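(* Let $\mathfrak g=\mathfrak g(A)$ with $A$ a symmetrizable generalized Cartan matrix. For all integral weights $\lambda_q$ with finite stabilizer in $W_{I_{L(\lambda_q)}}$, one has $$\operatorname{wt}L(\lambda_q)=\sum_{w\in W_{I_{L(\lambda_q)}}}w\,\frac{\lambda_q}{\prod_{\alpha\in\pi}(1-q^{-\alpha})},$$ where the left-hand side denotes the multiplicity-free character $\sum_{\mu_q:\,L(\lambda_q)_{\mu_q}\ne0}\mu_q$, and on the right-hand side each factor is given its highest weight expansion: for a simple root $\alpha\in\pi$, $w\frac1{1-q^{-\alpha}}$ means $1+q^{-w\alpha}+q^{-2w\alpha}+\cdots$ if $w\alpha>0$ and $-q^{w\alpha}-q^{2w\alpha}-\cdots$ if $w\alpha<0$.
   Context: Let $A=(a_{ij})_{i,j\in I}$ be a symmetrizable generalized Cartan matrix, $D=\operatorname{diag}(d_i)$ with $d_i\in\mathbb Z^{>0}$ and $DA$ symmetric, $(\mathfrak h,\pi=\{\alpha_i\},\{\check\alpha_i\})$ a realization of $A$, and $\mathfrak g=\mathfrak g(A)$ the Kac--Moody algebra. Fix a lattice $P^\vee\subset\mathfrak h$ with $\mathbb Z$-basis consisting of the $\check\alpha_i$ ($i\in I$) and elements $\check\beta_l$ ($1\le l\le|I|-\operatorname{rk}A$), with $P^\vee\otimes_{\mathbb Z}\mathbb C\simeq\mathfrak h$ and $(\check\beta_l,\alpha_i)\in\mathbb Z$; $P=\{\lambda\in\mathfrak h^*:(P^\vee,\lambda)\subset\mathbb Z\}$. $U_q(\mathfrak g)$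 is the $\mathbb C(q)$-algebra ($q$ an indeterminate) generated by $e_i,f_i$ ($i\in I$), $q^h$ ($h\in P^\vee$) with relations $q^0=1$, $q^hq^{h'}=q^{h+h'}$, $q^he_iq^{-h}=q^{(h,\alpha_i)}e_i$, $q^hf_iq^{-h}=q^{-(h,\alpha_i)}f_i$, $[e_i,f_j]=\delta_{ij}\frac{K_i-K_i^{-1}}{q_i-q_i^{-1}}$ with $K_i=q^{d_i\check\alpha_i}$, $q_i=q^{d_i}$, and the quantum Serre relations. A weight is a $\mathbb C(q)$-algebra homomorphism $\mu_q:\mathbb C(q)[q^{P^\vee}]\to\mathbb C(q)$; it is integral if it is of the form $q^\mu$, $\mu\in P$, with $q^\mu(q^h)=q^{(h,\mu)}$. $V_{\mu_q}=\{v:q^hv=\mu_q(q^h)v\ \forall h\in P^\vee\}$. $L(\lambda_q)$ is the simple highest weight $U_q(\mathfrak g)$-module of highest weight $\lambda_q$. $I_{L(\lambda_q)}=\{i\in I:\dim\mathbb C(q)[f_i]L(\lambda_q)_{\lambda_q}<\infty\}$. $W_J$ is the subgroup of the Weyl group generated by the $s_j$, $j\in J$, with $s_j\mu=\mu-(\check\alpha_j,\mu)\alpha_j$; it acts on integral weights by $w(q^\mu)=q^{w\mu}$. $w\alpha>0$ (resp. $<0$) means $w\alpha$ is a positive (resp. negative) root. The identity is one of formal, possibly infinite, sums of integral weights $q^\mu$, $\mu\in P$, with product $q^\mu q^\nu=q^{\mu+\nu}$. *)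

theory Defs
  imports
    "HOL-Analysis.Analysis"
    "HOL-Algebra.QuotRing"
    "HOL-Algebra.Bij"
    "HOL-Algebra.Generated_Groups"
    "HOL-Library.Poly_Mapping"
    "HOL-Library.Function_Algebras"
    "HOL-Computational_Algebra.Fraction_Field"
begin

section \<open>The Cartan datum\<close>

text \<open>
  The index set is a finite type \<open>'i\<close>, the Cartan subalgebra is a type \<open>'h\<close> with complex
  scalar multiplication \<open>scl\<close>.  Elements of the dual space are functions \<open>'h \<Rightarrow> complex\<close>, so the
  pairing \<open>(h, \<mu>)\<close> is \<open>\<mu> h\<close>.  Only \<open>beta l\<close> for \<open>1 \<le> l \<le> corank\<close> is relevant.
\<close>

record ('i, 'h) km_datum =
  cartan :: "'i \<Rightarrow> 'i \<Rightarrow> int"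
  symd :: "'i \<Rightarrow> int"
  scl :: "complex \<Rightarrow> 'h \<Rightarrow> 'h"
  sroot :: "'i \<Rightarrow> 'h \<Rightarrow> complex"
  coroot :: "'i \<Rightarrow> 'h"
  beta :: "nat \<Rightarrow> 'h"

definition gen_cartan_matrix :: "('i \<Rightarrow> 'i \<Rightarrow> int) \<Rightarrow> bool" where
  "gen_cartan_matrix a \<longleftrightarrow>
     (\<forall>i. a i i = 2) \<and> (\<forall>i j. i \<noteq> j \<longrightarrow> a i j \<le> 0) \<and> (\<forall>i j. a i j = 0 \<longleftrightarrow> a j i = 0)"

definition symmetrized_by :: "('i \<Rightarrow> 'i \<Rightarrow> int) \<Rightarrow> ('i \<Rightarrow> int) \<Rightarrow> bool" where
  "symmetrized_by a d \<longleftrightarrow> (\<forall>i. d i > 0) \<and> (\<forall>i j. d i * a i j = d j * a j i)"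

definition cartan_rank :: "('i::finite, 'h, 'z) km_datum_scheme \<Rightarrow> nat" where
  "cartan_rank D = rank ((\<chi> i j. of_int (cartan D i j)) :: complex^'i^'i)"

definition corank :: "('i::finite, 'h, 'z) km_datum_scheme \<Rightarrow> nat" where
  "corank D = CARD('i) - cartan_rank D"

definition dual_space :: "('i, 'h::ab_group_add, 'z) km_datum_scheme \<Rightarrow> ('h \<Rightarrow> complex) set" where
  "dual_space D = {\<mu>. Vector_Spaces.linear (scl D) (*) \<mu>}"

definition dual_scale :: "complex \<Rightarrow> ('h \<Rightarrow> complex) \<Rightarrow> 'h \<Rightarrow> complex" where
  "dual_scale c \<mu> = (\<lambda>h. c * \<mu> h)"

definition realization :: "('i::finite, 'h::ab_group_add, 'z) km_datum_scheme \<Rightarrow> bool" where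
  "realization D \<longleftrightarrow>
     vector_space (scl D) \<and>
     (\<exists>B. finite B \<and> module.span (scl D) B = UNIV) \<and>
     vector_space.dim (scl D) (UNIV :: 'h set) = 2 * CARD('i) - cartan_rank D \<and>
     range (sroot D) \<subseteq> dual_space D \<and>
     inj (sroot D) \<and> \<not> module.dependent dual_scale (range (sroot D)) \<and>
     inj (coroot D) \<and> \<not> module.dependent (scl D) (range (coroot D)) \<and>
     (\<forall>i j. sroot D j (coroot D i) = of_int (cartan D i j))"

definition lattice_index :: "('i::finite, 'h, 'z) km_datum_scheme \<Rightarrow> ('i + nat) set" where
  "lattice_index D = UNIV <+> {1..corank D}"

definition lattice_basis :: "('i, 'h, 'z) km_datum_scheme \<Rightarrow> 'i + nat \<Rightarrow> 'h" where
  "lattice_basis D = case_sum (coroot D) (beta D)"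

definition coweight_lattice :: "('i::finite, 'h::ab_group_add, 'z) km_datum_scheme \<Rightarrow> 'h set" where
  "coweight_lattice D =
     {\<Sum>s\<in>lattice_index D. scl D (of_int (c s)) (lattice_basis D s) | c. True}"

text \<open>
  That the integral span of the lattice basis is free on it and becomes the Cartan subalgebra after
  extension of scalars says exactly that the lattice basis is a complex basis.
\<close>

definition lattice_condition :: "('i::finite, 'h::ab_group_add, 'z) km_datum_scheme \<Rightarrow> bool" where
  "lattice_condition D \<longleftrightarrow>
     inj_on (lattice_basis D) (lattice_index D) \<and>
     \<not> module.dependent (scl D) (lattice_basis D ` lattice_index D) \<and>
     module.span (scl D) (lattice_basis D ` lattice_index D) = UNIV \<and>
     (\<forall>l\<in>{1..corank D}. \<forall>i. sroot D i (beta D l) \<in> \<int>)"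

definition symmetrizable_km_datum :: "('i::finite, 'h::ab_group_add, 'z) km_datum_scheme \<Rightarrow> bool" where
  "symmetrizable_km_datum D \<longleftrightarrow>
     gen_cartan_matrix (cartan D) \<and> symmetrized_by (cartan D) (symd D) \<and>
     realization D \<and> lattice_condition D"

definition weight_lattice :: "('i::finite, 'h::ab_group_add, 'z) km_datum_scheme \<Rightarrow> ('h \<Rightarrow> complex) set" where
  "weight_lattice D = {\<mu> \<in> dual_space D. \<forall>h\<in>coweight_lattice D. \<mu> h \<in> \<int>}"

definition ipair :: "'h \<Rightarrow> ('h \<Rightarrow> complex) \<Rightarrow> int" where
  "ipair h \<mu> = (THE n. \<mu> h = of_int n)"


section \<open>The Weyl group and the sign of real roots\<close>

definition simple_refl :: "('i, 'h::ab_group_add, 'z) km_datum_scheme \<Rightarrow> 'i \<Rightarrow> ('h \<Rightarrow> complex) \<Rightarrow> 'h \<Rightarrow> complex" where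
  "simple_refl D j = (\<lambda>\<mu>\<in>dual_space D. \<mu> - dual_scale (\<mu> (coroot D j)) (sroot D j))"

definition parabolic_weyl ::
    "('i, 'h::ab_group_add, 'z) km_datum_scheme \<Rightarrow> 'i set \<Rightarrow> (('h \<Rightarrow> complex) \<Rightarrow> 'h \<Rightarrow> complex) set" where
  "parabolic_weyl D J = generate (BijGroup (dual_space D)) (simple_refl D ` J)"

definition pos_cone :: "('i::finite, 'h, 'z) km_datum_scheme \<Rightarrow> ('h \<Rightarrow> complex) set" where
  "pos_cone D = {\<Sum>i\<in>UNIV. dual_scale (of_nat (n i)) (sroot D i) | n :: 'i \<Rightarrow> nat. True}"

text \<open>
  A root is positive if it lies in the cone of the simple roots.  Only Weyl group images of simple
  roots, that is real roots, have to be given a sign below.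
\<close>

definition real_roots :: "('i::finite, 'h::ab_group_add, 'z) km_datum_scheme \<Rightarrow> ('h \<Rightarrow> complex) set" where
  "real_roots D = {w (sroot D i) | w i. w \<in> parabolic_weyl D UNIV}"

definition pos_real_root :: "('i::finite, 'h::ab_group_add, 'z) km_datum_scheme \<Rightarrow> ('h \<Rightarrow> complex) \<Rightarrow> bool" where
  "pos_real_root D r \<longleftrightarrow> r \<in> real_roots D \<and> r \<in> pos_cone D"

definition neg_real_root :: "('i::finite, 'h::ab_group_add, 'z) km_datum_scheme \<Rightarrow> ('h \<Rightarrow> complex) \<Rightarrow> bool" where
  "neg_real_root D r \<longleftrightarrow> r \<in> real_roots D \<and> - r \<in> pos_cone D"


section \<open>The field of rational functions in \<open>q\<close> and quantum integers\<close>

type_synonym cq = "complex poly fract"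

definition qvar :: cq where
  "qvar = Fract [:0, 1:] 1"

definition qint :: "cq \<Rightarrow> nat \<Rightarrow> cq" where
  "qint x n = (x ^ n - inverse x ^ n) / (x - inverse x)"

definition qfact :: "cq \<Rightarrow> nat \<Rightarrow> cq" where
  "qfact x n = (\<Prod>k=1..n. qint x k)"

definition qbinom :: "cq \<Rightarrow> nat \<Rightarrow> nat \<Rightarrow> cq" where
  "qbinom x n k = qfact x n / (qfact x k * qfact x (n - k))"

definition qi :: "('i, 'h, 'z) km_datum_scheme \<Rightarrow> 'i \<Rightarrow> cq" where
  "qi D i = qvar powi symd D i"


section \<open>The quantum group by generators and relations\<close>

text \<open>
  Words form a monoid under concatenation (written additively), so finitely supported functions on
  words with convolution product form the free associative algebra.
\<close>

datatype 'g fword = FWord (letters: "'g list")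

instantiation fword :: (type) monoid_add
begin

definition zero_fword :: "'a fword" where
  "zero_fword = FWord []"

definition plus_fword :: "'a fword \<Rightarrow> 'a fword \<Rightarrow> 'a fword" where
  "plus_fword u v = FWord (letters u @ letters v)"

instance
  by standard (auto simp: zero_fword_def plus_fword_def)

end

type_synonym 'g falg = "'g fword \<Rightarrow>\<^sub>0 cq"

definition const :: "cq \<Rightarrow> ('k::zero \<Rightarrow>\<^sub>0 cq)" where
  "const c = Poly_Mapping.single 0 c"

definition gen :: "'g \<Rightarrow> 'g falg" where
  "gen g = Poly_Mapping.single (FWord [g]) 1"

definition free_algebra :: "'g set \<Rightarrow> 'g falg ring" where
  "free_algebra G =
     \<lparr>carrier = {p. \<forall>w\<in>Poly_Mapping.keys p. set (letters w) \<subseteq> G},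
      mult = (*), one = 1, zero = 0, add = (+)\<rparr>"

lemma ring_free_algebra:
  fixes G :: "'g set"
  shows "ring (free_algebra G)"
proof -
  let ?C = "{p :: 'g falg. \<forall>w\<in>Poly_Mapping.keys p. set (letters w) \<subseteq> G}"
  have sum_closed: "p + p' \<in> ?C" if "p \<in> ?C" "p' \<in> ?C" for p p'
    using that Poly_Mapping.keys_add[of p p'] by blast
  have prod_closed: "p * p' \<in> ?C" if "p \<in> ?C" "p' \<in> ?C" for p p'
  proof -
    have "set (letters w) \<subseteq> G" if w: "w \<in> Poly_Mapping.keys (p * p')" for w
    proof -
      obtain a b where "w = a + b" "a \<in> Poly_Mapping.keys p" "b \<in> Poly_Mapping.keys p'"
        using keys_mult[of p p'] w by blast
      then show ?thesis
        using \<open>p \<in> ?C\<close> \<open>p' \<in> ?C\<close> by (auto simp: plus_fword_def)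
    qed
    then show ?thesis by blast
  qed
  have one: "1 \<in> ?C"
    by (auto simp: keys_one zero_fword_def)
  have "- p \<in> ?C" if "p \<in> ?C" for p
    using that by simp
  then have neg: "\<exists>p'\<in>?C. p' + p = 0" if "p \<in> ?C" for p
    using that by (meson add.left_inverse)
  have zero: "0 \<in> ?C"
    by simp
  have ops: "carrier (free_algebra G) = ?C" "mult (free_algebra G) = (*)" "ring.add (free_algebra G) = (+)"
      "monoid.one (free_algebra G) = 1" "ring.zero (free_algebra G) = 0"
    by (simp_all add: free_algebra_def)
  show ?thesis
  proof (rule ringI)
    show "abelian_group (free_algebra G)"
      by (rule abelian_groupI; unfold ops) (fact zero | erule (1) sum_closed | erule neg | simp only: add_0_left add_0_right | simp only: ac_simps)+
    show "Group.monoid (free_algebra G)"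
      by (rule monoidI; unfold ops) (fact one | erule (1) prod_closed | simp only: mult.assoc mult_1_left mult_1_right)+
  qed (unfold ops, simp_all only: distrib_left distrib_right)
qed

datatype ('i, 'h) uq_gen = Eg 'i | Fg 'i | Kg 'h

definition uq_gens :: "('i::finite, 'h::ab_group_add, 'z) km_datum_scheme \<Rightarrow> ('i, 'h) uq_gen set" where
  "uq_gens D = range Eg \<union> range Fg \<union> Kg ` coweight_lattice D"

definition uq_Ki :: "('i, 'h::ab_group_add, 'z) km_datum_scheme \<Rightarrow> 'i \<Rightarrow> ('i, 'h) uq_gen falg" where
  "uq_Ki D i = gen (Kg (scl D (of_int (symd D i)) (coroot D i)))"

definition uq_Ki_inv :: "('i, 'h::ab_group_add, 'z) km_datum_scheme \<Rightarrow> 'i \<Rightarrow> ('i, 'h) uq_gen falg" where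
  "uq_Ki_inv D i = gen (Kg (- scl D (of_int (symd D i)) (coroot D i)))"

definition serre :: "('i, 'h, 'z) km_datum_scheme \<Rightarrow> ('i \<Rightarrow> ('i, 'h) uq_gen) \<Rightarrow> 'i \<Rightarrow> 'i \<Rightarrow> ('i, 'h) uq_gen falg" where
  "serre D X i j =
     (let N = nat (1 - cartan D i j) in
      \<Sum>s\<le>N. const ((- 1) ^ s * qbinom (qi D i) N s) * gen (X i) ^ (N - s) * gen (X j) * gen (X i) ^ s)"

definition uq_relators :: "('i::finite, 'h::ab_group_add, 'z) km_datum_scheme \<Rightarrow> ('i, 'h) uq_gen falg set" where
  "uq_relators D =
     {gen (Kg 0) - 1} \<union>
     {gen (Kg h) * gen (Kg h') - gen (Kg (h + h')) | h h'.
        h \<in> coweight_lattice D \<and> h' \<in> coweight_lattice D} \<union>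
     {gen (Kg h) * gen (Eg i) * gen (Kg (- h)) - const (qvar powi ipair h (sroot D i)) * gen (Eg i) | h i.
        h \<in> coweight_lattice D} \<union>
     {gen (Kg h) * gen (Fg i) * gen (Kg (- h)) - const (qvar powi (- ipair h (sroot D i))) * gen (Fg i) | h i.
        h \<in> coweight_lattice D} \<union>
     {gen (Eg i) * gen (Fg j) - gen (Fg j) * gen (Eg i)
        - (if i = j then const (1 / (qi D i - inverse (qi D i))) * (uq_Ki D i - uq_Ki_inv D i) else 0) | i j. True} \<union>
     {serre D Eg i j | i j. i \<noteq> j} \<union>
     {serre D Fg i j | i j. i \<noteq> j}"

lemma coweight_lattice_closed:
  fixes D :: "('i::finite, 'h::ab_group_add, 'z) km_datum_scheme"
  assumes D: "symmetrizable_km_datum D"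
  shows "0 \<in> coweight_lattice D"
    and "h \<in> coweight_lattice D \<Longrightarrow> h' \<in> coweight_lattice D \<Longrightarrow> h + h' \<in> coweight_lattice D"
    and "h \<in> coweight_lattice D \<Longrightarrow> - h \<in> coweight_lattice D"
    and "scl D (of_int n) (coroot D i) \<in> coweight_lattice D"
proof -
  interpret vector_space "scl D"
    using D by (simp add: symmetrizable_km_datum_def realization_def)
  have fin: "finite (lattice_index D)"
    by (simp add: lattice_index_def)
  have memI: "h \<in> coweight_lattice D"
    if "h = (\<Sum>s\<in>lattice_index D. scl D (of_int (c s)) (lattice_basis D s))" for h c
    using that by (auto simp: coweight_lattice_def)
  show "0 \<in> coweight_lattice D"
    by (rule memI[where c = "\<lambda>_. 0"]) simp
  show "h + h' \<in> coweight_lattice D" if h: "h \<in> coweight_lattice D" "h' \<in> coweight_lattice D"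
  proof -
    obtain c c' where "h = (\<Sum>s\<in>lattice_index D. scl D (of_int (c s)) (lattice_basis D s))"
      "h' = (\<Sum>s\<in>lattice_index D. scl D (of_int (c' s)) (lattice_basis D s))"
      using h unfolding coweight_lattice_def by blast
    then show ?thesis
      by (intro memI[where c = "\<lambda>s. c s + c' s"]) (simp add: scale_left_distrib sum.distrib)
  qed
  show "- h \<in> coweight_lattice D" if h: "h \<in> coweight_lattice D"
  proof -
    obtain c where "h = (\<Sum>s\<in>lattice_index D. scl D (of_int (c s)) (lattice_basis D s))"
      using h unfolding coweight_lattice_def by blast
    then show ?thesis
      by (intro memI[where c = "\<lambda>s. - c s"]) (simp add: sum_negf)
  qed
  have "(\<Sum>s\<in>lattice_index D. scl D (of_int (if s = Inl i then n else 0)) (lattice_basis D s))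
      = (\<Sum>s\<in>lattice_index D. if s = Inl i then scl D (of_int n) (lattice_basis D s) else 0)"
    by (intro sum.cong) auto
  also have "\<dots> = scl D (of_int n) (coroot D i)"
    using fin by (auto simp: sum.delta lattice_index_def lattice_basis_def)
  finally show "scl D (of_int n) (coroot D i) \<in> coweight_lattice D"
    by (intro memI[where c = "\<lambda>s. if s = Inl i then n else 0"]) simp
qed

text \<open>
  \<open>genideal\<close> is only meaningful for subsets of the carrier; otherwise it is the universal set.
\<close>

lemma uq_relators_in_carrier:
  fixes D :: "('i::finite, 'h::ab_group_add, 'z) km_datum_scheme"
  assumes D: "symmetrizable_km_datum D"
  shows "uq_relators D \<subseteq> carrier (free_algebra (uq_gens D))"
proof -
  define C where "C = carrier (free_algebra (uq_gens D))"
  interpret ring "free_algebra (uq_gens D)"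
    by (rule ring_free_algebra)
  have ops: "mult (free_algebra (uq_gens D)) = (*)" "ring.add (free_algebra (uq_gens D)) = (+)"
    "monoid.one (free_algebra (uq_gens D)) = 1" "ring.zero (free_algebra (uq_gens D)) = 0"
    by (simp_all add: free_algebra_def)
  have plus: "p + p' \<in> C" if "p \<in> C" "p' \<in> C" for p p'
    using add.m_closed that unfolding ops C_def by blast
  have times: "p * p' \<in> C" if "p \<in> C" "p' \<in> C" for p p'
    using m_closed that unfolding ops C_def by blast
  have one: "1 \<in> C"
    using one_closed unfolding ops C_def .
  have zero: "0 \<in> C"
    using zero_closed unfolding ops C_def .
  have minus: "p - p' \<in> C" if "p \<in> C" "p' \<in> C" for p p'
  proof -
    have "- p' \<in> C" using that(2) by (simp add: C_def free_algebra_def)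
    then show ?thesis using plus[OF that(1)] by fastforce
  qed
  have power: "p ^ n \<in> C" if "p \<in> C" for p n
    by (induction n) (simp_all add: one times that)
  have sum: "(\<Sum>s\<in>S. f s) \<in> C" if "\<And>s. f s \<in> C" for f and S :: "nat set"
    by (induction S rule: infinite_finite_induct) (simp_all add: zero plus that)
  have const: "const c \<in> C" for c
    by (simp add: C_def free_algebra_def const_def zero_fword_def)
  have gen: "gen g \<in> C" if "g \<in> uq_gens D" for g
    using that by (simp add: C_def free_algebra_def gen_def)
  have E: "gen (Eg i) \<in> C" and F: "gen (Fg i) \<in> C" for i
    by (auto intro!: gen simp: uq_gens_def)
  have K: "gen (Kg h) \<in> C" if "h \<in> coweight_lattice D" for h
    using that by (auto intro!: gen simp: uq_gens_def)
  have Ki: "uq_Ki D i \<in> C" "uq_Ki_inv D i \<in> C" for i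
    unfolding uq_Ki_def uq_Ki_inv_def by (intro K coweight_lattice_closed D)+
  have serre: "serre D X i j \<in> C" if "\<And>i. gen (X i) \<in> C" for X i j
    unfolding serre_def Let_def by (intro sum times power const that)
  have "uq_relators D \<subseteq> C"
    unfolding uq_relators_def
    by (intro Un_least subsetI; elim CollectE exE conjE insertE emptyE; hypsubst)
       (auto split: if_splits intro!: minus plus times one zero E F K Ki const
          serre[of Eg] serre[of Fg] coweight_lattice_closed[OF D])
  then show ?thesis by (simp add: C_def)
qed

definition uq_ideal :: "('i::finite, 'h::ab_group_add, 'z) km_datum_scheme \<Rightarrow> ('i, 'h) uq_gen falg set" where
  "uq_ideal D = genideal (free_algebra (uq_gens D)) (uq_relators D)"

definition uq :: "('i::finite, 'h::ab_group_add, 'z) km_datum_scheme \<Rightarrow> ('i, 'h) uq_gen falg set ring" where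
  "uq D = FactRing (free_algebra (uq_gens D)) (uq_ideal D)"

definition uq_class :: "('i::finite, 'h::ab_group_add, 'z) km_datum_scheme \<Rightarrow> ('i, 'h) uq_gen falg \<Rightarrow> ('i, 'h) uq_gen falg set" where
  "uq_class D p = uq_ideal D +>\<^bsub>free_algebra (uq_gens D)\<^esub> p"


section \<open>Modules, weights and weight spaces\<close>

definition left_module :: "('r, 'z) ring_scheme \<Rightarrow> ('r \<Rightarrow> 'v \<Rightarrow> 'v::ab_group_add) \<Rightarrow> bool" where
  "left_module R act \<longleftrightarrow>
     (\<forall>a\<in>carrier R. \<forall>v v'. act a (v + v') = act a v + act a v') \<and>
     (\<forall>a\<in>carrier R. \<forall>b\<in>carrier R. \<forall>v. act (a \<oplus>\<^bsub>R\<^esub> b) v = act a v + act b v) \<and>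
     (\<forall>a\<in>carrier R. \<forall>b\<in>carrier R. \<forall>v. act (a \<otimes>\<^bsub>R\<^esub> b) v = act a (act b v)) \<and>
     (\<forall>v. act \<one>\<^bsub>R\<^esub> v = v)"

definition submodule_of :: "('r, 'z) ring_scheme \<Rightarrow> ('r \<Rightarrow> 'v \<Rightarrow> 'v::ab_group_add) \<Rightarrow> 'v set \<Rightarrow> bool" where
  "submodule_of R act N \<longleftrightarrow>
     0 \<in> N \<and> (\<forall>v\<in>N. \<forall>v'\<in>N. v + v' \<in> N) \<and> (\<forall>a\<in>carrier R. \<forall>v\<in>N. act a v \<in> N)"

definition simple_left_module :: "('r, 'z) ring_scheme \<Rightarrow> ('r \<Rightarrow> 'v \<Rightarrow> 'v::ab_group_add) \<Rightarrow> bool" where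
  "simple_left_module R act \<longleftrightarrow>
     left_module R act \<and> (UNIV :: 'v set) \<noteq> {0} \<and>
     (\<forall>N. submodule_of R act N \<longrightarrow> N = {0} \<or> N = UNIV)"

definition scalar_act ::
    "('i::finite, 'h::ab_group_add, 'z) km_datum_scheme \<Rightarrow> (('i, 'h) uq_gen falg set \<Rightarrow> 'v \<Rightarrow> 'v) \<Rightarrow> cq \<Rightarrow> 'v \<Rightarrow> 'v" where
  "scalar_act D act c = act (uq_class D (const c))"

text \<open>The group algebra of the coweight lattice; \<open>q^h\<close> is \<open>Poly_Mapping.single h 1\<close>.\<close>

definition torus_algebra :: "('i::finite, 'h::ab_group_add, 'z) km_datum_scheme \<Rightarrow> ('h \<Rightarrow>\<^sub>0 cq) set" where
  "torus_algebra D = {p. Poly_Mapping.keys p \<subseteq> coweight_lattice D}"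

text \<open>Homomorphisms are extensional, so that distinct functions are distinct weights.\<close>

definition weights :: "('i::finite, 'h::ab_group_add, 'z) km_datum_scheme \<Rightarrow> (('h \<Rightarrow>\<^sub>0 cq) \<Rightarrow> cq) set" where
  "weights D = {m \<in> extensional (torus_algebra D).
     m 1 = 1 \<and>
     (\<forall>p\<in>torus_algebra D. \<forall>p'\<in>torus_algebra D. m (p + p') = m p + m p' \<and> m (p * p') = m p * m p') \<and>
     (\<forall>c. \<forall>p\<in>torus_algebra D. m (const c * p) = c * m p)}"

definition qwt :: "('i::finite, 'h::ab_group_add, 'z) km_datum_scheme \<Rightarrow> ('h \<Rightarrow> complex) \<Rightarrow> ('h \<Rightarrow>\<^sub>0 cq) \<Rightarrow> cq" where
  "qwt D \<mu> = (\<lambda>p\<in>torus_algebra D.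
     \<Sum>h\<in>Poly_Mapping.keys p. Poly_Mapping.lookup p h * qvar powi ipair h \<mu>)"

definition integral_weights :: "('i::finite, 'h::ab_group_add, 'z) km_datum_scheme \<Rightarrow> (('h \<Rightarrow>\<^sub>0 cq) \<Rightarrow> cq) set" where
  "integral_weights D = qwt D ` weight_lattice D"

definition weight_space ::
    "('i::finite, 'h::ab_group_add, 'z) km_datum_scheme \<Rightarrow> (('i, 'h) uq_gen falg set \<Rightarrow> 'v \<Rightarrow> 'v)
       \<Rightarrow> (('h \<Rightarrow>\<^sub>0 cq) \<Rightarrow> cq) \<Rightarrow> 'v set" where
  "weight_space D act m =
     {v. \<forall>h\<in>coweight_lattice D.
        act (uq_class D (gen (Kg h))) v = scalar_act D act (m (Poly_Mapping.single h 1)) v}"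

definition highest_weight_module ::
    "('i::finite, 'h::ab_group_add, 'z) km_datum_scheme \<Rightarrow> (('i, 'h) uq_gen falg set \<Rightarrow> 'v \<Rightarrow> 'v::ab_group_add)
       \<Rightarrow> (('h \<Rightarrow>\<^sub>0 cq) \<Rightarrow> cq) \<Rightarrow> bool" where
  "highest_weight_module D act m \<longleftrightarrow>
     left_module (uq D) act \<and>
     (\<exists>v\<in>weight_space D act m. v \<noteq> 0 \<and>
        (\<forall>i. act (uq_class D (gen (Eg i))) v = 0) \<and>
        {act u v | u. u \<in> carrier (uq D)} = UNIV)"

text \<open>
  The module \<open>L(m)\<close>, which is unique up to isomorphism, is any module with this property.
\<close>

definition simple_highest_weight_module ::
    "('i::finite, 'h::ab_group_add, 'z) km_datum_scheme \<Rightarrow> (('i, 'h) uq_gen falg set \<Rightarrow> 'v \<Rightarrow> 'v::ab_group_add)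
       \<Rightarrow> (('h \<Rightarrow>\<^sub>0 cq) \<Rightarrow> cq) \<Rightarrow> bool" where
  "simple_highest_weight_module D act m \<longleftrightarrow>
     simple_left_module (uq D) act \<and> highest_weight_module D act m"

definition fi_orbit ::
    "('i::finite, 'h::ab_group_add, 'z) km_datum_scheme \<Rightarrow> (('i, 'h) uq_gen falg set \<Rightarrow> 'v \<Rightarrow> 'v::ab_group_add)
       \<Rightarrow> (('h \<Rightarrow>\<^sub>0 cq) \<Rightarrow> cq) \<Rightarrow> 'i \<Rightarrow> 'v set" where
  "fi_orbit D act m i =
     {act (uq_class D (\<Sum>k\<le>n. const (c k) * gen (Fg i) ^ k)) v | (n :: nat) c v. v \<in> weight_space D act m}"

definition integrability ::
    "('i::finite, 'h::ab_group_add, 'z) km_datum_scheme \<Rightarrow> (('i, 'h) uq_gen falg set \<Rightarrow> 'v \<Rightarrow> 'v::ab_group_add)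
       \<Rightarrow> (('h \<Rightarrow>\<^sub>0 cq) \<Rightarrow> cq) \<Rightarrow> 'i set" where
  "integrability D act m =
     {i. \<exists>B. finite B \<and> fi_orbit D act m i \<subseteq> module.span (scalar_act D act) B}"


section \<open>Formal sums of integral weights\<close>

text \<open>
  A formal sum is its coefficient function: its value at \<open>\<mu>\<close> is the coefficient of \<open>q^\<mu>\<close>.
\<close>

type_synonym 'h fsum = "('h \<Rightarrow> complex) \<Rightarrow> int"

definition wt_char ::
    "('i::finite, 'h::ab_group_add, 'z) km_datum_scheme \<Rightarrow> (('i, 'h) uq_gen falg set \<Rightarrow> 'v \<Rightarrow> 'v::ab_group_add)
       \<Rightarrow> 'h fsum" where
  "wt_char D act \<mu> = (if weight_space D act (qwt D \<mu>) \<noteq> {0} then 1 else 0)"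

definition hw_expansion :: "('i::finite, 'h::ab_group_add, 'z) km_datum_scheme \<Rightarrow> ('h \<Rightarrow> complex) \<Rightarrow> 'h fsum" where
  "hw_expansion D r =
     (if pos_real_root D r then
        (\<lambda>\<nu>. if \<exists>k::nat. \<nu> = - dual_scale (of_nat k) r then 1 else 0)
      else if neg_real_root D r then
        (\<lambda>\<nu>. if \<exists>k::nat. k \<ge> 1 \<and> \<nu> = dual_scale (of_nat k) r then - 1 else 0)
      else (\<lambda>\<nu>. 0))"

definition prod_families :: "('i::finite \<Rightarrow> 'h fsum) \<Rightarrow> ('h \<Rightarrow> complex) \<Rightarrow> ('i \<Rightarrow> 'h \<Rightarrow> complex) set" where
  "prod_families F \<mu> = {\<nu>. (\<forall>i. F i (\<nu> i) \<noteq> 0) \<and> (\<Sum>i\<in>UNIV. \<nu> i) = \<mu>}"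

text \<open>
  The product of the \<open>F i\<close>, multiplied out.  For highest weight expansions the families contributing
  to a given coefficient are finite in number; see \<open>finite_prod_families\<close>.
\<close>

definition fsum_prod :: "('i::finite \<Rightarrow> 'h fsum) \<Rightarrow> 'h fsum" where
  "fsum_prod F \<mu> = (\<Sum>\<nu>\<in>prod_families F \<mu>. \<Prod>i\<in>UNIV. F i (\<nu> i))"

lemma finite_prod_families:
  fixes D :: "('i::finite, 'h::ab_group_add, 'z) km_datum_scheme"
  assumes D: "symmetrizable_km_datum D"
  shows "finite (prod_families (\<lambda>i::'i. hw_expansion D (r i)) \<mu>)"
proof -
  define \<phi> where "\<phi> n = (\<Sum>i\<in>UNIV. dual_scale (of_nat (n i)) (sroot D i))" for n :: "'i \<Rightarrow> nat"
  interpret dual: vector_space "dual_scale :: complex \<Rightarrow> ('h \<Rightarrow> complex) \<Rightarrow> 'h \<Rightarrow> complex"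
    by unfold_locales (auto simp: dual_scale_def fun_eq_iff algebra_simps)
  have inj: "inj (sroot D)" and indep: "dual.independent (range (sroot D))"
    using D by (auto simp: symmetrizable_km_datum_def realization_def)
  have \<phi>_inj: "n = n'" if "\<phi> n = \<phi> n'" for n n'
  proof -
    have "(\<Sum>i\<in>UNIV. dual_scale (of_nat (n i) - of_nat (n' i)) (sroot D i)) = 0"
      using that by (simp add: \<phi>_def dual.scale_left_diff_distrib sum_subtractf)
    then have "(\<Sum>v\<in>range (sroot D).
        dual_scale (of_nat (n (inv_into UNIV (sroot D) v)) - of_nat (n' (inv_into UNIV (sroot D) v))) v) = 0"
      by (simp add: sum.reindex[OF inj] inj)
    then have "of_nat (n i) - of_nat (n' i) = (0::complex)" for i
      using dual.independentD[OF indep _ subset_refl, of _ "sroot D i"] inj by force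
    then show ?thesis by auto
  qed
  have \<phi>_scale: "dual_scale (of_nat k) (\<phi> n) = \<phi> (\<lambda>i. k * n i)" for k n
    by (simp add: \<phi>_def dual.scale_sum_right)
  have \<phi>_sum: "(\<Sum>i\<in>UNIV. \<phi> (N i)) = \<phi> (\<lambda>j. \<Sum>i\<in>UNIV. N i j)" for N :: "'i \<Rightarrow> 'i \<Rightarrow> nat"
  proof -
    have "(\<Sum>i\<in>UNIV. \<phi> (N i))
        = (\<Sum>j\<in>UNIV. \<Sum>i\<in>UNIV. dual_scale (of_nat (N i j)) (sroot D j))"
      unfolding \<phi>_def by (rule sum.swap)
    also have "\<dots> = \<phi> (\<lambda>j. \<Sum>i\<in>UNIV. N i j)"
      by (simp add: \<phi>_def dual.scale_sum_left)
    finally show ?thesis .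
  qed
  have supp: "\<exists>n. \<nu> = - \<phi> n" if nz: "hw_expansion D s \<nu> \<noteq> 0" for s \<nu>
  proof (cases "pos_real_root D s")
    case True
    then obtain k n where "\<nu> = - dual_scale (of_nat k) s" "s = \<phi> n"
      using nz by (auto simp: hw_expansion_def pos_real_root_def pos_cone_def \<phi>_def split: if_splits)
    then show ?thesis using \<phi>_scale by auto
  next
    case False
    then have neg: "neg_real_root D s" and "\<exists>k::nat. \<nu> = dual_scale (of_nat k) s"
      using nz by (auto simp: hw_expansion_def split: if_splits)
    then obtain k :: nat where k: "\<nu> = dual_scale (of_nat k) s" by blast
    obtain n where "- s = \<phi> n"
      using neg by (auto simp: neg_real_root_def pos_cone_def \<phi>_def)
    then have "s = - \<phi> n" by (metis minus_minus)
    then have "\<nu> = - dual_scale (of_nat k) (\<phi> n)" using k by simp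
    then show ?thesis using \<phi>_scale by auto
  qed
  show ?thesis
  proof (cases "prod_families (\<lambda>i. hw_expansion D (r i)) \<mu> = {}")
    case False
    have fam: "\<exists>N. \<nu> = (\<lambda>i. - \<phi> (N i)) \<and> \<mu> = - \<phi> (\<lambda>j. \<Sum>i\<in>UNIV. N i j)"
      if "\<nu> \<in> prod_families (\<lambda>i. hw_expansion D (r i)) \<mu>" for \<nu>
    proof -
      have "\<forall>i. \<exists>n. \<nu> i = - \<phi> n"
        using that supp by (auto simp: prod_families_def)
      then obtain N where N: "\<And>i. \<nu> i = - \<phi> (N i)" by metis
      moreover have "(\<Sum>i\<in>UNIV. \<nu> i) = \<mu>"
        using that by (auto simp: prod_families_def)
      ultimately have "\<mu> = - \<phi> (\<lambda>j. \<Sum>i\<in>UNIV. N i j)"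
        by (simp add: sum_negf \<phi>_sum)
      then show ?thesis using N by blast
    qed
    obtain M where M: "\<mu> = - \<phi> M" using False fam by blast
    have "prod_families (\<lambda>i. hw_expansion D (r i)) \<mu>
        \<subseteq> (\<lambda>N i. - \<phi> (N i)) ` (UNIV \<rightarrow>\<^sub>E (UNIV \<rightarrow>\<^sub>E {..Max (range M)}))"
    proof
      fix \<nu> assume "\<nu> \<in> prod_families (\<lambda>i. hw_expansion D (r i)) \<mu>"
      then obtain N where N: "\<nu> = (\<lambda>i. - \<phi> (N i))" "\<mu> = - \<phi> (\<lambda>j. \<Sum>i\<in>UNIV. N i j)"
        using fam by blast
      have MN: "M = (\<lambda>j. \<Sum>i\<in>UNIV. N i j)"
        using M N(2) by (intro \<phi>_inj) simp
      have "N i j \<le> M j" for i j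
        unfolding MN by (rule member_le_sum) auto
      moreover have "M j \<le> Max (range M)" for j by simp
      ultimately have "N i j \<le> Max (range M)" for i j by (meson order_trans)
      then show "\<nu> \<in> (\<lambda>N i. - \<phi> (N i)) ` (UNIV \<rightarrow>\<^sub>E (UNIV \<rightarrow>\<^sub>E {..Max (range M)}))"
        using N(1) by (intro image_eqI[of _ _ N]) auto
    qed
    then show ?thesis
      by (rule finite_subset) (intro finite_imageI finite_PiE finite; simp)
  qed simp
qed

text \<open>The product of the monomial \<open>q^\<nu>\<close> with a formal sum.\<close>

definition fsum_shift :: "('h \<Rightarrow> complex) \<Rightarrow> 'h fsum \<Rightarrow> 'h fsum" where
  "fsum_shift \<nu> f \<mu> = f (\<mu> - \<nu>)"

definition weyl_summand ::
    "('i::finite, 'h::ab_group_add, 'z) km_datum_scheme \<Rightarrow> ('h \<Rightarrow> complex)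
       \<Rightarrow> (('h \<Rightarrow> complex) \<Rightarrow> 'h \<Rightarrow> complex) \<Rightarrow> 'h fsum" where
  "weyl_summand D lam w =
     fsum_shift (w lam) (fsum_prod (\<lambda>i. hw_expansion D (w (sroot D i))))"

definition is_formal_sum ::
    "('i::finite, 'h::ab_group_add, 'z) km_datum_scheme \<Rightarrow> ('x \<Rightarrow> 'h fsum) \<Rightarrow> 'x set \<Rightarrow> 'h fsum \<Rightarrow> bool" where
  "is_formal_sum D f S g \<longleftrightarrow>
     (\<forall>\<mu>\<in>weight_lattice D.
        finite {x\<in>S. f x \<mu> \<noteq> 0} \<and> g \<mu> = (\<Sum>x\<in>{x\<in>S. f x \<mu> \<noteq> 0}. f x \<mu>))"

end

theory Submission
  imports Defs
begin

text \<open>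
  The coefficient of \<open>q^\<mu>\<close> in the summand of \<open>w\<close> is \<open>(-1)^|D(w)|\<close> if the set of negative simple root
  coordinates of \<open>\<lambda> - w\<inverse>\<mu>\<close> is exactly the descent set \<open>D(w) = {i. w\<alpha>\<^sub>i < 0}\<close>, and \<open>0\<close> otherwise.
  If the whole orbit of \<open>\<mu>\<close> lies below \<open>\<lambda>\<close>, there are no negative coordinates and only \<open>w = 1\<close>
  contributes. Otherwise some \<open>w\<mu>\<close> is not below \<open>\<lambda>\<close>, where all coefficients vanish, and the sum is
  invariant under \<open>\<mu> \<mapsto> s\<^sub>j\<mu>\<close> because the contributions of \<open>w\<close> and \<open>s\<^sub>jw\<close> combine. So the right-hand
  side is the indicator function of the \<open>\<mu>\<close> whose orbit lies below \<open>\<lambda>\<close>.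

  On the module side, \<open>f\<^sub>i\<close> is locally nilpotent for integrable \<open>i\<close> and injective otherwise, so the
  weights are stable under the parabolic Weyl group by rank one theory. It remains to see that
  every dominant \<open>\<mu>\<close> below \<open>\<lambda>\<close> is a weight, which is where the finiteness of the stabilizer enters.
\<close>

section \<open>Simple reflections on the dual space\<close>

text \<open>The expansion of a factor depends on the sign of \<open>w\<alpha>\<^sub>i\<close>, so
  \<open>s\<^sub>j\<close> does not simply permute the summands. But a reflection
  \<open>s\<^sub>j\<close> keeps the sign of every \<open>w\<alpha>\<^sub>i\<close> other than
  \<alpha> with index \<open>j\<close> and its negative, so \<open>w\<close> and
  \<open>s\<^sub>jw\<close> have the same descents unless some \<open>w\<alpha>\<^sub>i\<close> is
  one of these two. In the exceptional case \<open>s\<^sub>jw = ws\<^sub>i\<close>, and the two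
  coefficients see only one coordinate and its mirror image. This rests on every
  \<open>w\<alpha>\<^sub>i\<close> being positive or negative, which is obtained from word lengths
  by reduction to dihedral groups, with no root spaces involved. That \<open>f\<^sub>i\<close> is
  either locally nilpotent or injective comes from simplicity: the vectors killed by some power of
  \<open>f\<^sub>i\<close> form a submodule. Finiteness of the stabilizer also makes each
  coefficient on the right-hand side a finite sum: a nonzero coefficient at \<mu> forces
  \<open>w\<lambda>\<close> to lie between \<mu> and \<lambda>, which leaves finitely many values
  \<open>w\<lambda>\<close>, each attained on a coset of the stabilizer.\<close>

locale km_setting =
  fixes D :: "('i::finite, 'h::ab_group_add) km_datum"
  assumes datum: "symmetrizable_km_datum D"
begin

abbreviation "al \<equiv> sroot D"
abbreviation "co \<equiv> coroot D"
abbreviation "cm \<equiv> cartan D"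

definition phi :: "('i \<Rightarrow> int) \<Rightarrow> 'h \<Rightarrow> complex" where
  "phi c = (\<lambda>h. \<Sum>i\<in>UNIV. of_int (c i) * al i h)"

definition unit_vec :: "'i \<Rightarrow> 'i \<Rightarrow> int" where
  "unit_vec i = (\<lambda>k. if k = i then 1 else 0)"

definition cpair :: "'i \<Rightarrow> ('i \<Rightarrow> int) \<Rightarrow> int" where
  "cpair j c = (\<Sum>k\<in>UNIV. cm j k * c k)"

text \<open>
  Unlike \<open>simple_refl\<close>, the reflections act on all functions and not just on the dual space, so that
  words in them are plain compositions. No group element is lost, see \<open>rst_inj\<close> below.
\<close>

definition refl :: "'i \<Rightarrow> ('h \<Rightarrow> complex) \<Rightarrow> 'h \<Rightarrow> complex" where
  "refl j \<mu> = \<mu> - dual_scale (\<mu> (co j)) (al j)"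

definition rw :: "'i list \<Rightarrow> ('h \<Rightarrow> complex) \<Rightarrow> 'h \<Rightarrow> complex" where
  "rw ws = foldr refl ws"

definition wgrp :: "'i set \<Rightarrow> (('h \<Rightarrow> complex) \<Rightarrow> 'h \<Rightarrow> complex) set" where
  "wgrp J = rw ` lists J"

lemma cartan_props:
  "cm i i = 2" "i \<noteq> j \<Longrightarrow> cm i j \<le> 0" "cm i j = 0 \<longleftrightarrow> cm j i = 0"
  "symd D i > 0" "symd D i * cm i j = symd D j * cm j i"
  using datum
  by (auto simp: symmetrizable_km_datum_def gen_cartan_matrix_def symmetrized_by_def)

lemma sroot_coroot: "al j (co i) = of_int (cm i j)"
  and sroot_dual: "al i \<in> dual_space D"
  using datum by (auto simp: symmetrizable_km_datum_def realization_def)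

lemma vs_scl: "vector_space (scl D)"
  using datum by (auto simp: symmetrizable_km_datum_def realization_def)

lemma phi_add: "phi (\<lambda>i. c i + d i) = phi c + phi d"
  by (simp add: phi_def fun_eq_iff algebra_simps sum.distrib)

lemma phi_diff: "phi (\<lambda>i. c i - d i) = phi c - phi d"
  by (simp add: phi_def fun_eq_iff algebra_simps sum_subtractf)

lemma phi_minus: "phi (\<lambda>i. - c i) = - phi c"
  by (simp add: phi_def fun_eq_iff sum_negf)

lemma phi_scale: "phi (\<lambda>i. k * c i) = dual_scale (of_int k) (phi c)"
  by (simp add: phi_def dual_scale_def fun_eq_iff algebra_simps sum_distrib_left)

lemma phi_unit: "phi (unit_vec i) = al i"
proof
  fix h
  have "(\<Sum>j\<in>UNIV. of_int (unit_vec i j) * al j h) = (\<Sum>j\<in>UNIV. if j = i then al j h else 0)"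
    by (intro sum.cong) (auto simp: unit_vec_def)
  then show "phi (unit_vec i) h = al i h" by (simp add: phi_def)
qed

lemma phi_sum: "phi (\<lambda>i. \<Sum>x\<in>S. c x i) = (\<Sum>x\<in>S. phi (c x))"
proof (induction S rule: infinite_finite_induct)
  case (insert x F)
  then show ?case by (simp add: phi_add)
qed (auto simp: phi_def fun_eq_iff)

lemma phi_eq_0: "phi c = 0 \<Longrightarrow> c = (\<lambda>_. 0)"
proof -
  assume c: "phi c = 0"
  interpret dual: vector_space "dual_scale :: complex \<Rightarrow> ('h \<Rightarrow> complex) \<Rightarrow> 'h \<Rightarrow> complex"
    by unfold_locales (auto simp: dual_scale_def fun_eq_iff algebra_simps)
  have inj: "inj al" and indep: "dual.independent (range al)"
    using datum by (auto simp: symmetrizable_km_datum_def realization_def)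
  have "(\<Sum>i\<in>UNIV. dual_scale (of_int (c i)) (al i)) h = phi c h" for h
  proof -
    have "(\<Sum>i\<in>S. dual_scale (of_int (c i)) (al i)) h = (\<Sum>i\<in>S. of_int (c i) * al i h)" for S
      by (induction S rule: infinite_finite_induct) (auto simp: dual_scale_def)
    then show ?thesis by (simp add: phi_def)
  qed
  then have "(\<Sum>i\<in>UNIV. dual_scale (of_int (c i)) (al i)) = 0"
    using c by (auto simp: fun_eq_iff)
  then have "(\<Sum>v\<in>range al. dual_scale (of_int (c (inv_into UNIV al v))) v) = 0"
    by (simp add: sum.reindex[OF inj] inj)
  then have "of_int (c i) = (0::complex)" for i
    using dual.independentD[OF indep _ subset_refl, of _ "al i"] inj by force
  then show ?thesis by auto
qed

lemma phi_inj: "phi c = phi d \<longleftrightarrow> c = d"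
proof
  assume "phi c = phi d"
  then have "phi (\<lambda>i. c i - d i) = 0" by (simp add: phi_diff)
  from phi_eq_0[OF this] show "c = d" by (simp add: fun_eq_iff)
qed simp

lemma phi_coroot: "phi c (co j) = of_int (cpair j c)"
  by (simp add: phi_def cpair_def sroot_coroot mult.commute)

lemma cpair_diff: "cpair j (\<lambda>i. c i - d i) = cpair j c - cpair j d"
  by (simp add: cpair_def algebra_simps sum_subtractf)

lemma upd_unit: "c(j := c j - m) = (\<lambda>i. c i - m * unit_vec j i)"
  by (auto simp: unit_vec_def)

lemma refl_phi: "refl j (phi c) = phi (c(j := c j - cpair j c))"
  unfolding upd_unit phi_diff phi_scale phi_unit refl_def phi_coroot ..

lemma refl_add: "refl j (\<mu> + \<nu>) = refl j \<mu> + refl j \<nu>"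
  by (simp add: refl_def dual_scale_def fun_eq_iff algebra_simps)

lemma refl_diff: "refl j (\<mu> - \<nu>) = refl j \<mu> - refl j \<nu>"
  by (simp add: refl_def dual_scale_def fun_eq_iff algebra_simps)

lemma refl_scale: "refl j (dual_scale c \<nu>) = dual_scale c (refl j \<nu>)"
  by (simp add: refl_def dual_scale_def fun_eq_iff algebra_simps)

lemma refl_refl [simp]: "refl j (refl j \<mu>) = \<mu>"
  by (simp add: refl_def dual_scale_def fun_eq_iff sroot_coroot cartan_props algebra_simps)

lemma refl_comp [simp]: "refl j \<circ> refl j = id"
  by (simp add: fun_eq_iff)

lemma rw_Nil [simp]: "rw [] = id" by (simp add: rw_def fun_eq_iff)
lemma rw_Cons [simp]: "rw (s # ws) = refl s \<circ> rw ws" by (simp add: rw_def fun_eq_iff)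
lemma rw_append [simp]: "rw (ws @ us) = rw ws \<circ> rw us"
  by (simp add: rw_def fun_eq_iff)

lemma rw_rev: "rw (rev ws) \<circ> rw ws = id"
proof (induction ws)
  case (Cons s ws)
  have "rw (rev (s # ws)) \<circ> rw (s # ws) = rw (rev ws) \<circ> ((refl s \<circ> refl s) \<circ> rw ws)"
    by (simp add: comp_assoc del: refl_comp)
  then show ?case using Cons by simp
qed simp

lemma wgrpI: "set ws \<subseteq> J \<Longrightarrow> rw ws \<in> wgrp J"
  by (auto simp: wgrp_def)

lemma wgrpE: assumes "g \<in> wgrp J" obtains ws where "set ws \<subseteq> J" "g = rw ws"
  using assms by (auto simp: wgrp_def)

lemma wgrp_comp: "g \<in> wgrp J \<Longrightarrow> g' \<in> wgrp J \<Longrightarrow> g \<circ> g' \<in> wgrp J"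
  by (metis wgrpE wgrpI rw_append set_append Un_least)

lemma wgrp_id: "id \<in> wgrp J"
  using wgrpI[of "[]"] by simp

lemma wgrp_refl: "j \<in> J \<Longrightarrow> refl j \<in> wgrp J"
  using wgrpI[of "[j]"] by simp

lemma wgrp_mono: "J \<subseteq> K \<Longrightarrow> g \<in> wgrp J \<Longrightarrow> g \<in> wgrp K"
  by (auto elim!: wgrpE intro!: wgrpI)

lemma wgrp_inverse:
  assumes "g \<in> wgrp J" obtains g' where "g' \<in> wgrp J" "g' \<circ> g = id" "g \<circ> g' = id"
proof -
  obtain ws where ws: "set ws \<subseteq> J" "g = rw ws" using assms by (rule wgrpE)
  then show thesis using rw_rev[of ws] rw_rev[of "rev ws"] that[of "rw (rev ws)"] wgrpI[of "rev ws" J]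
    by simp
qed

lemma wgrp_linear:
  assumes "g \<in> wgrp J"
  shows "g (\<mu> + \<nu>) = g \<mu> + g \<nu>" "g (\<mu> - \<nu>) = g \<mu> - g \<nu>" "g (dual_scale c \<nu>) = dual_scale c (g \<nu>)"
    "g (- \<nu>) = - g \<nu>"
proof -
  obtain ws where ws: "g = rw ws" using assms by (rule wgrpE)
  have *: "rw ws (\<mu> + \<nu>) = rw ws \<mu> + rw ws \<nu> \<and> rw ws (\<mu> - \<nu>) = rw ws \<mu> - rw ws \<nu> \<and>
     rw ws (dual_scale c \<nu>) = dual_scale c (rw ws \<nu>)" for \<mu> \<nu> c
  proof (induction ws)
    case (Cons s ws)
    then show ?case by (simp only: rw_Cons comp_apply refl_add refl_diff refl_scale)
  qed (simp only: rw_Nil id_apply)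
  show "g (\<mu> + \<nu>) = g \<mu> + g \<nu>" "g (\<mu> - \<nu>) = g \<mu> - g \<nu>" "g (dual_scale c \<nu>) = dual_scale c (g \<nu>)"
    using * ws by metis+
  have "- \<nu> = dual_scale (-1) \<nu>" for \<nu> :: "'h \<Rightarrow> complex" by (simp add: dual_scale_def fun_eq_iff)
  then show "g (- \<nu>) = - g \<nu>"
    using * ws by metis
qed

text \<open>A reflection with index \<open>j\<close> changes only the coordinate at
  \<open>j\<close>. Both the integrality of the image and the untouched coordinates outside
  \<open>J\<close> are needed later.\<close>

lemma wgrp_phi:
  assumes "g \<in> wgrp J"
  obtains d where "g (phi c) = phi d" "\<And>i. i \<notin> J \<Longrightarrow> d i = c i"
proof -
  obtain ws where ws: "set ws \<subseteq> J" "g = rw ws" using assms by (rule wgrpE)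
  have "\<exists>d. rw ws (phi c) = phi d \<and> (\<forall>i. i \<notin> J \<longrightarrow> d i = c i)"
    using ws(1)
  proof (induction ws)
    case (Cons s ws)
    then obtain d where "rw ws (phi c) = phi d" "\<forall>i. i \<notin> J \<longrightarrow> d i = c i" by auto
    then have "rw (s # ws) (phi c) = phi (d(s := d s - cpair s d))"
      by (simp only: rw_Cons comp_apply refl_phi)
    moreover have "\<forall>i. i \<notin> J \<longrightarrow> (d(s := d s - cpair s d)) i = c i"
      using Cons.prems \<open>\<forall>i. i \<notin> J \<longrightarrow> d i = c i\<close> by auto
    ultimately show ?case by blast
  qed auto
  then show thesis using that ws by auto
qed

section \<open>Dihedral subgroups\<close>

text \<open>The alternating word of length \<open>k\<close> whose last letter, the one that acts
  first, is \<open>t\<close>. It grows at the front, so that passing from \<open>k\<close> to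
  \<open>k + 1\<close> applies one more reflection to the vector at hand.\<close>

primrec altw :: "'i \<Rightarrow> 'i \<Rightarrow> nat \<Rightarrow> 'i list" where
  "altw t s 0 = []"
| "altw t s (Suc k) = (if even k then t else s) # altw t s k"

definition comb :: "'i \<Rightarrow> 'i \<Rightarrow> int \<Rightarrow> int \<Rightarrow> 'h \<Rightarrow> complex" where
  "comb s t x y = dual_scale (of_int x) (al s) + dual_scale (of_int y) (al t)"

lemma refl_comb:
  "refl s (comb s t x y) = comb s t (- (cm s t * y) - x) y"
  "refl t (comb s t x y) = comb s t x (- (cm t s * x) - y)"
  by (auto simp: refl_def comb_def dual_scale_def fun_eq_iff sroot_coroot cartan_props algebra_simps)

lemma set_altw: "set (altw t s k) \<subseteq> {s, t}"
  by (induction k) auto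

lemma length_altw [simp]: "length (altw t s k) = k"
  by (induction k) auto

lemma altw_last: "\<exists>us. altw t s (Suc k) = us @ [t]"
  by (induction k) auto

lemma altw_suffix: "\<exists>us. altw t s (k + m) = us @ altw t s m"
  by (induction k) auto

lemma alternating_altw:
  assumes "set z \<subseteq> {s, t}" "\<And>u x w. z \<noteq> u @ [x, x] @ w" "z \<noteq> [] \<Longrightarrow> last z = t" "s \<noteq> t"
  shows "z = altw t s (length z)"
  using assms(1-3)
proof (induction z)
  case (Cons x z)
  have "z \<noteq> u @ [y, y] @ w" for u y w
    using Cons.prems(2)[of "x # u" y w] by auto
  then have z: "z = altw t s (length z)" if "z \<noteq> []"
    using that Cons by (auto split: if_splits)
  show ?case
  proof (cases "length z")
    case 0
    then show ?thesis using Cons.prems by auto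
  next
    case (Suc k)
    then have "z = (if even k then t else s) # altw t s k" using z by force
    moreover have "x \<noteq> hd z" using Cons.prems(2)[of "[]" x "tl z"] Suc by (cases z) auto
    ultimately have "x = (if even (Suc k) then t else s)"
      using Cons.prems(1) by (auto split: if_splits)
    then show ?thesis using z Suc by force
  qed
qed simp

text \<open>The infinite dihedral case. The signs alone do not survive the induction; it also
  carries that the pairing with the coroot of the letter used last, \<open>2 * x - p * y\<close> or
  \<open>2 * y - r * x\<close>, is nonnegative.\<close>

lemma rank2_infinite:
  assumes "s \<noteq> t" "cm s t * cm t s \<ge> 4"
  shows "\<exists>x y. x \<ge> 0 \<and> y \<ge> 0 \<and> rw (altw t s k) (al s) = comb s t x y"
proof -
  define p r where "p = - cm s t" and "r = - cm t s"
  have pr: "p \<ge> 0" "r \<ge> 0" "p * r \<ge> 4" using assms cartan_props by (auto simp: p_def r_def)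
  have "\<exists>x y. x \<ge> 0 \<and> y \<ge> 0 \<and> (if even k then 2 * x \<ge> p * y else 2 * y \<ge> r * x) \<and>
     rw (altw t s k) (al s) = comb s t x y"
  proof (induction k)
    case 0
    show ?case by (rule exI[of _ 1], rule exI[of _ 0]) (simp add: comb_def dual_scale_def fun_eq_iff)
  next
    case (Suc k)
    then obtain x y where xy: "x \<ge> 0" "y \<ge> 0" "if even k then 2 * x \<ge> p * y else 2 * y \<ge> r * x"
      "rw (altw t s k) (al s) = comb s t x y" by blast
    show ?case
    proof (cases "even k")
      case True
      \<comment> \<open>Here \<open>p * r \<ge> 4\<close> turns \<open>2 * x \<ge> p * y\<close>
        into \<open>r * x \<ge> 2 * y\<close>, which makes the new coordinate
        \<open>r * x - y\<close> nonnegative and is the invariant for the next step.\<close>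
      have "4 * y \<le> p * r * y" using pr xy by (intro mult_right_mono) auto
      also have "\<dots> \<le> r * (2 * x)" using mult_left_mono[of "p * y" "2 * x" r] True xy pr
        by (simp add: algebra_simps)
      finally have "r * x \<ge> 2 * y" by simp
      then show ?thesis using True xy
        by - (rule exI[of _ x], rule exI[of _ "r * x - y"], simp add: refl_comb r_def algebra_simps)
    next
      case False
      have "4 * x \<le> p * r * x" using pr xy by (intro mult_right_mono) auto
      also have "\<dots> \<le> p * (2 * y)" using mult_left_mono[of "r * x" "2 * y" p] False xy pr
        by (simp add: algebra_simps)
      finally have "p * y \<ge> 2 * x" by simp
      then show ?thesis using False xy
        by - (rule exI[of _ "p * y - x"], rule exI[of _ y], simp add: refl_comb p_def algebra_simps)
    qed
  qed
  then show ?thesis by blast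
qed

text \<open>The dihedral orbit of an arbitrary functional stays of this form. A braid relation thus
  becomes an identity between coefficients, polynomial in \<open>\<mu> (co s)\<close> and
  \<open>\<mu> (co t)\<close>.\<close>

definition sub2 :: "'i \<Rightarrow> 'i \<Rightarrow> ('h \<Rightarrow> complex) \<Rightarrow> complex \<Rightarrow> complex \<Rightarrow> 'h \<Rightarrow> complex" where
  "sub2 s t \<mu> x y = \<mu> - dual_scale x (al s) - dual_scale y (al t)"

lemma refl_sub2:
  "refl s (sub2 s t \<mu> x y) = sub2 s t \<mu> (\<mu> (co s) - x - of_int (cm s t) * y) y"
  "refl t (sub2 s t \<mu> x y) = sub2 s t \<mu> x (\<mu> (co t) - y - of_int (cm t s) * x)"
  by (auto simp: refl_def sub2_def dual_scale_def fun_eq_iff sroot_coroot cartan_props algebra_simps)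

text \<open>The products 0, 1, 2, 3 of the off-diagonal entries belong to the types A1 x A1, A2, B2,
  G2, with braid relations of length 2, 3, 4, 6. Both claims are computed on coefficients in each
  case.\<close>

lemma rank2_finite:
  assumes "s \<noteq> t" "cm s t * cm t s < 4"
  shows "\<exists>m>0. rw (altw t s m) = rw (altw s t m) \<and>
    (\<forall>k<m. \<exists>x y. x \<ge> 0 \<and> y \<ge> 0 \<and> rw (altw t s k) (al s) = comb s t x y)"
proof -
  define p r where "p = - cm s t" and "r = - cm t s"
  have cm: "cm s t = - p" "cm t s = - r" by (auto simp: p_def r_def)
  have pr: "p \<ge> 0" "r \<ge> 0" "p * r < 4" "p = 0 \<longleftrightarrow> r = 0"
    using assms cartan_props by (auto simp: p_def r_def)
  have al: "al s = comb s t 1 0" by (simp add: comb_def dual_scale_def fun_eq_iff)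
  have \<mu>: "\<mu> = sub2 s t \<mu> 0 0" for \<mu> by (simp add: sub2_def dual_scale_def fun_eq_iff)
  have m: ?thesis
    if "m > 0" "\<And>\<mu>. rw (altw t s m) (sub2 s t \<mu> 0 0) = rw (altw s t m) (sub2 s t \<mu> 0 0)"
     "\<And>k. k < m \<Longrightarrow> \<exists>x y. x \<ge> 0 \<and> y \<ge> 0 \<and> rw (altw t s k) (comb s t 1 0) = comb s t x y" for m
  proof -
    have "rw (altw t s m) = rw (altw s t m)"
    proof
      fix \<mu> show "rw (altw t s m) \<mu> = rw (altw s t m) \<mu>"
        using that(2)[of \<mu>] unfolding \<mu>[symmetric] .
    qed
    then show ?thesis using that(1,3) unfolding al by blast
  qed
  have ex: "x \<ge> 0 \<and> y \<ge> 0 \<Longrightarrow> \<exists>x'\<ge>0. \<exists>y'\<ge>0. comb s t x y = comb s t x' y'" for x y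
    by blast
  have nums: "(3::nat) = Suc (Suc (Suc 0))" "(4::nat) = Suc (Suc (Suc (Suc 0)))"
    "(6::nat) = Suc (Suc (Suc (Suc (Suc (Suc 0)))))" by simp_all
  note S = cm refl_sub2 refl_comb algebra_simps
  consider "p = 0" "r = 0" | "p = 1" "r = 1" | "p = 1" "r = 2" | "p = 2" "r = 1" | "p = 1" "r = 3" | "p = 3" "r = 1"
  proof -
    have "p = 0 \<or> r = 0 \<or> (p \<ge> 1 \<and> r \<ge> 1)" using pr by linarith
    moreover have "p \<le> 3" "r \<le> 3" if "p \<ge> 1" "r \<ge> 1"
      using pr that mult_left_mono[of 1 r p] mult_right_mono[of 1 p r] by linarith+
    ultimately have "p \<in> {0,1,2,3}" "r \<in> {0,1,2,3}" using pr by auto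
    then show thesis using pr that by auto
  qed
  then show ?thesis
  proof cases
    case 1 then show ?thesis by (intro m[of "Suc (Suc 0)"]) (auto simp: S nums less_Suc_eq intro!: ex)
  next
    case 2 then show ?thesis by (intro m[of "3"]) (auto simp: S nums less_Suc_eq intro!: ex)
  next
    case 3 then show ?thesis by (intro m[of "4"]) (auto simp: S nums less_Suc_eq intro!: ex)
  next
    case 4 then show ?thesis by (intro m[of "4"]) (auto simp: S nums less_Suc_eq intro!: ex)
  next
    case 5 then show ?thesis by (intro m[of "6"]) (auto simp: S nums less_Suc_eq intro!: ex)
  next
    case 6 then show ?thesis by (intro m[of "6"]) (auto simp: S nums less_Suc_eq intro!: ex)
  qed
qed

section \<open>Length and the sign of roots\<close>

definition len :: "'i set \<Rightarrow> (('h \<Rightarrow> complex) \<Rightarrow> 'h \<Rightarrow> complex) \<Rightarrow> nat" where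
  "len J g = (LEAST n. \<exists>ws. set ws \<subseteq> J \<and> length ws = n \<and> rw ws = g)"

lemma len_le: "set ws \<subseteq> J \<Longrightarrow> len J (rw ws) \<le> length ws"
  unfolding len_def by (rule Least_le) auto

lemma reduced_word:
  assumes "g \<in> wgrp J" obtains ws where "set ws \<subseteq> J" "rw ws = g" "length ws = len J g"
proof -
  have "\<exists>n ws. set ws \<subseteq> J \<and> length ws = n \<and> rw ws = g"
    using assms by (auto elim: wgrpE)
  from LeastI_ex[OF this] show thesis using that unfolding len_def by blast
qed

lemma len_comp_word:
  assumes "v \<in> wgrp J" "set ws \<subseteq> J" shows "len J (v \<circ> rw ws) \<le> len J v + length ws"
proof -
  obtain us where "set us \<subseteq> J" "rw us = v" "length us = len J v"
    using assms(1) by (rule reduced_word)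
  then show ?thesis using len_le[of "us @ ws" J] assms(2) by simp
qed

lemma len_refl_le: "v \<in> wgrp J \<Longrightarrow> j \<in> J \<Longrightarrow> len J (v \<circ> refl j) \<le> len J v + 1"
  using len_comp_word[of v J "[j]"] by simp

lemma last_letter:
  assumes "g \<in> wgrp J" "g \<noteq> id"
  obtains t v where "t \<in> J" "v \<in> wgrp J" "g = v \<circ> refl t" "len J g = len J v + 1"
proof -
  obtain ws where ws: "set ws \<subseteq> J" "rw ws = g" "length ws = len J g"
    using assms(1) by (rule reduced_word)
  then have "ws \<noteq> []" using assms(2) by auto
  then obtain us t where us: "ws = us @ [t]" by (metis rev_exhaust)
  have "g = rw us \<circ> refl t" using ws us by simp
  moreover have "len J (rw us) \<le> len J g - 1" "len J g \<ge> 1" using len_le[of us J] ws us by auto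
  moreover have "len J g \<le> len J (rw us) + 1"
    using len_refl_le[of "rw us" J t] ws us \<open>g = rw us \<circ> refl t\<close> wgrpI[of us J] by simp
  ultimately show thesis using that[of t "rw us"] ws us wgrpI[of us J] by auto
qed

text \<open>A shorter word for \<open>rw ws\<close>, or one of equal length ending in
  \<open>s\<close>, would contradict \<open>red\<close> or \<open>asc\<close>. So \<open>ws\<close>
  alternates and ends in \<open>t\<close>. In a finite dihedral group it is also shorter than the
  braid relation, which could otherwise be used to make it end in \<open>s\<close>.\<close>

lemma dihedral_pos:
  assumes v: "v \<in> wgrp J" and st: "s \<in> J" "t \<in> J" "s \<noteq> t"
    and ws: "set ws \<subseteq> {s, t}"
    and red: "len J (v \<circ> rw ws) = len J v + length ws"
    and asc: "len J (v \<circ> rw ws) \<le> len J (v \<circ> rw ws \<circ> refl s)"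
  shows "\<exists>x y. x \<ge> 0 \<and> y \<ge> 0 \<and> rw ws (al s) = comb s t x y"
proof -
  have short: "length ws \<le> length z" if "set z \<subseteq> {s, t}" "rw z = rw ws" for z
    using len_comp_word[OF v, of z] that st red by force
  have no_s: "rw ws \<noteq> rw (z @ [s])" if "set z \<subseteq> {s, t}" "length ws = length z + 1" for z
  proof
    assume "rw ws = rw (z @ [s])"
    then have "v \<circ> rw ws \<circ> refl s = v \<circ> rw z" by (simp add: comp_assoc)
    then show False
      using len_comp_word[OF v, of z] that st red asc by force
  qed
  have adj: "ws \<noteq> u @ [x, x] @ w" for u x w
  proof
    assume "ws = u @ [x, x] @ w"
    then have "rw (u @ w) = rw ws"
      by (simp add: comp_assoc[symmetric])
    then show False using short[of "u @ w"] ws \<open>ws = u @ [x, x] @ w\<close> by auto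
  qed
  have lst: "last ws = t" if ne: "ws \<noteq> []"
  proof -
    have bl: "ws = butlast ws @ [last ws]" using ne by simp
    have "set (butlast ws) \<subseteq> {s, t}" using ws in_set_butlastD by fast
    moreover have "length ws = length (butlast ws) + 1" using ne by simp
    ultimately have "last ws \<noteq> s" using no_s[of "butlast ws"] bl by metis
    moreover have "last ws \<in> {s, t}" using ws last_in_set[OF ne] by blast
    ultimately show ?thesis by simp
  qed
  have alt: "ws = altw t s (length ws)"
    by (rule alternating_altw[OF ws adj lst st(3)])
  obtain n where n: "ws = altw t s n" using alt by blast
  show ?thesis
  proof (cases "cm s t * cm t s \<ge> 4")
    case True
    show ?thesis using rank2_infinite[OF st(3) True, of n] n by simp
  next
    case False
    then obtain m where m: "m > 0" "rw (altw t s m) = rw (altw s t m)"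
      "\<forall>k<m. \<exists>x y. x \<ge> 0 \<and> y \<ge> 0 \<and> rw (altw t s k) (al s) = comb s t x y"
      using rank2_finite[OF st(3)] by fastforce
    have "length ws < m"
    proof (rule ccontr)
      assume "\<not> length ws < m"
      then obtain us where us: "ws = us @ altw t s m"
        using altw_suffix[of t s "n - m" m] n by auto
      obtain z where z: "altw s t m = z @ [s]" using altw_last[of s t "m - 1"] m by auto
      have "set z \<subseteq> {s, t}" using set_altw[of s t m] z by auto
      moreover have "length ws = length (us @ z) + 1"
        using us z length_altw[of s t m] by simp
      moreover have "rw ws = rw ((us @ z) @ [s])"
        unfolding us by (simp only: rw_append m z comp_assoc)
      moreover have "set us \<subseteq> {s, t}" using ws us by auto
      ultimately show False using no_s[of "us @ z"] by simp
    qed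
    then show ?thesis using m n by simp
  qed
qed

text \<open>
  Write \<open>g = v \<circ> rw ws\<close> with \<open>v\<close> as short as possible and \<open>ws\<close> a word in \<open>s\<close> and the last letter \<open>t\<close> of
  \<open>g\<close>. Then \<open>v\<close> maps both \<open>al s\<close> and \<open>al t\<close> into the positive cone by induction.
\<close>

theorem len_ascent_pos:
  assumes "g \<in> wgrp J" "s \<in> J" "len J g \<le> len J (g \<circ> refl s)"
  shows "\<exists>c. (\<forall>i. 0 \<le> c i) \<and> g (al s) = phi c"
  using assms
proof (induction "len J g" arbitrary: g s rule: less_induct)
  case less
  show ?case
  proof (cases "g = id")
    case True
    then show ?thesis
      by (intro exI[of _ "unit_vec s"]) (simp add: phi_unit, simp add: unit_vec_def)
  next
    case False
    then obtain t v0 where t: "t \<in> J" "v0 \<in> wgrp J" "g = v0 \<circ> refl t" "len J g = len J v0 + 1"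
      using last_letter[OF less.prems(1)] by metis
    have "t \<noteq> s"
    proof
      assume "t = s"
      then have "g \<circ> refl s = v0" using t by (simp add: comp_assoc)
      then show False using t less.prems by simp
    qed
    define Q where "Q v \<longleftrightarrow> v \<in> wgrp J \<and> (\<exists>ws. set ws \<subseteq> {s, t} \<and> g = v \<circ> rw ws \<and> len J g = len J v + length ws)" for v
    have "Q v0" unfolding Q_def using t by (intro conjI exI[of _ "[t]"]) auto
    then obtain v where v: "Q v" "\<And>v'. Q v' \<Longrightarrow> len J v \<le> len J v'"
      using ex_has_least_nat[of Q _ "len J"] by metis
    then obtain ws where ws: "v \<in> wgrp J" "set ws \<subseteq> {s, t}" "g = v \<circ> rw ws" "len J g = len J v + length ws"
      by (auto simp: Q_def)
    \<comment> \<open>\<open>v0\<close> competes in the choice of \<open>v\<close>, so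
      \<open>v\<close> is properly shorter than \<open>g\<close> and the induction hypothesis
      applies to it.\<close>
    have lt: "len J v < len J g" using v(2)[OF \<open>Q v0\<close>] t by simp
    have asc: "len J v \<le> len J (v \<circ> refl x)" if "x \<in> {s, t}" for x
    proof (rule ccontr)
      assume neg: "\<not> ?thesis"
      have x: "v \<circ> refl x \<in> wgrp J" using that t less.prems ws by (auto intro: wgrp_comp wgrp_refl)
      have g: "g = (v \<circ> refl x) \<circ> rw (x # ws)"
        using ws(3) by (simp add: fun_eq_iff)
      moreover have "len J g \<le> len J (v \<circ> refl x) + length (x # ws)"
        unfolding g using len_comp_word[OF x, of "x # ws"] that t less.prems ws by auto
      ultimately have "Q (v \<circ> refl x)"
        unfolding Q_def using neg x ws that by (intro conjI exI[of _ "x # ws"]) auto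
      then show False using v(2) neg by auto
    qed
    obtain c1 c2 where c: "\<forall>i. 0 \<le> c1 i" "v (al s) = phi c1" "\<forall>i. 0 \<le> c2 i" "v (al t) = phi c2"
      using less.hyps[OF lt ws(1), of s] less.hyps[OF lt ws(1), of t] asc t less.prems by auto
    obtain x y where xy: "x \<ge> 0" "y \<ge> 0" "rw ws (al s) = comb s t x y"
      using dihedral_pos[OF ws(1) less.prems(2) t(1) _ ws(2)] ws less.prems \<open>t \<noteq> s\<close> by metis
    have "g (al s) = phi (\<lambda>i. x * c1 i + y * c2 i)"
      using ws(3) xy c wgrp_linear[OF ws(1)]
      by (simp add: phi_add phi_scale comb_def)
    then show ?thesis using xy c by (intro exI[of _ "\<lambda>i. x * c1 i + y * c2 i"]) auto
  qed
qed

definition pos_at :: "(('h \<Rightarrow> complex) \<Rightarrow> 'h \<Rightarrow> complex) \<Rightarrow> 'i \<Rightarrow> bool" where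
  "pos_at g i \<longleftrightarrow> (\<exists>c. (\<forall>k. 0 \<le> c k) \<and> g (al i) = phi c)"

definition neg_at :: "(('h \<Rightarrow> complex) \<Rightarrow> 'h \<Rightarrow> complex) \<Rightarrow> 'i \<Rightarrow> bool" where
  "neg_at g i \<longleftrightarrow> (\<exists>c. (\<forall>k. 0 \<le> c k) \<and> g (al i) = - phi c)"

lemma len_descent_neg:
  assumes "g \<in> wgrp J" "s \<in> J" "len J (g \<circ> refl s) \<le> len J g"
  shows "neg_at g s"
proof -
  have "g \<circ> refl s \<in> wgrp J" using assms by (auto intro: wgrp_comp wgrp_refl)
  moreover have "g \<circ> refl s \<circ> refl s = g" by (simp add: comp_assoc)
  ultimately obtain c where c: "\<forall>i. 0 \<le> c i" "(g \<circ> refl s) (al s) = phi c"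
    using len_ascent_pos[of "g \<circ> refl s" J s] assms by auto
  have "refl s (al s) = - al s"
    by (simp add: refl_def dual_scale_def fun_eq_iff sroot_coroot cartan_props)
  then have "g (al s) = - phi c" using c wgrp_linear(4)[OF assms(1)] by (metis comp_apply minus_minus)
  then show ?thesis using c by (auto simp: neg_at_def)
qed

lemma al_nonzero: "al i \<noteq> 0"
proof
  assume "al i = 0"
  then have "unit_vec i = (\<lambda>_. 0)" using phi_eq_0 phi_unit by metis
  then show False by (metis unit_vec_def zero_neq_one)
qed

text \<open>Length is taken in the whole Weyl group because \<open>s\<close> need not lie in
  \<open>J\<close>; each \<open>s\<close> is an ascent or a descent of \<open>g\<close>.\<close>

lemma pos_neg_at: "g \<in> wgrp J \<Longrightarrow> pos_at g s \<or> neg_at g s"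
  using len_ascent_pos[of g UNIV s] len_descent_neg[of g UNIV s] wgrp_mono[of J UNIV g]
  by (metis UNIV_I linear pos_at_def subset_UNIV)

lemma not_pos_neg_at:
  assumes "g \<in> wgrp J" "pos_at g s" shows "\<not> neg_at g s"
proof
  assume "neg_at g s"
  then obtain c d where c: "\<forall>k. 0 \<le> c k" "g (al s) = phi c" "\<forall>k. 0 \<le> d k" "g (al s) = - phi d"
    using assms by (auto simp: pos_at_def neg_at_def)
  then have "c = (\<lambda>k. - d k)" by (metis phi_inj phi_minus)
  have "c k = 0" for k
  proof -
    have "c k = - d k" using \<open>c = (\<lambda>k. - d k)\<close> by (rule fun_cong)
    moreover have "0 \<le> c k" "0 \<le> d k" using c by auto
    ultimately show ?thesis by linarith
  qed
  then have "c = (\<lambda>_. 0)" by blast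
  then have "g (al s) = 0" using c by (simp add: phi_def fun_eq_iff)
  moreover obtain g' where "g' \<circ> g = id" "g' \<in> wgrp J" using assms wgrp_inverse by metis
  ultimately have "al s = g' 0" by (metis comp_apply id_apply)
  also have "g' 0 = 0" using wgrp_linear(2)[OF \<open>g' \<in> wgrp J\<close>, of 0 0] by simp
  finally show False using al_nonzero by simp
qed

text \<open>A nontrivial element has a last letter, and this letter is a descent. Equality of group
  elements is proved below through this criterion.\<close>

lemma all_pos_id:
  assumes "g \<in> wgrp J" "\<And>s. pos_at g s" shows "g = id"
proof (rule ccontr)
  assume "g \<noteq> id"
  then obtain t v where t: "t \<in> J" "v \<in> wgrp J" "g = v \<circ> refl t" "len J g = len J v + 1"
    using last_letter[OF assms(1)] by metis
  then have "g \<circ> refl t = v" by (simp add: comp_assoc)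
  then have "neg_at g t" using len_descent_neg[OF assms(1) t(1)] t by simp
  then show False using not_pos_neg_at assms by blast
qed

section \<open>The Weyl sum\<close>

definition nonneg :: "('i \<Rightarrow> int) \<Rightarrow> bool" where
  "nonneg c \<longleftrightarrow> (\<forall>i. 0 \<le> c i)"

lemma wgrp_inj: "g \<in> wgrp J \<Longrightarrow> g x = g y \<longleftrightarrow> x = y"
  by (metis wgrp_inverse comp_apply id_apply)

lemma wgrp_phi_sum:
  assumes "g \<in> wgrp J"
  shows "g (phi m) = (\<Sum>i\<in>UNIV. dual_scale (of_int (m i)) (g (al i)))"
proof -
  have zero: "g 0 = 0" using wgrp_linear(2)[OF assms, of 0 0] by simp
  have "g (\<Sum>i\<in>S. dual_scale (of_int (m i)) (al i)) = (\<Sum>i\<in>S. dual_scale (of_int (m i)) (g (al i)))" for S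
    by (induction S rule: infinite_finite_induct)
       (simp_all only: sum.infinite sum.empty sum.insert zero wgrp_linear[OF assms] not_False_eq_True)
  moreover have "phi m = (\<Sum>i\<in>UNIV. dual_scale (of_int (m i)) (al i))"
  proof
    fix h
    have "(\<Sum>i\<in>S. dual_scale (of_int (m i)) (al i)) h = (\<Sum>i\<in>S. of_int (m i) * al i h)" for S
      by (induction S rule: infinite_finite_induct) (auto simp: dual_scale_def)
    then show "phi m h = (\<Sum>i\<in>UNIV. dual_scale (of_int (m i)) (al i)) h" by (simp add: phi_def)
  qed
  ultimately show ?thesis by simp
qed

section \<open>Effect of a simple reflection on the signs of roots\<close>

lemma refl_al: "refl s (al s) = - al s"
  by (simp add: refl_def dual_scale_def fun_eq_iff sroot_coroot cartan_props)

text \<open>Only the coordinate at \<open>j\<close> changes, so a positive root that turns negative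
  is a multiple \<open>c j\<close> of \<open>al j\<close>. The multiple is 1 because the inverse of
  \<open>g\<close> preserves the root lattice.\<close>

lemma refl_pos_at:
  assumes g: "g \<in> wgrp J" and j: "j \<in> J" and pos: "pos_at g i" and ne: "g (al i) \<noteq> al j"
  shows "pos_at (refl j \<circ> g) i"
proof (rule ccontr)
  assume "\<not> ?thesis"
  moreover have g': "refl j \<circ> g \<in> wgrp J" using g j by (intro wgrp_comp wgrp_refl)
  ultimately obtain d where d: "\<forall>k. 0 \<le> d k" "refl j (g (al i)) = - phi d"
    using pos_neg_at[of "refl j \<circ> g" J i] by (auto simp: neg_at_def)
  obtain c where c: "\<forall>k. 0 \<le> c k" "g (al i) = phi c" using pos by (auto simp: pos_at_def)
  have "phi (\<lambda>k. - d k) = phi (c(j := c j - cpair j c))"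
    using d(2) unfolding c(2) refl_phi phi_minus by simp
  then have e: "- d k = (c(j := c j - cpair j c)) k" for k
    unfolding phi_inj by (rule fun_cong)
  have ck: "c k = 0" if "k \<noteq> j" for k
  proof -
    have "- d k = c k" using e[of k] that by simp
    moreover have "0 \<le> c k" "0 \<le> d k" using c d by auto
    ultimately show ?thesis by linarith
  qed
  then have cj: "c = (\<lambda>k. c j * unit_vec j k)" by (auto simp: unit_vec_def)
  have gi: "g (al i) = dual_scale (of_int (c j)) (al j)"
    unfolding c(2) by (subst cj) (simp only: phi_scale phi_unit)
  \<comment> \<open>Pulling \<open>g (al i)\<close> back along \<open>h\<close> exhibits
    \<open>c j\<close> as a divisor of the coordinate 1 of \<open>al i\<close>.\<close>
  obtain h where h: "h \<in> wgrp J" "h \<circ> g = id" using g by (rule wgrp_inverse)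
  obtain b where b: "h (phi (unit_vec j)) = phi b" using h(1) by (rule wgrp_phi)
  have "al i = h (g (al i))" using h(2) by (metis comp_apply id_apply)
  also have "\<dots> = phi (\<lambda>k. c j * b k)"
    unfolding gi wgrp_linear(3)[OF h(1)] phi_scale using b by (simp add: phi_unit)
  finally have "phi (unit_vec i) = phi (\<lambda>k. c j * b k)" by (simp only: phi_unit)
  then have "unit_vec i i = c j * b i" unfolding phi_inj by (rule fun_cong)
  then have "c j * b i = 1" by (simp add: unit_vec_def)
  moreover have "0 \<le> c j" using c by blast
  ultimately have "c j = 1" by (metis zmult_eq_1_iff not_one_le_zero neg_0_le_iff_le)
  then have "g (al i) = al j" using gi by (simp add: dual_scale_def)
  then show False using ne by simp
qed

text \<open>If \<open>i\<close> were outside \<open>J\<close>, then \<open>g\<close> would preserve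
  the coordinate 1 of \<open>al i\<close> at \<open>i\<close>, while \<open>al j\<close> has 0
  there.\<close>

lemma simple_image_inside:
  assumes "g \<in> wgrp J" "j \<in> J" "g (al i) = al j"
  shows "i \<in> J"
proof (rule ccontr)
  assume i: "i \<notin> J"
  obtain d where "g (phi (unit_vec i)) = phi d" "\<And>k. k \<notin> J \<Longrightarrow> d k = unit_vec i k"
    using wgrp_phi[OF assms(1)] by blast
  then have "d = unit_vec j" "d i = 1"
    using assms i by (metis phi_unit phi_inj, simp add: unit_vec_def)
  then show False using i assms(2) by (auto simp: unit_vec_def split: if_splits)
qed

text \<open>
  The element \<open>g s\<^sub>i g\<inverse> s\<^sub>j\<close> changes a simple root by a multiple of \<open>\<alpha>\<^sub>j\<close> only and fixes \<open>\<alpha>\<^sub>j\<close>, so it has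
  no descents.
\<close>

lemma refl_conjugate:
  assumes g: "g \<in> wgrp J" and j: "j \<in> J" and gi: "g (al i) = al j"
  shows "refl j \<circ> g = g \<circ> refl i"
proof -
  have i: "i \<in> J" by (rule simple_image_inside[OF g j gi])
  obtain h where h: "h \<in> wgrp J" "h \<circ> g = id" "g \<circ> h = id" using g by (rule wgrp_inverse)
  have hj: "h (al j) = al i" using h(2) gi by (metis comp_apply id_apply)
  define T where "T = g \<circ> refl i \<circ> h \<circ> refl j"
  have T: "T \<in> wgrp J" unfolding T_def using g h i j by (intro wgrp_comp wgrp_refl) auto
  have Ts: "\<exists>x. T \<mu> = \<mu> + dual_scale x (al j)" for \<mu>
  proof -
    have "T \<mu> = g (h (refl j \<mu>) - dual_scale (h (refl j \<mu>) (co i)) (al i))"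
      by (simp add: T_def refl_def[of i])
    also have "\<dots> = refl j \<mu> - dual_scale (h (refl j \<mu>) (co i)) (al j)"
      using h(3) gi wgrp_linear[OF g] by (metis comp_apply id_apply)
    finally show ?thesis
      by (intro exI[of _ "- \<mu> (co j) - h (refl j \<mu>) (co i)"])
         (simp add: refl_def dual_scale_def fun_eq_iff algebra_simps)
  qed
  have "h (- al j) = - al i" unfolding wgrp_linear(4)[OF h(1)] hj ..
  moreover have "refl i (- al i) = al i"
    using wgrp_linear(4)[OF wgrp_refl[OF i], of "al i"] refl_al by (simp only: minus_minus)
  ultimately have Tj: "T (al j) = al j"
    unfolding T_def comp_apply refl_al by (simp only: gi)
  have "pos_at T k" for k
  proof (rule ccontr)
    assume np: "\<not> pos_at T k"
    then obtain d where d: "\<forall>l. 0 \<le> d l" "T (al k) = - phi d"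
      using pos_neg_at[OF T] by (auto simp: neg_at_def)
    obtain b where b: "T (phi (unit_vec k)) = phi b" using T by (rule wgrp_phi)
    have kj: "k \<noteq> j"
    proof
      assume "k = j"
      then have "pos_at T k" unfolding pos_at_def using Tj
        by (intro exI[of _ "unit_vec j"]) (simp add: phi_unit, simp add: unit_vec_def)
      then show False using np by simp
    qed
    obtain x where x: "T (al k) = al k + dual_scale x (al j)" using Ts by blast
    have b': "T (al k) = phi b" using b by (simp add: phi_unit)
    have "b = (\<lambda>l. - d l)" using b' d(2) by (metis phi_inj phi_minus)
    \<comment> \<open>The factor \<open>x\<close> is merely a complex number. That
      \<open>T (al k) - al k\<close> is negated by \<open>refl j\<close> shows that its integer
      coordinate at \<open>k\<close>, different from \<open>j\<close>, vanishes.\<close>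
    moreover have "b k = 1"
    proof -
      have "T (al k) - al k = dual_scale x (al j)" unfolding x by (rule add_diff_cancel_left')
      moreover have "refl j (dual_scale x (al j)) = - dual_scale x (al j)"
        unfolding refl_scale refl_al by (simp add: dual_scale_def fun_eq_iff)
      ultimately have "refl j (T (al k) - al k) = - (T (al k) - al k)"
        by (simp only:)
      then have "refl j (phi (\<lambda>l. b l - unit_vec k l)) = phi (\<lambda>l. - (b l - unit_vec k l))"
        unfolding b' phi_diff phi_unit phi_minus .
      then have "(\<lambda>l. b l - unit_vec k l)(j := (b j - unit_vec k j) - cpair j (\<lambda>l. b l - unit_vec k l))
          = (\<lambda>l. - (b l - unit_vec k l))"
        unfolding refl_phi phi_inj .
      from fun_cong[OF this, of k] show ?thesis using kj by (simp add: unit_vec_def)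
    qed
    ultimately have "- d k = 1" by simp
    moreover have "0 \<le> d k" using d(1) by simp
    ultimately show False by linarith
  qed
  then have "T = id" using T by (rule all_pos_id[rotated])
  have "refl j \<circ> g = T \<circ> (refl j \<circ> g)" using \<open>T = id\<close> by simp
  also have "\<dots> = g \<circ> refl i"
    unfolding T_def using h(2) by (metis comp_assoc refl_comp comp_id)
  finally show ?thesis .
qed

text \<open>Each descent contributes the sign in front of the expansion of its factor. This is not
  the determinant of \<open>g\<close>, which counts all inversions and not just the simple roots
  made negative.\<close>

definition sgn_at :: "(('h \<Rightarrow> complex) \<Rightarrow> 'h \<Rightarrow> complex) \<Rightarrow> int" where
  "sgn_at g = (\<Prod>i\<in>UNIV. if neg_at g i then - 1 else 1)"

definition eps :: "('h \<Rightarrow> complex) \<Rightarrow> (('h \<Rightarrow> complex) \<Rightarrow> 'h \<Rightarrow> complex) \<Rightarrow> ('h \<Rightarrow> complex) \<Rightarrow> int" where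
  "eps lam g \<mu> =
     (if \<exists>m. (\<forall>i. m i < 0 \<longleftrightarrow> neg_at g i) \<and> g (phi m) = g lam - \<mu> then sgn_at g else 0)"

text \<open>The sign of \<open>m i\<close> agrees with the sign of the root \<open>g (al i)\<close>,
  so every product of the two lies in the positive cone.\<close>

lemma eps_below:
  assumes g: "g \<in> wgrp J" and nz: "eps lam g \<mu> \<noteq> 0"
  obtains c where "nonneg c" "\<mu> = g lam - phi c"
proof -
  obtain m where m: "\<And>i. m i < 0 \<longleftrightarrow> neg_at g i" "g (phi m) = g lam - \<mu>"
    using nz by (auto simp: eps_def split: if_splits)
  have "\<exists>c. nonneg c \<and> dual_scale (of_int (m i)) (g (al i)) = phi c" for i
  proof (cases "neg_at g i")
    case True
    then obtain c where c: "\<forall>k. 0 \<le> c k" "g (al i) = - phi c" by (auto simp: neg_at_def)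
    have "dual_scale (of_int (m i)) (g (al i)) = phi (\<lambda>k. (- m i) * c k)"
      unfolding phi_scale c by (simp add: dual_scale_def fun_eq_iff)
    then show ?thesis using c m(1)[of i] True
      by (intro exI[of _ "\<lambda>k. (- m i) * c k"])
         (auto simp: nonneg_def simp del: mult_minus_left intro!: mult_nonneg_nonneg)
  next
    case False
    then obtain c where c: "\<forall>k. 0 \<le> c k" "g (al i) = phi c"
      using pos_neg_at[OF g] by (auto simp: pos_at_def)
    then have "dual_scale (of_int (m i)) (g (al i)) = phi (\<lambda>k. m i * c k)"
      unfolding phi_scale by simp
    then show ?thesis using c m(1)[of i] False
      by (intro exI[of _ "\<lambda>k. m i * c k"]) (auto simp: nonneg_def)
  qed
  then obtain C where C: "\<And>i. nonneg (C i)" "\<And>i. dual_scale (of_int (m i)) (g (al i)) = phi (C i)"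
    by metis
  have "g (phi m) = phi (\<lambda>k. \<Sum>i\<in>UNIV. C i k)"
    unfolding wgrp_phi_sum[OF g] C phi_sum ..
  then have "\<mu> = g lam - phi (\<lambda>k. \<Sum>i\<in>UNIV. C i k)" using m(2)
    by (metis diff_diff_eq2 add_diff_cancel_left')
  moreover have "nonneg (\<lambda>k. \<Sum>i\<in>UNIV. C i k)"
    using C(1) by (auto simp: nonneg_def intro: sum_nonneg)
  ultimately show thesis using that by blast
qed

lemma neg_at_id: "\<not> neg_at id i"
proof -
  have "pos_at id i" unfolding pos_at_def
    by (intro exI[of _ "unit_vec i"]) (simp add: phi_unit, simp add: unit_vec_def)
  then show ?thesis using not_pos_neg_at wgrp_id by blast
qed

text \<open>The vector \<open>m\<close> in \<open>eps\<close> holds the coordinates of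
  \<open>lam\<close> minus the inverse image of \<mu> under \<open>g\<close>, which are nonnegative
  here. So \<open>g\<close> has no descents.\<close>

lemma eps_orbit_bounded:
  assumes bd: "\<And>g. g \<in> wgrp J \<Longrightarrow> \<exists>c. nonneg c \<and> g \<mu> = lam - phi c"
    and g: "g \<in> wgrp J"
  shows "eps lam g \<mu> = (if g = id then 1 else 0)"
proof (cases "g = id")
  case True
  obtain c where "nonneg c" "\<mu> = lam - phi c" using bd[OF wgrp_id] by auto
  then have "\<exists>m. (\<forall>i. m i < 0 \<longleftrightarrow> neg_at id i) \<and> id (phi m) = id lam - \<mu>"
    by (intro exI[of _ c]) (auto simp: neg_at_id nonneg_def not_less)
  then show ?thesis using True by (simp add: eps_def sgn_at_def neg_at_id)
next
  case False
  have "eps lam g \<mu> = 0"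
  proof (rule ccontr)
    assume "eps lam g \<mu> \<noteq> 0"
    then obtain m where m: "\<And>i. m i < 0 \<longleftrightarrow> neg_at g i" "g (phi m) = g lam - \<mu>"
      by (auto simp: eps_def split: if_splits)
    obtain h where h: "h \<in> wgrp J" "h \<circ> g = id" using g by (rule wgrp_inverse)
    obtain c where c: "nonneg c" "h \<mu> = lam - phi c" using bd[OF h(1)] by blast
    have hg: "h (g x) = x" for x using h(2) by (metis comp_apply id_apply)
    have "phi m = h (g lam - \<mu>)" using m(2) hg by metis
    also have "\<dots> = phi c" unfolding wgrp_linear(2)[OF h(1)] hg c by simp
    finally have "m = c" by (simp only: phi_inj)
    then have "\<not> neg_at g i" for i using m(1) c(1) unfolding nonneg_def by (metis not_less)
    then have "g = id" using all_pos_id[OF g] pos_neg_at[OF g] by blast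
    then show False using False by simp
  qed
  then show ?thesis using False by simp
qed

lemma eps_eval:
  assumes g: "g \<in> wgrp J" and m: "g (phi m) = g lam - \<mu>"
  shows "eps lam g \<mu> = (if \<forall>i. m i < 0 \<longleftrightarrow> neg_at g i then sgn_at g else 0)"
proof -
  have "m' = m" if "g (phi m') = g lam - \<mu>" for m'
    using that m by (metis wgrp_inj[OF g] phi_inj)
  then show ?thesis unfolding eps_def using m by metis
qed

lemma eps_none: "(\<And>m. g (phi m) \<noteq> g lam - \<mu>) \<Longrightarrow> eps lam g \<mu> = 0"
  by (auto simp: eps_def)

lemma refl_inj: "refl j x = refl j y \<longleftrightarrow> x = y"
  by (metis refl_refl)

lemma refl_comp_cancel: "refl j \<circ> (refl j \<circ> g) = g"
  by (metis comp_assoc refl_comp id_comp)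

lemma eps_refl_same:
  assumes g: "g \<in> wgrp J" and j: "j \<in> J" and same: "\<And>i. neg_at (refl j \<circ> g) i \<longleftrightarrow> neg_at g i"
  shows "eps lam (refl j \<circ> g) (refl j \<mu>) = eps lam g \<mu>"
proof -
  have "(refl j \<circ> g) (phi m) = (refl j \<circ> g) lam - refl j \<mu> \<longleftrightarrow> g (phi m) = g lam - \<mu>" for m
    unfolding comp_apply refl_diff[symmetric] refl_inj ..
  moreover have "sgn_at (refl j \<circ> g) = sgn_at g" unfolding sgn_at_def same ..
  ultimately show ?thesis unfolding eps_def same by (simp only:)
qed

text \<open>The two inequalities say that \<open>g (al i)\<close> is neither \<open>al j\<close> nor
  its negative; these are the only roots whose sign \<open>refl j\<close> can change.\<close>

lemma neg_at_refl_same: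
  assumes g: "g \<in> wgrp J" and j: "j \<in> J"
    and "\<And>i. g (al i) \<noteq> al j" "\<And>i. (refl j \<circ> g) (al i) \<noteq> al j"
  shows "neg_at (refl j \<circ> g) i \<longleftrightarrow> neg_at g i"
proof -
  have g': "refl j \<circ> g \<in> wgrp J" using g j by (intro wgrp_comp wgrp_refl)
  have "pos_at g i \<Longrightarrow> pos_at (refl j \<circ> g) i" using refl_pos_at[OF g j] assms by blast
  moreover have "pos_at (refl j \<circ> g) i \<Longrightarrow> pos_at g i"
    using refl_pos_at[OF g' j, of i] assms(4) unfolding refl_comp_cancel by blast
  ultimately show ?thesis
    using pos_neg_at[OF g, of i] pos_neg_at[OF g', of i] not_pos_neg_at[OF g, of i]
      not_pos_neg_at[OF g', of i] by blast
qed

text \<open>The index \<open>i\<close> is the only one affected: by injectivity of \<open>g\<close>,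
  no other simple root is mapped to \<open>al j\<close> or to its negative.\<close>

lemma neg_at_refl_simple:
  assumes g: "g \<in> wgrp J" and j: "j \<in> J" and gi: "g (al i) = al j"
  shows "\<not> neg_at g i" "neg_at (refl j \<circ> g) k \<longleftrightarrow> neg_at g k \<or> k = i"
    "sgn_at (refl j \<circ> g) = - sgn_at g"
proof -
  have g': "refl j \<circ> g \<in> wgrp J" using g j by (intro wgrp_comp wgrp_refl)
  have posi: "pos_at g i" unfolding pos_at_def gi
    by (intro exI[of _ "unit_vec j"]) (simp add: phi_unit, simp add: unit_vec_def)
  then show ni: "\<not> neg_at g i" using not_pos_neg_at[OF g] by blast
  have negi: "neg_at (refl j \<circ> g) i" unfolding neg_at_def comp_apply gi refl_al
    by (intro exI[of _ "unit_vec j"]) (simp add: phi_unit, simp add: unit_vec_def)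
  have alne: "al k \<noteq> - al i" for k
  proof
    assume "al k = - al i"
    then have "unit_vec k = (\<lambda>l. - unit_vec i l)" by (metis phi_inj phi_unit phi_minus)
    then have "unit_vec k i = - unit_vec i i" by (rule fun_cong)
    then show False by (simp add: unit_vec_def split: if_splits)
  qed
  have *: "neg_at (refl j \<circ> g) k \<longleftrightarrow> neg_at g k" if k: "k \<noteq> i" for k
  proof -
    have "al k \<noteq> al i" using k by (metis phi_inj phi_unit unit_vec_def zero_neq_one)
    then have "g (al k) \<noteq> al j" using gi wgrp_inj[OF g] by metis
    then have "pos_at g k \<Longrightarrow> pos_at (refl j \<circ> g) k" using refl_pos_at[OF g j] by blast
    moreover have "(refl j \<circ> g) (al k) \<noteq> al j"
    proof
      assume "(refl j \<circ> g) (al k) = al j"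
      then have "g (al k) = refl j (al j)" by (metis comp_apply refl_refl)
      then have "g (al k) = g (- al i)" unfolding refl_al wgrp_linear(4)[OF g] gi .
      then show False using alne wgrp_inj[OF g] by metis
    qed
    then have "pos_at (refl j \<circ> g) k \<Longrightarrow> pos_at g k"
      using refl_pos_at[OF g' j, of k] unfolding refl_comp_cancel by blast
    ultimately show ?thesis
      using pos_neg_at[OF g, of k] pos_neg_at[OF g', of k] not_pos_neg_at[OF g, of k]
        not_pos_neg_at[OF g', of k] by blast
  qed
  then show "neg_at (refl j \<circ> g) k \<longleftrightarrow> neg_at g k \<or> k = i" using negi by metis
  have "sgn_at f = (if neg_at f i then - 1 else 1) * (\<Prod>k\<in>UNIV - {i}. if neg_at f k then - 1 else 1)" for f
    unfolding sgn_at_def by (rule prod.remove) auto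
  then show "sgn_at (refl j \<circ> g) = - sgn_at g"
    using ni negi * by simp
qed

lemma eps_pair_simple:
  assumes g: "g \<in> wgrp J" and j: "j \<in> J" and gi: "g (al i) = al j" and lam: "lam (co i) = of_int l"
  shows "eps lam g \<mu> + eps lam (refl j \<circ> g) \<mu> = eps lam g (refl j \<mu>) + eps lam (refl j \<circ> g) (refl j \<mu>)"
proof -
  \<comment> \<open>If \<open>m\<close> are the coordinates of \<open>lam\<close> minus a weight,
    then \<open>\<iota> m\<close> are those of \<open>lam\<close> minus its reflection at
    \<open>i\<close>. Only the coordinate at \<open>i\<close> moves.\<close>
  define \<iota> where "\<iota> m = m(i := l + m i - cpair i m)" for m
  have conj: "refl j \<circ> g = g \<circ> refl i" by (rule refl_conjugate[OF g j gi])
  have i: "i \<in> J" by (rule simple_image_inside[OF g j gi])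
  have g': "refl j \<circ> g \<in> wgrp J" using g j by (intro wgrp_comp wgrp_refl)
  have \<iota>: "phi (\<iota> m) = lam - refl i (lam - phi m)" for m
  proof -
    have "\<iota> m = (\<lambda>k. m k - (cpair i m - l) * unit_vec i k)"
      by (auto simp: \<iota>_def unit_vec_def)
    then have "phi (\<iota> m) = phi m - dual_scale (of_int (cpair i m - l)) (al i)"
      by (simp only: phi_diff phi_scale phi_unit)
    then show ?thesis
      by (simp add: refl_def phi_coroot lam dual_scale_def fun_eq_iff algebra_simps)
  qed
  have \<iota>\<iota>: "\<iota> (\<iota> m) = m" for m
  proof -
    have "phi (\<iota> (\<iota> m)) = phi m" unfolding \<iota> by simp
    then show ?thesis by (simp only: phi_inj)
  qed
  have eq: "a - (b - c) = a - x \<longleftrightarrow> c = b - x" for a b c x :: "'h \<Rightarrow> complex"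
    by (auto simp: fun_eq_iff algebra_simps)
  have e1: "(refl j \<circ> g) (phi (\<iota> m)) = (refl j \<circ> g) lam - \<mu> \<longleftrightarrow> g (phi m) = g lam - \<mu>" for m \<mu>
    unfolding conj comp_apply \<iota> refl_diff refl_refl wgrp_linear(2)[OF g] eq ..
  have e2: "(refl j \<circ> g) (phi m) = (refl j \<circ> g) lam - refl j \<mu> \<longleftrightarrow> g (phi m) = g lam - \<mu>" for m \<mu>
    unfolding comp_apply refl_diff[symmetric] refl_inj ..
  have e3: "g (phi (\<iota> m)) = g lam - refl j \<mu>" if "g (phi m) = g lam - \<mu>" for m
    using e1[of "\<iota> m" "refl j \<mu>"] e2[of m \<mu>] that unfolding \<iota>\<iota> by simp
  note neg = neg_at_refl_simple[OF g j gi]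
  show ?thesis
  proof (cases "\<exists>m. g (phi m) = g lam - \<mu>")
    case True
    then obtain m where m: "g (phi m) = g lam - \<mu>" by blast
    have out: "\<iota> m k = m k" if "k \<noteq> i" for k using that by (simp add: \<iota>_def)
    \<comment> \<open>The conditions away from \<open>i\<close> are common to all four coefficients.
      If they hold, each side of the claim is \<open>sgn_at g\<close> times 1, minus 1 if
      \<open>m i < 0\<close>, minus 1 if \<open>\<iota> m i < 0\<close>; this is symmetric in
      \<open>m i\<close> and \<open>\<iota> m i\<close>.\<close>
    define R where "R \<longleftrightarrow> (\<forall>k. k \<noteq> i \<longrightarrow> (m k < 0 \<longleftrightarrow> neg_at g k))"
    have "eps lam g \<mu> = (if R \<and> \<not> m i < 0 then sgn_at g else 0)"
      unfolding eps_eval[OF g m] R_def using neg(1) by (intro if_cong) auto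
    moreover have "eps lam (refl j \<circ> g) \<mu> = (if R \<and> \<iota> m i < 0 then - sgn_at g else 0)"
      unfolding eps_eval[OF g' e1[THEN iffD2, OF m]] R_def neg(2,3)
      using neg(1) out by (intro if_cong) (metis, simp_all)
    moreover have "eps lam g (refl j \<mu>) = (if R \<and> \<not> \<iota> m i < 0 then sgn_at g else 0)"
      unfolding eps_eval[OF g e3[OF m]] R_def using neg(1) out by (intro if_cong) (metis, simp_all)
    moreover have "eps lam (refl j \<circ> g) (refl j \<mu>) = (if R \<and> m i < 0 then - sgn_at g else 0)"
      unfolding eps_eval[OF g' e2[THEN iffD2, OF m]] R_def neg(2,3)
      using neg(1) by (intro if_cong) (metis, simp_all)
    ultimately show ?thesis by auto
  next
    case False
    have "eps lam g \<mu> = 0" using False by (intro eps_none) auto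
    moreover have "eps lam (refl j \<circ> g) \<mu> = 0"
      using False e1 \<iota>\<iota> by (intro eps_none) metis
    moreover have "eps lam (refl j \<circ> g) (refl j \<mu>) = 0"
      using False e2 by (intro eps_none) metis
    moreover have "eps lam g (refl j \<mu>) = 0"
      using False e1 e2 \<iota>\<iota> by (intro eps_none) metis
    ultimately show ?thesis by simp
  qed
qed

text \<open>Exchanging \<open>g\<close> and \<open>refl j \<circ> g\<close> swaps the two summands
  on each side, which reduces the second case to the first. If the descents agree, the two summands
  are exchanged by the reflection of \<mu>.\<close>

lemma eps_pair:
  assumes g: "g \<in> wgrp J" and j: "j \<in> J" and lam: "\<And>i. lam (co i) \<in> \<int>"
  shows "eps lam g \<mu> + eps lam (refl j \<circ> g) \<mu> = eps lam g (refl j \<mu>) + eps lam (refl j \<circ> g) (refl j \<mu>)"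
proof -
  have g': "refl j \<circ> g \<in> wgrp J" using g j by (intro wgrp_comp wgrp_refl)
  consider i where "g (al i) = al j" | i where "(refl j \<circ> g) (al i) = al j"
    | "\<And>i. g (al i) \<noteq> al j" "\<And>i. (refl j \<circ> g) (al i) \<noteq> al j" by blast
  then show ?thesis
  proof cases
    case 1
    then show ?thesis using eps_pair_simple[OF g j, of i lam] lam by (metis Ints_cases)
  next
    case 2
    obtain l where "lam (co i) = of_int l" using lam by (metis Ints_cases)
    from eps_pair_simple[of "refl j \<circ> g" J j i lam l \<mu>, OF g' j 2 this] show ?thesis
      unfolding refl_comp_cancel by simp
  next
    case 3
    have same: "neg_at (refl j \<circ> g) i \<longleftrightarrow> neg_at g i" for i
      by (rule neg_at_refl_same[OF g j 3])
    have "eps lam (refl j \<circ> g) (refl j \<mu>) = eps lam g \<mu>"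
      by (rule eps_refl_same[OF g j same])
    moreover have "eps lam (refl j \<circ> g) (refl j (refl j \<mu>)) = eps lam g (refl j \<mu>)"
      by (rule eps_refl_same[OF g j same])
    ultimately show ?thesis by simp
  qed
qed

section \<open>Invariance, finiteness and value of the sum\<close>

definition weyl_sum :: "'i set \<Rightarrow> ('h \<Rightarrow> complex) \<Rightarrow> ('h \<Rightarrow> complex) \<Rightarrow> int" where
  "weyl_sum J lam \<mu> = (\<Sum>g\<in>{g \<in> wgrp J. eps lam g \<mu> \<noteq> 0}. eps lam g \<mu>)"

lemma weyl_sum_refl:
  assumes j: "j \<in> J" and lam: "\<And>i. lam (co i) \<in> \<int>"
    and fin: "\<And>\<mu>. finite {g \<in> wgrp J. eps lam g \<mu> \<noteq> 0}"
  shows "weyl_sum J lam (refl j \<mu>) = weyl_sum J lam \<mu>"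
proof -
  define A where "A = {g \<in> wgrp J. eps lam g \<mu> \<noteq> 0} \<union> {g \<in> wgrp J. eps lam g (refl j \<mu>) \<noteq> 0}"
  \<comment> \<open>A finite set that contains both supports and is closed under left multiplication
    by \<open>refl j\<close>. Summing over it counts every pair twice, which avoids a choice of
    representatives.\<close>
  define B where "B = A \<union> (\<lambda>g. refl j \<circ> g) ` A"
  have B: "finite B" "B \<subseteq> wgrp J"
    using fin j by (auto simp: A_def B_def intro!: wgrp_comp wgrp_refl)
  have stable: "(\<lambda>g. refl j \<circ> g) ` B = B"
    unfolding B_def image_Un image_image refl_comp_cancel by auto
  have inj: "inj_on (\<lambda>g. refl j \<circ> g) B"
    by (rule inj_on_inverseI[of _ "\<lambda>g. refl j \<circ> g"]) (rule refl_comp_cancel)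
  have swap: "(\<Sum>g\<in>B. eps lam (refl j \<circ> g) \<nu>) = (\<Sum>g\<in>B. eps lam g \<nu>)" for \<nu>
    using sum.reindex[OF inj, of "\<lambda>g. eps lam g \<nu>"] unfolding stable by (simp add: o_def)
  have W: "weyl_sum J lam \<nu> = (\<Sum>g\<in>B. eps lam g \<nu>)" if "\<nu> = \<mu> \<or> \<nu> = refl j \<mu>" for \<nu>
    unfolding weyl_sum_def using B that by (intro sum.mono_neutral_left) (auto simp: A_def B_def)
  have "2 * (\<Sum>g\<in>B. eps lam g \<mu>) = (\<Sum>g\<in>B. eps lam g \<mu> + eps lam (refl j \<circ> g) \<mu>)"
    by (simp add: sum.distrib swap)
  also have "\<dots> = (\<Sum>g\<in>B. eps lam g (refl j \<mu>) + eps lam (refl j \<circ> g) (refl j \<mu>))"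
    using B j lam by (intro sum.cong eps_pair) auto
  also have "\<dots> = 2 * (\<Sum>g\<in>B. eps lam g (refl j \<mu>))"
    by (simp add: sum.distrib swap)
  finally show ?thesis using W by simp
qed

lemma weyl_sum_wgrp:
  assumes g: "g \<in> wgrp J" and lam: "\<And>i. lam (co i) \<in> \<int>"
    and fin: "\<And>\<mu>. finite {g \<in> wgrp J. eps lam g \<mu> \<noteq> 0}"
  shows "weyl_sum J lam (g \<mu>) = weyl_sum J lam \<mu>"
proof -
  obtain ws where ws: "set ws \<subseteq> J" "g = rw ws" using g by (rule wgrpE)
  have "weyl_sum J lam (rw ws \<mu>) = weyl_sum J lam \<mu>"
    using ws(1) by (induction ws) (simp_all add: weyl_sum_refl[OF _ lam fin])
  then show ?thesis using ws by simp
qed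

lemma finite_bounded_nonneg: "finite {a. nonneg a \<and> (\<forall>i. a i \<le> n i)}"
proof -
  have "{a. nonneg a \<and> (\<forall>i. a i \<le> n i)} \<subseteq> (UNIV \<rightarrow>\<^sub>E {0..Max (range n)})"
  proof
    fix a assume "a \<in> {a. nonneg a \<and> (\<forall>i. a i \<le> n i)}"
    then have a: "0 \<le> a i" "a i \<le> n i" for i by (auto simp: nonneg_def)
    have "a i \<le> Max (range n)" for i using order_trans[OF a(2) Max_ge] by simp
    then show "a \<in> (UNIV \<rightarrow>\<^sub>E {0..Max (range n)})" using a by auto
  qed
  then show ?thesis by (rule finite_subset) (intro finite_PiE; simp)
qed

text \<open>A contributing \<open>g\<close> satisfies \<mu> \<le> \<open>g lam\<close> \<le>
  \<open>lam\<close> in the root order, so \<open>g lam\<close> takes finitely many values. The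
  \<open>g\<close> with a given value form a coset of the stabilizer of \<open>lam\<close>.\<close>

lemma finite_eps:
  assumes bd: "\<And>g. g \<in> wgrp J \<Longrightarrow> \<exists>c. nonneg c \<and> g lam = lam - phi c"
    and stab: "finite {g \<in> wgrp J. g lam = lam}"
  shows "finite {g \<in> wgrp J. eps lam g \<mu> \<noteq> 0}"
proof (cases "{g \<in> wgrp J. eps lam g \<mu> \<noteq> 0} = {}")
  case False
  have below: "\<exists>a c. nonneg a \<and> nonneg c \<and> g lam = lam - phi a \<and> \<mu> = lam - phi (\<lambda>i. a i + c i)"
    if ge: "g \<in> wgrp J" "eps lam g \<mu> \<noteq> 0" for g
  proof -
    obtain c where c: "nonneg c" "\<mu> = g lam - phi c" by (rule eps_below[OF ge])
    obtain a where a: "nonneg a" "g lam = lam - phi a" using bd ge by blast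
    have "\<mu> = lam - phi (\<lambda>i. a i + c i)" unfolding phi_add c(2) a(2) by (simp only: diff_diff_eq)
    then show ?thesis using a c by blast
  qed
  then obtain n where n: "\<mu> = lam - phi n" using False by blast
  have "(\<lambda>g. g lam) ` {g \<in> wgrp J. eps lam g \<mu> \<noteq> 0}
      \<subseteq> (\<lambda>a. lam - phi a) ` {a. nonneg a \<and> (\<forall>i. a i \<le> n i)}"
  proof
    fix x assume "x \<in> (\<lambda>g. g lam) ` {g \<in> wgrp J. eps lam g \<mu> \<noteq> 0}"
    then obtain a c where ac: "nonneg a" "nonneg c" "x = lam - phi a" "\<mu> = lam - phi (\<lambda>i. a i + c i)"
      using below by blast
    have "phi n = phi (\<lambda>i. a i + c i)" using n ac(4) by (metis diff_diff_eq2 add_diff_cancel_left')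
    then have "n i = a i + c i" for i unfolding phi_inj by (rule fun_cong)
    then have "a i \<le> n i" for i using ac(2) by (simp add: nonneg_def)
    then show "x \<in> (\<lambda>a. lam - phi a) ` {a. nonneg a \<and> (\<forall>i. a i \<le> n i)}" using ac by blast
  qed
  then have fin: "finite ((\<lambda>g. g lam) ` {g \<in> wgrp J. eps lam g \<mu> \<noteq> 0})"
    by (rule finite_subset) (intro finite_imageI finite_bounded_nonneg)
  have fibre: "finite {g \<in> wgrp J. g lam = x}" for x
  proof (cases "{g \<in> wgrp J. g lam = x} = {}")
    case False
    then obtain g0 where g0: "g0 \<in> wgrp J" "g0 lam = x" by blast
    obtain h where h: "h \<in> wgrp J" "h \<circ> g0 = id" "g0 \<circ> h = id" using g0(1) by (rule wgrp_inverse)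
    have hx: "h x = lam" using h g0 by (metis comp_apply id_apply)
    have "{g \<in> wgrp J. g lam = x} \<subseteq> (\<lambda>g. g0 \<circ> g) ` {g \<in> wgrp J. g lam = lam}"
    proof
      fix g assume g: "g \<in> {g \<in> wgrp J. g lam = x}"
      then have "g = g0 \<circ> (h \<circ> g)" using h by (metis comp_assoc id_comp)
      moreover have "h \<circ> g \<in> {g \<in> wgrp J. g lam = lam}" using g h(1) hx by (auto intro: wgrp_comp)
      ultimately show "g \<in> (\<lambda>g. g0 \<circ> g) ` {g \<in> wgrp J. g lam = lam}" by blast
    qed
    then show ?thesis by (rule finite_subset) (intro finite_imageI stab)
  qed (simp only: finite.emptyI)
  have "{g \<in> wgrp J. eps lam g \<mu> \<noteq> 0}
     \<subseteq> (\<Union>x\<in>(\<lambda>g. g lam) ` {g \<in> wgrp J. eps lam g \<mu> \<noteq> 0}. {g \<in> wgrp J. g lam = x})" by blast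
  then show ?thesis using fin fibre by (meson finite_UN_I finite_subset)
qed (simp only: finite.emptyI)

theorem weyl_sum_eq:
  assumes lam: "\<And>i. lam (co i) \<in> \<int>"
    and bd: "\<And>g. g \<in> wgrp J \<Longrightarrow> \<exists>c. nonneg c \<and> g lam = lam - phi c"
    and stab: "finite {g \<in> wgrp J. g lam = lam}"
  shows "weyl_sum J lam \<mu> = (if \<forall>g\<in>wgrp J. \<exists>c. nonneg c \<and> g \<mu> = lam - phi c then 1 else 0)"
proof (cases "\<forall>g\<in>wgrp J. \<exists>c. nonneg c \<and> g \<mu> = lam - phi c")
  case True
  then have e: "eps lam g \<mu> = (if g = id then 1 else 0)" if "g \<in> wgrp J" for g
    using eps_orbit_bounded[of J \<mu> lam g] that by blast
  then have "{g \<in> wgrp J. eps lam g \<mu> \<noteq> 0} = {id}" using wgrp_id by (auto split: if_splits)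
  then show ?thesis using e[OF wgrp_id] True by (simp add: weyl_sum_def)
next
  case False
  then obtain g where g: "g \<in> wgrp J" "\<not> (\<exists>c. nonneg c \<and> g \<mu> = lam - phi c)" by blast
  have zero: "eps lam h (g \<mu>) = 0" if h: "h \<in> wgrp J" for h
  proof (rule ccontr)
    assume "eps lam h (g \<mu>) \<noteq> 0"
    with h obtain c where c: "nonneg c" "g \<mu> = h lam - phi c" by (rule eps_below)
    obtain a where a: "nonneg a" "h lam = lam - phi a" using bd h by blast
    have "g \<mu> = lam - phi (\<lambda>i. a i + c i)" unfolding phi_add c(2) a(2) by (simp only: diff_diff_eq)
    moreover have "nonneg (\<lambda>i. a i + c i)" using a c by (simp add: nonneg_def)
    ultimately show False using g by blast
  qed
  have fin: "finite {g \<in> wgrp J. eps lam g \<nu> \<noteq> 0}" for \<nu>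
    by (rule finite_eps) (use bd stab in blast)+
  have "weyl_sum J lam (g \<mu>) = 0" using zero by (simp add: weyl_sum_def)
  then show ?thesis using weyl_sum_wgrp[OF g(1) lam fin] False by auto
qed

section \<open>Comparison with the Weyl group and the expansions in the statement\<close>

lemma dual_space_iff:
  "\<mu> \<in> dual_space D \<longleftrightarrow> (\<forall>x y. \<mu> (x + y) = \<mu> x + \<mu> y) \<and> (\<forall>c x. \<mu> (scl D c x) = c * \<mu> x)"
proof -
  have "vector_space ((*) :: complex \<Rightarrow> complex \<Rightarrow> complex)"
    by unfold_locales (auto simp: algebra_simps)
  then show ?thesis by (simp add: dual_space_def Vector_Spaces.linear_iff vs_scl)
qed

lemma refl_dual: "\<mu> \<in> dual_space D \<Longrightarrow> refl j \<mu> \<in> dual_space D"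
  using sroot_dual[of j] by (simp add: dual_space_iff refl_def dual_scale_def algebra_simps)

lemma wgrp_dual: assumes "g \<in> wgrp J" "\<mu> \<in> dual_space D" shows "g \<mu> \<in> dual_space D"
proof -
  obtain ws where ws: "g = rw ws" using assms(1) by (rule wgrpE)
  show ?thesis unfolding ws using assms(2) by (induction ws) (auto intro: refl_dual)
qed

text \<open>Elements of \<open>BijGroup\<close> are extensional, so a map on all functions has to be
  cut down before it can be compared with them.\<close>

definition rst :: "(('h \<Rightarrow> complex) \<Rightarrow> 'h \<Rightarrow> complex) \<Rightarrow> ('h \<Rightarrow> complex) \<Rightarrow> 'h \<Rightarrow> complex" where
  "rst g = restrict g (dual_space D)"

lemma simple_refl_rst: "simple_refl D j = rst (refl j)"
  by (auto simp: simple_refl_def rst_def refl_def restrict_def)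

lemma rst_carrier: assumes "g \<in> wgrp J" shows "rst g \<in> carrier (BijGroup (dual_space D))"
proof -
  obtain h where h: "h \<in> wgrp J" "h \<circ> g = id" "g \<circ> h = id" using assms by (rule wgrp_inverse)
  have "bij_betw g (dual_space D) (dual_space D)"
    by (rule bij_betw_byWitness[where f' = h])
       (use h assms wgrp_dual in \<open>auto simp: fun_eq_iff[of "_ \<circ> _"]\<close>)
  then show ?thesis by (simp add: BijGroup_def Bij_def rst_def bij_betw_restrict_eq)
qed

lemma rst_mult:
  assumes "g \<in> wgrp J" "h \<in> wgrp J"
  shows "rst g \<otimes>\<^bsub>BijGroup (dual_space D)\<^esub> rst h = rst (g \<circ> h)"
proof -
  have "rst g \<in> Bij (dual_space D)" "rst h \<in> Bij (dual_space D)"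
    using assms[THEN rst_carrier] by (auto simp: BijGroup_def)
  then have "rst g \<otimes>\<^bsub>BijGroup (dual_space D)\<^esub> rst h = compose (dual_space D) (rst g) (rst h)"
    by (simp add: BijGroup_def)
  also have "\<dots> = rst (g \<circ> h)"
    using wgrp_dual[OF assms(2)] by (auto simp: compose_def rst_def restrict_def)
  finally show ?thesis .
qed

lemma parabolic_weyl_eq: "parabolic_weyl D J = rst ` wgrp J"
proof
  interpret G: group "BijGroup (dual_space D)" by (rule group_BijGroup)
  have one: "rst id = \<one>\<^bsub>BijGroup (dual_space D)\<^esub>"
    by (auto simp: BijGroup_def rst_def restrict_def)
  show "parabolic_weyl D J \<subseteq> rst ` wgrp J"
  proof
    fix w assume "w \<in> parabolic_weyl D J"
    then have "w \<in> generate (BijGroup (dual_space D)) (simple_refl D ` J)"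
      by (simp add: parabolic_weyl_def)
    then show "w \<in> rst ` wgrp J"
    proof (induction rule: generate.induct)
      case one
      then show ?case using \<open>rst id = _\<close> wgrp_id by (metis image_eqI)
    next
      case (incl h)
      then show ?case by (auto simp: simple_refl_rst intro: wgrp_refl)
    next
      \<comment> \<open>Simple reflections are involutions, so the inverses allowed in
        \<open>generate\<close> add no new words.\<close>
      case (inv h)
      then obtain j where j: "j \<in> J" "h = rst (refl j)" by (auto simp: simple_refl_rst)
      have "inv\<^bsub>BijGroup (dual_space D)\<^esub> h = h"
      proof (rule G.inv_equality)
        have "h \<otimes>\<^bsub>BijGroup (dual_space D)\<^esub> h = rst (refl j \<circ> refl j)"
          unfolding j(2) by (rule rst_mult[OF wgrp_refl wgrp_refl, OF j(1) j(1)])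
        then show "h \<otimes>\<^bsub>BijGroup (dual_space D)\<^esub> h = \<one>\<^bsub>BijGroup (dual_space D)\<^esub>"
          unfolding refl_comp one .
        show "h \<in> carrier (BijGroup (dual_space D))" "h \<in> carrier (BijGroup (dual_space D))"
          unfolding j(2) by (rule rst_carrier[OF wgrp_refl[OF j(1)]])+
      qed
      then show ?case using j by (auto intro: wgrp_refl)
    next
      case (eng h1 h2)
      then obtain g1 g2 where "g1 \<in> wgrp J" "h1 = rst g1" "g2 \<in> wgrp J" "h2 = rst g2" by blast
      then have "h1 \<otimes>\<^bsub>BijGroup (dual_space D)\<^esub> h2 = rst (g1 \<circ> g2)" "g1 \<circ> g2 \<in> wgrp J"
        using rst_mult wgrp_comp by blast+
      then show ?case by blast
    qed
  qed
  have "rst (rw ws) \<in> generate (BijGroup (dual_space D)) (simple_refl D ` J)" if "set ws \<subseteq> J" for ws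
    using that
  proof (induction ws)
    case Nil
    then show ?case using one generate.one by (metis rw_Nil)
  next
    case (Cons s ws)
    have "rst (refl s) \<in> generate (BijGroup (dual_space D)) (simple_refl D ` J)"
      using Cons.prems by (intro generate.incl) (auto simp: simple_refl_rst)
    from generate.eng[OF this] have "rst (refl s) \<otimes>\<^bsub>BijGroup (dual_space D)\<^esub> rst (rw ws)
        \<in> generate (BijGroup (dual_space D)) (simple_refl D ` J)"
      using Cons by simp
    moreover have "rst (refl s) \<otimes>\<^bsub>BijGroup (dual_space D)\<^esub> rst (rw ws) = rst (refl s \<circ> rw ws)"
      using Cons.prems by (intro rst_mult[where J = J] wgrp_refl wgrpI) auto
    ultimately show ?case unfolding rw_Cons by metis
  qed
  then show "rst ` wgrp J \<subseteq> parabolic_weyl D J"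
    by (auto simp: parabolic_weyl_def elim!: wgrpE)
qed

text \<open>The simple roots lie in the dual space, and an element of \<open>wgrp J\<close> that
  fixes all of them is the identity.\<close>

lemma rst_inj: "inj_on rst (wgrp J)"
proof
  fix g g' assume g: "g \<in> wgrp J" "g' \<in> wgrp J" and eq: "rst g = rst g'"
  obtain h where h: "h \<in> wgrp J" "h \<circ> g = id" "g \<circ> h = id" using g(1) by (rule wgrp_inverse)
  have T: "h \<circ> g' \<in> wgrp J" using h g by (intro wgrp_comp)
  have "g' (al i) = g (al i)" for i
    using fun_cong[OF eq, of "al i"] sroot_dual by (simp add: rst_def)
  then have "(h \<circ> g') (al i) = al i" for i using h by (metis comp_apply id_apply)
  then have "pos_at (h \<circ> g') i" for i
    unfolding pos_at_def by (intro exI[of _ "unit_vec i"]) (simp add: phi_unit, simp add: unit_vec_def)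
  then have "h \<circ> g' = id" by (rule all_pos_id[OF T])
  then have "g \<circ> (h \<circ> g') = g" by simp
  then show "g = g'" using h(3) by (simp add: comp_assoc[symmetric])
qed

lemma pos_cone_eq: "pos_cone D = {phi c | c. nonneg c}"
proof -
  have e: "(\<Sum>i\<in>UNIV. dual_scale (of_nat (n i)) (al i)) = phi (\<lambda>i. int (n i))" for n
  proof -
    have "(\<Sum>i\<in>UNIV. dual_scale (of_int (int (n i))) (al i)) = phi (\<lambda>i. int (n i))"
      using wgrp_phi_sum[OF wgrp_id, of "\<lambda>i. int (n i)"] by simp
    then show ?thesis by simp
  qed
  have "\<exists>n. phi c = phi (\<lambda>i. int (n i))" if "nonneg c" for c
    using that by (intro exI[of _ "\<lambda>i. nat (c i)"]) (simp add: nonneg_def)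
  then show ?thesis unfolding pos_cone_def e by (auto simp: nonneg_def)
qed

lemma wgrp_real_root: "g \<in> wgrp J \<Longrightarrow> g (al i) \<in> real_roots D"
  unfolding real_roots_def parabolic_weyl_eq
  using wgrp_mono[of J UNIV g] sroot_dual
  by (intro CollectI exI[of _ "rst g"] exI[of _ i]) (auto simp: rst_def)

lemma pos_real_root_iff: "g \<in> wgrp J \<Longrightarrow> pos_real_root D (g (al i)) \<longleftrightarrow> pos_at g i"
  using wgrp_real_root by (auto simp: pos_real_root_def pos_cone_eq pos_at_def nonneg_def)

lemma neg_real_root_iff: "g \<in> wgrp J \<Longrightarrow> neg_real_root D (g (al i)) \<longleftrightarrow> neg_at g i"
  using wgrp_real_root
  by (auto simp: neg_real_root_def pos_cone_eq neg_at_def nonneg_def) (metis minus_minus)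

text \<open>Both expansions are supported on the multiples by \<open>- m\<close> of the root for
  integers \<open>m\<close>, with \<open>m \<ge> 0\<close> for a positive root and
  \<open>m < 0\<close> for a negative one. This gives one formula with the descent condition built
  in.\<close>

lemma hw_expansion_eq:
  assumes g: "g \<in> wgrp J"
  shows "hw_expansion D (g (al i)) \<nu> =
    (if \<exists>m. (m < 0 \<longleftrightarrow> neg_at g i) \<and> \<nu> = - dual_scale (of_int m) (g (al i))
     then (if neg_at g i then - 1 else 1) else 0)"
proof (cases "neg_at g i")
  case True
  then have np: "\<not> pos_at g i" using not_pos_neg_at[OF g] by blast
  have "(\<exists>k::nat. k \<ge> 1 \<and> \<nu> = dual_scale (of_nat k) (g (al i))) \<longleftrightarrow>
    (\<exists>m<0. \<nu> = - dual_scale (of_int m) (g (al i)))" (is "?L \<longleftrightarrow> ?R")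
  proof
    assume ?L
    then obtain k :: nat where "k \<ge> 1" "\<nu> = dual_scale (of_nat k) (g (al i))" by blast
    then show ?R by (intro exI[of _ "- int k"]) (auto simp: dual_scale_def fun_eq_iff)
  next
    assume ?R
    then obtain m where m: "m < 0" "\<nu> = - dual_scale (of_int m) (g (al i))" by blast
    then have "of_nat (nat (- m)) = - (of_int m :: complex)"
      by (metis less_imp_le neg_0_le_iff_le of_int_minus of_nat_nat)
    then show ?L using m by (intro exI[of _ "nat (- m)"]) (auto simp: dual_scale_def fun_eq_iff)
  qed
  then show ?thesis using True np g
    by (auto simp: hw_expansion_def pos_real_root_iff neg_real_root_iff)
next
  case False
  then have p: "pos_at g i" using pos_neg_at[OF g] by blast
  have "(\<exists>k::nat. \<nu> = - dual_scale (of_nat k) (g (al i))) \<longleftrightarrow>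
    (\<exists>m. \<not> m < 0 \<and> \<nu> = - dual_scale (of_int m) (g (al i)))"
    by (metis not_less of_int_of_nat_eq of_nat_0_le_iff zero_le_imp_eq_int)
  then show ?thesis using False p g
    by (auto simp: hw_expansion_def pos_real_root_iff neg_real_root_iff)
qed

text \<open>The images of the simple roots under \<open>g\<close> are linearly independent, so at
  most one family of exponents contributes and the multiplied-out product is a single term.\<close>

lemma weyl_summand_eq:
  assumes g: "g \<in> wgrp J" and lam: "lam \<in> dual_space D"
  shows "weyl_summand D lam (rst g) \<mu> = eps lam g \<mu>"
proof -
  define F where "F = (\<lambda>i. hw_expansion D (g (al i)))"
  define V where "V m = (\<lambda>i. - dual_scale (of_int (m i)) (g (al i)))" for m
  have Vsum: "(\<Sum>i\<in>UNIV. V m i) = - g (phi m)" for m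
    unfolding V_def wgrp_phi_sum[OF g] by (simp add: sum_negf)
  have Fnz: "F i \<nu> \<noteq> 0 \<longleftrightarrow> (\<exists>m. (m < 0 \<longleftrightarrow> neg_at g i) \<and> \<nu> = - dual_scale (of_int m) (g (al i)))" for i \<nu>
    by (simp add: F_def hw_expansion_eq[OF g])
  have fam: "prod_families F (\<mu> - g lam) = V ` {m. (\<forall>i. m i < 0 \<longleftrightarrow> neg_at g i) \<and> g (phi m) = g lam - \<mu>}"
    (is "_ = V ` ?M")
  proof (intro equalityI subsetI)
    fix \<nu> assume \<nu>: "\<nu> \<in> prod_families F (\<mu> - g lam)"
    then have "\<forall>i. \<exists>m. (m < 0 \<longleftrightarrow> neg_at g i) \<and> \<nu> i = - dual_scale (of_int m) (g (al i))"
      by (simp add: prod_families_def Fnz)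
    then obtain m where m: "\<And>i. m i < 0 \<longleftrightarrow> neg_at g i" "\<And>i. \<nu> i = - dual_scale (of_int (m i)) (g (al i))"
      by metis
    have \<nu>V: "\<nu> = V m" unfolding V_def using m(2) by blast
    have "- g (phi m) = \<mu> - g lam" using \<nu> Vsum[of m] unfolding \<nu>V prod_families_def by simp
    then have "g (phi m) = g lam - \<mu>" by (metis minus_diff_eq minus_minus)
    then show "\<nu> \<in> V ` ?M" using m(1) \<nu>V by blast
  next
    fix \<nu> assume "\<nu> \<in> V ` ?M"
    then obtain m where m: "\<forall>i. m i < 0 \<longleftrightarrow> neg_at g i" "g (phi m) = g lam - \<mu>" "\<nu> = V m" by blast
    have "(\<Sum>i\<in>UNIV. \<nu> i) = \<mu> - g lam" unfolding m(3) Vsum m(2) by (rule minus_diff_eq)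
    moreover have "F i (\<nu> i) \<noteq> 0" for i unfolding Fnz m(3) V_def using m(1) by blast
    ultimately show "\<nu> \<in> prod_families F (\<mu> - g lam)" by (simp add: prod_families_def)
  qed
  have Fval: "F i (V m i) = (if neg_at g i then - 1 else 1)" if "\<forall>i. m i < 0 \<longleftrightarrow> neg_at g i" for m i
    unfolding F_def hw_expansion_eq[OF g] V_def using that by (intro if_P) blast
  have "rst g lam = g lam" "\<And>i. rst g (al i) = g (al i)"
    using lam sroot_dual by (simp_all add: rst_def)
  then have "weyl_summand D lam (rst g) \<mu> = fsum_prod F (\<mu> - g lam)"
    unfolding weyl_summand_def fsum_shift_def F_def by (simp only:)
  also have "\<dots> = eps lam g \<mu>"
  proof (cases "?M = {}")
    case True
    then have "\<not> (\<exists>m. (\<forall>i. m i < 0 \<longleftrightarrow> neg_at g i) \<and> g (phi m) = g lam - \<mu>)" by blast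
    then have "eps lam g \<mu> = 0" unfolding eps_def by (rule if_not_P)
    then show ?thesis unfolding fsum_prod_def fam True by simp
  next
    case False
    then obtain m where m: "m \<in> ?M" by blast
    have m': "\<forall>i. m i < 0 \<longleftrightarrow> neg_at g i" "g (phi m) = g lam - \<mu>" using m by blast+
    have uniq: "n = m" if "g (phi n) = g lam - \<mu>" for n
    proof -
      have "g (phi n) = g (phi m)" using that m'(2) by (simp only:)
      then show ?thesis unfolding wgrp_inj[OF g] phi_inj .
    qed
    have "?M = {m}" using m uniq by blast
    then have "V ` ?M = {V m}" by (simp only: image_insert image_empty)
    then have "fsum_prod F (\<mu> - g lam) = (\<Prod>i\<in>UNIV. F i (V m i))"
      unfolding fsum_prod_def fam by (simp only: sum.insert finite.emptyI empty_iff not_False_eq_True sum.empty add_0_right)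
    also have "\<dots> = sgn_at g" unfolding sgn_at_def by (rule prod.cong[OF HOL.refl Fval[OF m'(1)]])
    also have "\<dots> = eps lam g \<mu>" unfolding eps_def by (rule if_P[symmetric]) (use m' in blast)
    finally show ?thesis .
  qed
  finally show ?thesis .
qed

end

section \<open>The generators as operators on a module\<close>

lemma poly_mapping_sum_single: "p = (\<Sum>k\<in>Poly_Mapping.keys p. Poly_Mapping.single k (Poly_Mapping.lookup p k))"
  by (rule poly_mapping_eqI)
     (simp add: lookup_sum lookup_single when_def in_keys_iff)

locale km_module = km_setting D
  for D :: "('i::finite, 'h::ab_group_add) km_datum" +
  fixes act :: "('i, 'h) uq_gen falg set \<Rightarrow> 'v \<Rightarrow> 'v::ab_group_add"
  assumes left_mod: "left_module (uq D) act"
begin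

abbreviation "A \<equiv> free_algebra (uq_gens D)"
abbreviation "PV \<equiv> coweight_lattice D"

text \<open>The free algebra acts through the quotient. Working with representatives confines the
  handling of cosets to the next few lemmas.\<close>

definition op :: "('i, 'h) uq_gen falg \<Rightarrow> 'v \<Rightarrow> 'v" where
  "op p = act (uq_class D p)"

abbreviation "scal \<equiv> scalar_act D act"
abbreviation "E i \<equiv> op (gen (Eg i))"
abbreviation "F i \<equiv> op (gen (Fg i))"
abbreviation "K h \<equiv> op (gen (Kg h))"

lemma A_ops: "mult A = (*)" "ring.add A = (+)" "monoid.one A = 1" "ring.zero A = 0"
  by (simp_all add: free_algebra_def)

lemma A_ring: "ring A" by (rule ring_free_algebra)

lemma A_closed:
  "p \<in> carrier A \<Longrightarrow> p' \<in> carrier A \<Longrightarrow> p + p' \<in> carrier A"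
  "p \<in> carrier A \<Longrightarrow> p' \<in> carrier A \<Longrightarrow> p * p' \<in> carrier A"
  "1 \<in> carrier A" "0 \<in> carrier A"
  "p \<in> carrier A \<Longrightarrow> p' \<in> carrier A \<Longrightarrow> p - p' \<in> carrier A"
proof -
  interpret ring A by (rule A_ring)
  show "p \<in> carrier A \<Longrightarrow> p' \<in> carrier A \<Longrightarrow> p + p' \<in> carrier A"
    using add.m_closed unfolding A_ops .
  show "p \<in> carrier A \<Longrightarrow> p' \<in> carrier A \<Longrightarrow> p * p' \<in> carrier A"
    using m_closed unfolding A_ops .
  show "1 \<in> carrier A" using one_closed unfolding A_ops .
  show "0 \<in> carrier A" using zero_closed unfolding A_ops .
  assume p: "p \<in> carrier A" "p' \<in> carrier A"
  then have "- p' \<in> carrier A" by (simp add: free_algebra_def)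
  then have "p + - p' \<in> carrier A" using p add.m_closed unfolding A_ops by blast
  then show "p - p' \<in> carrier A" by simp
qed

lemma A_power: "p \<in> carrier A \<Longrightarrow> p ^ n \<in> carrier A"
  by (induction n) (simp_all add: A_closed)

lemma A_sum: "(\<And>s. s \<in> S \<Longrightarrow> f s \<in> carrier A) \<Longrightarrow> (\<Sum>s\<in>S. f s) \<in> carrier A"
  by (induction S rule: infinite_finite_induct) (simp_all add: A_closed)

lemma A_const: "const c \<in> carrier A"
  by (simp add: free_algebra_def const_def zero_fword_def)

lemma A_gen:
  "gen (Eg i) \<in> carrier A" "gen (Fg i) \<in> carrier A" "h \<in> PV \<Longrightarrow> gen (Kg h) \<in> carrier A"
  by (auto simp: free_algebra_def gen_def uq_gens_def)

lemma uq_ideal_ideal: "ideal (uq_ideal D) A"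
  unfolding uq_ideal_def by (rule ring.genideal_ideal[OF A_ring uq_relators_in_carrier[OF datum]])

lemma class_hom: "uq_class D \<in> ring_hom A (uq D)"
  using ideal.rcos_ring_hom[OF uq_ideal_ideal] by (simp add: uq_class_def[abs_def] uq_def)

lemma class_closed: "p \<in> carrier A \<Longrightarrow> uq_class D p \<in> carrier (uq D)"
  using class_hom by (auto simp: ring_hom_def)

lemma carrier_uq: "carrier (uq D) = uq_class D ` carrier A"
  by (auto simp: uq_def uq_class_def FactRing_def A_RCOSETS_def')

lemma act_props:
  "a \<in> carrier (uq D) \<Longrightarrow> act a (v + v') = act a v + act a v'"
  "a \<in> carrier (uq D) \<Longrightarrow> b \<in> carrier (uq D) \<Longrightarrow> act (a \<oplus>\<^bsub>uq D\<^esub> b) v = act a v + act b v"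
  "a \<in> carrier (uq D) \<Longrightarrow> b \<in> carrier (uq D) \<Longrightarrow> act (a \<otimes>\<^bsub>uq D\<^esub> b) v = act a (act b v)"
  "act \<one>\<^bsub>uq D\<^esub> v = v"
  using left_mod by (auto simp: left_module_def)

lemma op_add_vec: "p \<in> carrier A \<Longrightarrow> op p (v + v') = op p v + op p v'"
  unfolding op_def by (rule act_props(1)[OF class_closed])

lemma op_add: "p \<in> carrier A \<Longrightarrow> p' \<in> carrier A \<Longrightarrow> op (p + p') v = op p v + op p' v"
  using ring_hom_add[OF class_hom, of p p'] act_props(2)[OF class_closed class_closed, of p p' v]
  by (simp add: op_def A_ops)

lemma op_mult: "p \<in> carrier A \<Longrightarrow> p' \<in> carrier A \<Longrightarrow> op (p * p') v = op p (op p' v)"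
  using ring_hom_mult[OF class_hom, of p p'] act_props(3)[OF class_closed class_closed, of p p' v]
  by (simp add: op_def A_ops)

lemma op_one [simp]: "op 1 v = v"
  using ring_hom_one[OF class_hom] act_props(4) by (simp add: op_def A_ops)

lemma op_zero_vec: "p \<in> carrier A \<Longrightarrow> op p 0 = 0"
  using op_add_vec[of p 0 0] by simp

lemma op_zero [simp]: "op 0 v = 0"
  using op_add[of 0 0 v] A_closed by simp

lemma op_diff: "p \<in> carrier A \<Longrightarrow> p' \<in> carrier A \<Longrightarrow> op (p - p') v = op p v - op p' v"
  using op_add[of "p - p'" p' v] A_closed by simp

lemma op_diff_vec: "p \<in> carrier A \<Longrightarrow> op p (v - v') = op p v - op p v'"
  using op_add_vec[of p "v - v'" v'] by simp

lemma op_sum: "(\<And>s. s \<in> S \<Longrightarrow> f s \<in> carrier A) \<Longrightarrow> op (\<Sum>s\<in>S. f s) v = (\<Sum>s\<in>S. op (f s) v)"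
  by (induction S rule: infinite_finite_induct) (simp_all add: op_add A_sum)

lemma op_power: "p \<in> carrier A \<Longrightarrow> op (p ^ n) v = (op p ^^ n) v"
  by (induction n) (simp_all add: op_mult A_power)

lemma op_relator: assumes "r \<in> uq_relators D" shows "op r v = 0"
proof -
  interpret I: ideal "uq_ideal D" A by (rule uq_ideal_ideal)
  have r: "r \<in> uq_ideal D"
    using ring.genideal_self[OF A_ring uq_relators_in_carrier[OF datum]] assms
    by (auto simp: uq_ideal_def)
  have "uq_class D r = uq_ideal D" unfolding uq_class_def by (rule I.a_rcos_const[OF r])
  also have "\<dots> = uq_class D 0"
    unfolding uq_class_def using I.a_rcos_const[of 0] additive_subgroup.zero_closed[OF I.additive_subgroup_axioms] by (simp add: A_ops)
  finally show ?thesis using op_zero by (simp add: op_def)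
qed

lemma op_relator_eq: "p - p' \<in> uq_relators D \<Longrightarrow> p \<in> carrier A \<Longrightarrow> p' \<in> carrier A \<Longrightarrow> op p v = op p' v"
  using op_relator[of "p - p'" v] op_diff[of p p' v] by simp

lemma scal_op: "scal c = op (const c)"
  by (simp add: scalar_act_def op_def)

lemma const_ops: "const c + const d = const (c + d)" "const c * const d = const (c * d)" "const 1 = 1"
  by (simp_all add: const_def single_add mult_single)

lemma vs_scal: "vector_space scal"
proof
  show "scal a (x + y) = scal a x + scal a y" for a x y
    unfolding scal_op by (rule op_add_vec[OF A_const])
  show "scal (a + b) x = scal a x + scal b x" for a b x
    unfolding scal_op const_ops(1)[symmetric] by (rule op_add[OF A_const A_const])
  show "scal a (scal b x) = scal (a * b) x" for a b x
    unfolding scal_op const_ops(2)[symmetric] by (rule op_mult[OF A_const A_const, symmetric])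
  show "scal 1 x = x" for x
    unfolding scal_op const_ops(3) by (rule op_one)
qed

sublocale vec: vector_space scal by (rule vs_scal)

lemma gen_const: "gen g * const c = const c * gen g"
  by (simp add: gen_def const_def mult_single)

lemma op_scal:
  assumes "gen g \<in> carrier A" shows "op (gen g) (scal c v) = scal c (op (gen g) v)"
proof -
  have "op (gen g * const c) v = op (const c * gen g) v" unfolding gen_const ..
  then show ?thesis unfolding scal_op using assms A_const by (simp only: op_mult)
qed

lemma E_lin: "E i (u + v) = E i u + E i v" "E i (scal c u) = scal c (E i u)" "E i 0 = 0" "E i (u - v) = E i u - E i v"
  and F_lin: "F i (u + v) = F i u + F i v" "F i (scal c u) = scal c (F i u)" "F i 0 = 0" "F i (u - v) = F i u - F i v"
  and K_lin: "h \<in> PV \<Longrightarrow> K h (u + v) = K h u + K h v" "h \<in> PV \<Longrightarrow> K h (scal c u) = scal c (K h u)" "h \<in> PV \<Longrightarrow> K h 0 = 0" "h \<in> PV \<Longrightarrow> K h (u - v) = K h u - K h v"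
  by (auto intro!: op_add_vec op_scal op_zero_vec op_diff_vec A_gen)

lemma PV_closed: "0 \<in> PV" "h \<in> PV \<Longrightarrow> h' \<in> PV \<Longrightarrow> h + h' \<in> PV" "h \<in> PV \<Longrightarrow> - h \<in> PV"
  "scl D (of_int n) (co i) \<in> PV"
  by (fact coweight_lattice_closed[OF datum])+

lemma K_zero: "K 0 v = v"
proof -
  have "gen (Kg 0) - 1 \<in> uq_relators D" unfolding uq_relators_def by (rule UnI1, rule UnI1, rule UnI1, rule UnI1, rule UnI1, rule UnI1, rule singletonI)
  from op_relator_eq[OF this A_gen(3)[OF PV_closed(1)] A_closed(3)] show ?thesis by simp
qed

lemma K_add: assumes "h \<in> PV" "h' \<in> PV" shows "K h (K h' v) = K (h + h') v"
proof -
  have "gen (Kg h) * gen (Kg h') - gen (Kg (h + h')) \<in> uq_relators D"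
    unfolding uq_relators_def
    by (rule UnI1, rule UnI1, rule UnI1, rule UnI1, rule UnI1, rule UnI2, intro CollectI exI conjI) (rule HOL.refl | rule assms)+
  note rel = this
  have hh: "h + h' \<in> PV" by (rule PV_closed(2)[OF assms])
  note h = A_gen(3)[OF assms(1)] A_gen(3)[OF assms(2)]
  have "op (gen (Kg h) * gen (Kg h')) v = K (h + h') v"
    by (rule op_relator_eq[OF rel A_closed(2)[OF h] A_gen(3)[OF hh]])
  then show ?thesis unfolding op_mult[OF h] .
qed

text \<open>The defining relation is evaluated at \<open>K h v\<close>, where \<open>K (- h)\<close>
  cancels.\<close>

lemma K_E: assumes "h \<in> PV" shows "K h (E i v) = scal (qvar powi ipair h (al i)) (E i (K h v))"
proof -
  have "gen (Kg h) * gen (Eg i) * gen (Kg (- h)) - const (qvar powi ipair h (al i)) * gen (Eg i) \<in> uq_relators D"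
    unfolding uq_relators_def
    by (rule UnI1, rule UnI1, rule UnI1, rule UnI1, rule UnI2, intro CollectI exI conjI) (rule HOL.refl | rule assms)+
  from op_relator_eq[OF this, of "K h v"] have "K h (E i (K (- h) (K h v))) = scal (qvar powi ipair h (al i)) (E i (K h v))"
    using assms by (simp add: A_gen PV_closed A_closed A_const op_mult scal_op)
  then show ?thesis using K_add[of "- h" h v] assms PV_closed by (simp add: K_zero)
qed

lemma K_F: assumes "h \<in> PV" shows "K h (F i v) = scal (qvar powi (- ipair h (al i))) (F i (K h v))"
proof -
  have "gen (Kg h) * gen (Fg i) * gen (Kg (- h)) - const (qvar powi (- ipair h (al i))) * gen (Fg i) \<in> uq_relators D"
    unfolding uq_relators_def
    by (rule UnI1, rule UnI1, rule UnI1, rule UnI2, intro CollectI exI conjI) (rule HOL.refl | rule assms)+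
  from op_relator_eq[OF this, of "K h v"] have "K h (F i (K (- h) (K h v))) = scal (qvar powi (- ipair h (al i))) (F i (K h v))"
    using assms by (simp add: A_gen PV_closed A_closed A_const op_mult scal_op)
  then show ?thesis using K_add[of "- h" h v] assms PV_closed by (simp add: K_zero)
qed

abbreviation "kc i \<equiv> scl D (of_int (symd D i)) (co i)"

definition H :: "'i \<Rightarrow> 'v \<Rightarrow> 'v" where
  "H i v = scal (1 / (qi D i - inverse (qi D i))) (K (kc i) v - K (- kc i) v)"

lemma E_F: "E i (F j v) = F j (E i v) + (if i = j then H i v else 0)"
proof -
  define r where "r = (if i = j then const (1 / (qi D i - inverse (qi D i))) * (uq_Ki D i - uq_Ki_inv D i) else 0)"
  have K: "uq_Ki D i \<in> carrier A" "uq_Ki_inv D i \<in> carrier A"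
    unfolding uq_Ki_def uq_Ki_inv_def using PV_closed by (auto intro!: A_gen)
  have r: "r \<in> carrier A" unfolding r_def using K by (auto intro!: A_closed A_const)
  have "gen (Eg i) * gen (Fg j) - gen (Fg j) * gen (Eg i) - r \<in> uq_relators D"
    unfolding uq_relators_def r_def
    by (rule UnI1, rule UnI1, rule UnI2, intro CollectI exI conjI) (rule HOL.refl | rule TrueI)+
  from op_relator_eq[OF this, of v] have "E i (F j v) - F j (E i v) = op r v"
    using r by (simp add: A_gen A_closed op_mult op_diff)
  moreover have "op r v = (if i = j then H i v else 0)"
    using K unfolding r_def H_def scal_op uq_Ki_def uq_Ki_inv_def
    by (cases "i = j") (simp_all add: op_mult op_diff A_closed A_const)
  ultimately show ?thesis by (simp add: algebra_simps)
qed

lemma F_serre: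
  assumes "i \<noteq> j" defines "N \<equiv> nat (1 - cm i j)"
  shows "(\<Sum>s\<le>N. scal ((- 1) ^ s * qbinom (qi D i) N s) ((F i ^^ (N - s)) (F j ((F i ^^ s) v)))) = 0"
proof -
  have "serre D Fg i j \<in> uq_relators D" unfolding uq_relators_def
    by (rule UnI2, intro CollectI exI conjI) (rule HOL.refl | rule assms)+
  from op_relator[OF this, of v] show ?thesis
    unfolding serre_def Let_def N_def[symmetric] scal_op
    by (subst (asm) op_sum) (simp_all add: A_gen A_closed A_const A_power op_mult op_power)
qed

text \<open>The free algebra is spanned by words, so closure under scalars and the generators is
  enough.\<close>

lemma submodule_ofI:
  assumes zero: "0 \<in> N" and add: "\<And>u v. u \<in> N \<Longrightarrow> v \<in> N \<Longrightarrow> u + v \<in> N"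
    and sc: "\<And>c u. u \<in> N \<Longrightarrow> scal c u \<in> N"
    and E: "\<And>i u. u \<in> N \<Longrightarrow> E i u \<in> N" and F: "\<And>i u. u \<in> N \<Longrightarrow> F i u \<in> N"
    and K: "\<And>h u. h \<in> PV \<Longrightarrow> u \<in> N \<Longrightarrow> K h u \<in> N"
  shows "submodule_of (uq D) act N"
proof -
  have word: "op (Poly_Mapping.single (FWord ws) c) u \<in> N \<and> Poly_Mapping.single (FWord ws) c \<in> carrier A"
    if "set ws \<subseteq> uq_gens D" "u \<in> N" for ws c u
    using that
  proof (induction ws)
    case Nil
    have "Poly_Mapping.single (FWord []) c = (const c :: ('i, 'h) uq_gen falg)"
      by (simp add: const_def zero_fword_def)
    then show ?case using sc[OF Nil(2), of c] A_const by (simp add: scal_op)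
  next
    case (Cons g ws)
    have e: "Poly_Mapping.single (FWord (g # ws)) c = gen g * Poly_Mapping.single (FWord ws) c"
      by (simp add: gen_def mult_single plus_fword_def)
    have g: "g \<in> uq_gens D" using Cons.prems by simp
    have gA: "gen g \<in> carrier A" using g by (simp add: free_algebra_def gen_def)
    have "op (gen g) x \<in> N" if "x \<in> N" for x
      using g E F K that by (auto simp: uq_gens_def)
    moreover have "op (Poly_Mapping.single (FWord ws) c) u \<in> N" "Poly_Mapping.single (FWord ws) c \<in> carrier A"
      using Cons.IH Cons.prems by auto
    ultimately show ?case unfolding e using gA by (auto simp only: op_mult A_closed)
  qed
  have closed: "op p u \<in> N" if "p \<in> carrier A" "u \<in> N" for p u
  proof -
    have keys: "set (letters k) \<subseteq> uq_gens D" if "k \<in> Poly_Mapping.keys p" for k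
      using that \<open>p \<in> carrier A\<close> by (simp add: free_algebra_def)
    have w: "op (Poly_Mapping.single k c) u \<in> N \<and> Poly_Mapping.single k c \<in> carrier A"
      if "k \<in> Poly_Mapping.keys p" for k c
      using word[OF keys[OF that] \<open>u \<in> N\<close>, of c] by simp
    have "op p u = (\<Sum>k\<in>Poly_Mapping.keys p. op (Poly_Mapping.single k (Poly_Mapping.lookup p k)) u)"
      by (subst poly_mapping_sum_single[of p], subst op_sum) (use w in auto)
    also have "\<dots> \<in> N"
    proof -
      have "(\<Sum>k\<in>S. op (Poly_Mapping.single k (Poly_Mapping.lookup p k)) u) \<in> N"
        if "S \<subseteq> Poly_Mapping.keys p" for S
        using that by (induction S rule: infinite_finite_induct) (use w zero add in auto)
      then show ?thesis by blast
    qed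
    finally show ?thesis .
  qed
  show ?thesis unfolding submodule_of_def carrier_uq
    using zero add closed by (auto simp: op_def)
qed

end

section \<open>Weight vectors of the simple module\<close>

lemma qvar_nonzero: "qvar \<noteq> 0"
  by (simp add: qvar_def Zero_fract_def eq_fract)

lemma qvar_power_neq_1: "n > 0 \<Longrightarrow> qvar ^ n \<noteq> 1"
proof
  assume n: "n > 0" and "qvar ^ n = 1"
  have "qvar ^ n = Fract ([:0, 1:] ^ n) 1"
    by (induction n) (simp_all add: qvar_def One_fract_def)
  then have "[:0, 1:] ^ n = (1 :: complex poly)"
    using \<open>qvar ^ n = 1\<close> by (simp add: One_fract_def eq_fract)
  then have "degree ([:0, 1:] ^ n :: complex poly) = 0" by simp
  then show False using n by (simp add: degree_power_eq)
qed

text \<open>Since \<open>q\<close> is not a root of unity, an integral weight can be recovered from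
  the scalars by which the torus acts.\<close>

lemma qvar_powi_inj: "qvar powi a = qvar powi b \<longleftrightarrow> a = b"
proof
  have *: "a \<le> b" if "qvar powi a = qvar powi b" for a b
  proof (rule ccontr)
    assume "\<not> a \<le> b"
    then have "qvar powi (a - b) = qvar ^ nat (a - b)" by (simp add: power_int_def)
    moreover have "qvar powi (a - b) = 1"
      using that qvar_nonzero by (simp add: power_int_diff)
    ultimately show False using qvar_power_neq_1[of "nat (a - b)"] \<open>\<not> a \<le> b\<close> by simp
  qed
  assume "qvar powi a = qvar powi b"
  then show "a = b" using *[of a b] *[of b a] by simp
qed simp

lemma ipairI: "\<mu> h = of_int n \<Longrightarrow> ipair h \<mu> = n"
  unfolding ipair_def by (rule the_equality) auto

lemma of_int_ipair: "\<mu> h \<in> \<int> \<Longrightarrow> of_int (ipair h \<mu>) = \<mu> h"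
  by (metis Ints_cases ipairI)

context km_setting
begin

lemma lattice_basis_in: "s \<in> lattice_index D \<Longrightarrow> lattice_basis D s \<in> coweight_lattice D"
proof -
  assume s: "s \<in> lattice_index D"
  interpret vector_space "scl D" by (rule vs_scl)
  have "(\<Sum>t\<in>lattice_index D. scl D (of_int (if t = s then 1 else 0)) (lattice_basis D t))
     = (\<Sum>t\<in>lattice_index D. if t = s then lattice_basis D t else 0)"
    by (intro sum.cong) auto
  also have "\<dots> = lattice_basis D s" using s by (simp add: lattice_index_def)
  finally show ?thesis unfolding coweight_lattice_def
    by (intro CollectI exI[of _ "\<lambda>t. if t = s then 1 else 0"]) auto
qed

text \<open>The lattice contains a complex basis of the Cartan subalgebra.\<close>

lemma dual_eqI:
  assumes "\<mu> \<in> dual_space D" "\<nu> \<in> dual_space D" "\<And>h. h \<in> coweight_lattice D \<Longrightarrow> \<mu> h = \<nu> h"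
  shows "\<mu> = \<nu>"
proof -
  interpret vector_space "scl D" by (rule vs_scl)
  have "\<mu> 0 = \<nu> 0" using assms dual_space_iff by (metis scale_zero_left mult_zero_left)
  then have "subspace {h. \<mu> h = \<nu> h}"
    using assms(1,2) by (auto simp: subspace_def dual_space_iff)
  moreover have "lattice_basis D ` lattice_index D \<subseteq> {h. \<mu> h = \<nu> h}"
    using lattice_basis_in assms(3) by auto
  ultimately have "span (lattice_basis D ` lattice_index D) \<subseteq> {h. \<mu> h = \<nu> h}"
    by (simp add: span_minimal)
  then show ?thesis using datum by (auto simp: symmetrizable_km_datum_def lattice_condition_def)
qed

lemma sroot_integral: assumes "h \<in> coweight_lattice D" shows "al i h \<in> \<int>"
proof -
  interpret vector_space "scl D" by (rule vs_scl)
  obtain c where h: "h = (\<Sum>s\<in>lattice_index D. scl D (of_int (c s)) (lattice_basis D s))"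
    using assms unfolding coweight_lattice_def by blast
  have "al i 0 = 0" using sroot_dual dual_space_iff by (metis scale_zero_left mult_zero_left)
  then have "al i (\<Sum>s\<in>S. x s) = (\<Sum>s\<in>S. al i (x s))" for x :: "'i + nat \<Rightarrow> 'h" and S
    using sroot_dual[of i]
    by (induction S rule: infinite_finite_induct) (simp_all add: dual_space_iff)
  then have "al i h = (\<Sum>s\<in>lattice_index D. of_int (c s) * al i (lattice_basis D s))"
    unfolding h using sroot_dual[of i] by (simp add: dual_space_iff)
  also have "\<dots> \<in> \<int>"
  proof (intro Ints_sum Ints_mult)
    fix s assume "s \<in> lattice_index D"
    then show "al i (lattice_basis D s) \<in> \<int>"
      using datum
      by (auto simp: lattice_index_def lattice_basis_def sroot_coroot symmetrizable_km_datum_def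
          lattice_condition_def)
  qed simp
  finally show ?thesis .
qed

lemma phi_integral: "h \<in> coweight_lattice D \<Longrightarrow> phi c h \<in> \<int>"
  unfolding phi_def by (intro Ints_sum Ints_mult sroot_integral) auto

lemma phi_dual: "phi c \<in> dual_space D"
  using sroot_dual
  by (simp add: dual_space_iff phi_def sum.distrib distrib_left sum_distrib_left mult.left_commute)

lemma weight_lattice_shift: "lam \<in> weight_lattice D \<Longrightarrow> lam - phi c \<in> weight_lattice D"
  using phi_dual[of c] phi_integral[of _ c]
  by (auto simp: weight_lattice_def dual_space_iff algebra_simps)

end

locale km_hw = km_module D act
  for D :: "('i::finite, 'h::ab_group_add) km_datum"
    and act :: "('i, 'h) uq_gen falg set \<Rightarrow> 'v \<Rightarrow> 'v::ab_group_add" +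
  fixes lam :: "'h \<Rightarrow> complex" and v0 :: 'v
  assumes lam: "lam \<in> weight_lattice D"
    and simple: "\<And>N. submodule_of (uq D) act N \<Longrightarrow> N = {0} \<or> N = UNIV"
    and v0_nonzero: "v0 \<noteq> 0"
    and v0_weight: "v0 \<in> weight_space D act (qwt D lam)"
    and v0_E: "E i v0 = 0"
begin

definition chr :: "('i \<Rightarrow> int) \<Rightarrow> 'h \<Rightarrow> cq" where
  "chr c h = qvar powi ipair h (lam - phi c)"

definition wsp :: "('i \<Rightarrow> int) \<Rightarrow> 'v set" where
  "wsp c = {u. \<forall>h\<in>PV. K h u = scal (chr c h) u}"

text \<open>Weights are recorded by their depth below \<open>lam\<close> in simple root coordinates.
  That depths are nonnegative is a theorem, \<open>wts_nonneg\<close>.\<close>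

definition wts :: "('i \<Rightarrow> int) set" where
  "wts = {c. \<exists>u\<in>wsp c. u \<noteq> 0}"

lemma qwt_single: "h \<in> PV \<Longrightarrow> qwt D \<mu> (Poly_Mapping.single h 1) = qvar powi ipair h \<mu>"
  by (simp add: qwt_def torus_algebra_def)

lemma weight_space_qwt:
  "weight_space D act (qwt D \<mu>) = {u. \<forall>h\<in>PV. K h u = scal (qvar powi ipair h \<mu>) u}"
  by (auto simp: weight_space_def qwt_single op_def)

lemma wsp_eq: "wsp c = weight_space D act (qwt D (lam - phi c))"
  by (simp add: wsp_def weight_space_qwt chr_def)

lemma ipair_wt: "h \<in> PV \<Longrightarrow> of_int (ipair h (lam - phi c)) = lam h - phi c h"
  using weight_lattice_shift[OF lam, of c] by (subst of_int_ipair) (auto simp: weight_lattice_def)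

lemma ipair_root: "h \<in> PV \<Longrightarrow> of_int (ipair h (al i)) = al i h"
  by (rule of_int_ipair) (rule sroot_integral)

lemma ipair_shift:
  assumes "h \<in> PV"
  shows "ipair h (lam - phi (c(i := c i - m))) = ipair h (lam - phi c) + m * ipair h (al i)"
  by (rule ipairI)
     (use ipair_wt[OF assms, of c] ipair_root[OF assms, of i] in
      \<open>simp add: upd_unit phi_diff phi_scale phi_unit dual_scale_def\<close>)

lemma F_wsp: "u \<in> wsp c \<Longrightarrow> F i u \<in> wsp (c(i := c i + 1))"
  unfolding wsp_def chr_def
  using ipair_shift[of _ c i "-1"] qvar_nonzero
  by (simp add: K_F F_lin power_int_add[symmetric] mult.commute)

lemma E_wsp: "u \<in> wsp c \<Longrightarrow> E i u \<in> wsp (c(i := c i - 1))"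
  unfolding wsp_def chr_def
  using ipair_shift[of _ c i "1"] qvar_nonzero
  by (simp add: K_E E_lin power_int_add[symmetric] add.commute)

lemma wsp_closed: "0 \<in> wsp c" "u \<in> wsp c \<Longrightarrow> v \<in> wsp c \<Longrightarrow> u + v \<in> wsp c"
  "u \<in> wsp c \<Longrightarrow> scal r u \<in> wsp c" "u \<in> wsp c \<Longrightarrow> v \<in> wsp c \<Longrightarrow> u - v \<in> wsp c"
  by (auto simp: wsp_def K_lin vec.scale_right_distrib vec.scale_right_diff_distrib vec.scale_left_commute)

lemma v0_wsp: "v0 \<in> wsp (\<lambda>_. 0)"
proof -
  have "lam - phi (\<lambda>_. 0) = lam" by (simp add: phi_def fun_eq_iff)
  then show ?thesis using v0_weight unfolding wsp_eq by simp
qed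

text \<open>The usual independence of eigenvectors: applying \<open>K h - \<psi> y h\<close> to the
  relation removes the term at \<open>y\<close>. The index type is arbitrary because a vector of yet
  unknown weight is compared with known ones below.\<close>

lemma weight_indep:
  assumes "finite C" "\<And>x h. x \<in> C \<Longrightarrow> h \<in> PV \<Longrightarrow> K h (u x) = scal (\<psi> x h) (u x)"
    "\<And>x y. x \<in> C \<Longrightarrow> y \<in> C \<Longrightarrow> x \<noteq> y \<Longrightarrow> \<exists>h\<in>PV. \<psi> x h \<noteq> \<psi> y h"
    "(\<Sum>x\<in>C. u x) = 0" "x \<in> C"
  shows "u x = 0"
  using assms
proof (induction C arbitrary: u x rule: finite_induct)
  case (insert y C)
  have Ksum: "K h (\<Sum>x\<in>S. f x) = (\<Sum>x\<in>S. K h (f x))" if "h \<in> PV" for h S and f :: "'x \<Rightarrow> 'v"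
    by (induction S rule: infinite_finite_induct) (simp_all add: K_lin that)
  have C: "u x = 0" if x: "x \<in> C" for x
  proof -
    have "x \<noteq> y" using x insert.hyps by blast
    then obtain h where h: "h \<in> PV" "\<psi> x h \<noteq> \<psi> y h" using insert.prems(2)[of x y] x by blast
    define w where "w z = scal (\<psi> z h - \<psi> y h) (u z)" for z
    have "(\<Sum>z\<in>insert y C. w z) = K h (\<Sum>z\<in>insert y C. u z) - scal (\<psi> y h) (\<Sum>z\<in>insert y C. u z)"
      unfolding Ksum[OF h(1)] vec.scale_sum_right sum_subtractf[symmetric] w_def
      using insert.prems(1) h by (intro sum.cong) (auto simp: vec.scale_left_diff_distrib)
    also have "\<dots> = 0" unfolding insert.prems(3) using K_lin(3)[OF h(1)] by simp
    finally have "(\<Sum>z\<in>C. w z) = 0" using insert.hyps by (simp add: w_def)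
    moreover have "K g (w z) = scal (\<psi> z g) (w z)" if "z \<in> C" "g \<in> PV" for z g
      using insert.prems(1)[of z g] that by (simp add: w_def K_lin vec.scale_left_commute)
    ultimately have "w x = 0" using insert.IH[of w x] insert.prems(2) x by blast
    then show ?thesis using h by (simp add: w_def)
  qed
  moreover have "u y = 0" using insert.prems(3) insert.hyps C by simp
  ultimately show ?case using insert.prems(4) by blast
qed simp

lemma chr_distinct: "c \<noteq> d \<Longrightarrow> \<exists>h\<in>PV. chr c h \<noteq> chr d h"
proof (rule ccontr)
  assume "c \<noteq> d" "\<not> (\<exists>h\<in>PV. chr c h \<noteq> chr d h)"
  then have "ipair h (lam - phi c) = ipair h (lam - phi d)" if "h \<in> PV" for h
    using that by (simp add: chr_def qvar_powi_inj)
  then have "phi c h = phi d h" if "h \<in> PV" for h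
    using ipair_wt[OF that, of c] ipair_wt[OF that, of d] that by simp
  then have "phi c = phi d" by (intro dual_eqI phi_dual)
  then show False using \<open>c \<noteq> d\<close> by (simp add: phi_inj)
qed

definition Fw :: "'i list \<Rightarrow> 'v" where "Fw ws = foldr F ws v0"

lemma Fw_simps: "Fw [] = v0" "Fw (j # ws) = F j (Fw ws)"
  by (simp_all add: Fw_def)

text \<open>The last conjunct leaves \<open>v0\<close> as the only monomial of depth zero, whence
  the highest weight space is a line.\<close>

lemma Fw_wsp: "\<exists>c. nonneg c \<and> Fw ws \<in> wsp c \<and> (ws \<noteq> [] \<longrightarrow> c \<noteq> (\<lambda>_. 0))"
proof (induction ws)
  case Nil
  show ?case using v0_wsp by (intro exI[of _ "\<lambda>_. 0"]) (simp add: Fw_simps nonneg_def)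
next
  case (Cons j ws)
  then obtain c where c: "nonneg c" "Fw ws \<in> wsp c" by blast
  have "(c(j := c j + 1)) j \<noteq> 0" using c(1) by (simp add: nonneg_def add_nonneg_eq_0_iff)
  then have "c(j := c j + 1) \<noteq> (\<lambda>_. 0)" by metis
  moreover have "nonneg (c(j := c j + 1))" using c(1) by (auto simp: nonneg_def)
  moreover have "Fw (j # ws) \<in> wsp (c(j := c j + 1))"
    unfolding Fw_simps by (rule F_wsp[OF c(2)])
  ultimately show ?case by blast
qed

lemma H_wsp: "u \<in> wsp c \<Longrightarrow> \<exists>r. H i u = scal r u"
  unfolding H_def wsp_def using PV_closed
  by (auto simp: vec.scale_left_diff_distrib[symmetric])

text \<open>The span is stable under \<open>E\<close> by commuting \<open>E\<close> to the right
  until it kills \<open>v0\<close>, so it is a nonzero submodule and simplicity makes it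
  everything.\<close>

lemma span_Fw: "vec.span (range Fw) = UNIV"
proof -
  let ?N = "vec.span (range Fw)"
  have lin: "T u \<in> ?N" if T: "\<And>x y. T (x + y) = T x + T y" "\<And>c x. T (scal c x) = scal c (T x)"
    and base: "\<And>ws. T (Fw ws) \<in> ?N" and u: "u \<in> ?N" for T u
  proof -
    have T0: "T 0 = 0" using T(1)[of 0 0] by simp
    have "vec.subspace {u. T u \<in> ?N}"
      unfolding vec.subspace_def using T T0 by (auto intro: vec.span_add vec.span_scale vec.span_zero)
    then show ?thesis using vec.span_minimal[of "range Fw" "{u. T u \<in> ?N}"] base u by blast
  qed
  have F: "F i u \<in> ?N" if "u \<in> ?N" for i u
  proof (rule lin[OF _ _ _ that])
    show "F i (Fw ws) \<in> ?N" for ws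
      using vec.span_base[of "Fw (i # ws)" "range Fw"] unfolding Fw_simps by (metis Fw_simps(2) rangeI)
  qed (rule F_lin)+
  have E: "E i u \<in> ?N" if "u \<in> ?N" for i u
  proof (rule lin[OF _ _ _ that])
    show "E i (Fw ws) \<in> ?N" for ws
    proof (induction ws)
      case Nil
      then show ?case by (simp add: Fw_simps v0_E vec.span_zero)
    next
      case (Cons j ws)
      obtain c where "Fw ws \<in> wsp c" using Fw_wsp by blast
      then obtain r where "H i (Fw ws) = scal r (Fw ws)" using H_wsp by blast
      then have "(if i = j then H i (Fw ws) else 0) \<in> ?N"
        using vec.span_scale[OF vec.span_base[OF rangeI[of Fw ws]], of r] vec.span_zero by auto
      then show ?case unfolding Fw_simps E_F using F[OF Cons] by (rule vec.span_add[rotated])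
    qed
  qed (rule E_lin)+
  have K: "K h u \<in> ?N" if h: "h \<in> PV" and u: "u \<in> ?N" for h u
  proof (rule lin[OF _ _ _ u])
    show "K h (Fw ws) \<in> ?N" for ws
    proof -
      obtain c where "Fw ws \<in> wsp c" using Fw_wsp by blast
      then have "K h (Fw ws) = scal (chr c h) (Fw ws)" using h by (simp add: wsp_def)
      then show ?thesis using vec.span_scale[OF vec.span_base[OF rangeI[of Fw ws]]] by simp
    qed
  qed (use h in \<open>simp_all add: K_lin\<close>)
  have "submodule_of (uq D) act ?N"
    by (rule submodule_ofI) (auto intro: vec.span_zero vec.span_add vec.span_scale E F K)
  moreover have "v0 \<in> ?N" using vec.span_base[OF rangeI[of Fw "[]"]] by (simp add: Fw_simps)
  ultimately show ?thesis using simple v0_nonzero by blast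
qed

text \<open>The decomposition into weight components. The family \<open>f\<close> is total and zero
  outside \<open>C\<close>, so that two decompositions can be added over the union of their index
  sets.\<close>

lemma graded:
  "\<exists>C f. finite C \<and> (\<forall>c\<in>C. nonneg c) \<and> (\<forall>c. f c \<in> wsp c) \<and> (\<exists>r. f (\<lambda>_. 0) = scal r v0) \<and>
     (\<forall>c. c \<notin> C \<longrightarrow> f c = 0) \<and> u = (\<Sum>c\<in>C. f c)" (is "?P u")
proof -
  have "vec.subspace {u. ?P u}"
    unfolding vec.subspace_def
  proof (intro conjI ballI allI)
    show "0 \<in> {u. ?P u}"
      by (intro CollectI exI[of _ "{}"] exI[of _ "\<lambda>_. 0"])
         (use wsp_closed in \<open>auto intro!: exI[of _ 0]\<close>)
    fix x assume x: "x \<in> {u. ?P u}"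
    then obtain C f where Cf: "finite C" "\<forall>c\<in>C. nonneg c" "\<forall>c. f c \<in> wsp c"
      "\<exists>r. f (\<lambda>_. 0) = scal r v0" "\<forall>c. c \<notin> C \<longrightarrow> f c = 0" "x = (\<Sum>c\<in>C. f c)" by blast
    show "scal k x \<in> {u. ?P u}" for k
      using Cf by (intro CollectI exI[of _ C] exI[of _ "\<lambda>c. scal k (f c)"])
         (auto simp: vec.scale_sum_right wsp_closed intro: exI[of _ "k * _"])
    fix y assume "y \<in> {u. ?P u}"
    then obtain C' f' where Cf': "finite C'" "\<forall>c\<in>C'. nonneg c" "\<forall>c. f' c \<in> wsp c"
      "\<exists>r. f' (\<lambda>_. 0) = scal r v0" "\<forall>c. c \<notin> C' \<longrightarrow> f' c = 0" "y = (\<Sum>c\<in>C'. f' c)" by blast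
    have "(\<Sum>c\<in>C \<union> C'. f c) = x" "(\<Sum>c\<in>C \<union> C'. f' c) = y"
      unfolding Cf(6) Cf'(6) using Cf Cf' by (auto intro!: sum.mono_neutral_right)
    then have "x + y = (\<Sum>c\<in>C \<union> C'. f c + f' c)" by (simp add: sum.distrib)
    moreover have "\<exists>r. f (\<lambda>_. 0) + f' (\<lambda>_. 0) = scal r v0"
      using Cf(4) Cf'(4) by (metis vec.scale_left_distrib)
    ultimately show "x + y \<in> {u. ?P u}"
      using Cf Cf' wsp_closed(2)
      by (intro CollectI exI[of _ "C \<union> C'"] exI[of _ "\<lambda>c. f c + f' c"]) auto
  qed
  moreover have "range Fw \<subseteq> {u. ?P u}"
  proof clarify
    fix ws
    obtain c where c: "nonneg c" "Fw ws \<in> wsp c" "ws \<noteq> [] \<longrightarrow> c \<noteq> (\<lambda>_. 0)" using Fw_wsp by blast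
    have "\<exists>r. (if (\<lambda>_. 0) = c then Fw ws else 0) = scal r v0"
    proof (cases "ws = []")
      case True
      then have "Fw ws = scal 1 v0" by (simp add: Fw_simps)
      then show ?thesis using vec.scale_zero_left[of v0] by metis
    next
      case False
      then show ?thesis using c(3) vec.scale_zero_left[of v0] by metis
    qed
    then show "?P (Fw ws)" using c wsp_closed(1)
      by (intro exI[of _ "{c}"] exI[of _ "\<lambda>d. if d = c then Fw ws else 0"]) auto
  qed
  ultimately have "vec.span (range Fw) \<subseteq> {u. ?P u}" by (rule vec.span_minimal[rotated])
  then show ?thesis using span_Fw by blast
qed

text \<open>Otherwise \<open>u\<close> and its weight components would belong to pairwise distinct
  characters, against independence. As \<open>m\<close> is an arbitrary function, this also covers
  weights not known to be integral.\<close>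

lemma weight_vector_char:
  assumes "u \<noteq> 0" "\<And>h. h \<in> PV \<Longrightarrow> K h u = scal (m h) u"
  shows "\<exists>c. nonneg c \<and> (\<forall>h\<in>PV. m h = chr c h)"
proof (rule ccontr)
  assume no: "\<not> ?thesis"
  obtain C f where Cf: "finite C" "\<forall>c\<in>C. nonneg c" "\<forall>c. f c \<in> wsp c" "u = (\<Sum>c\<in>C. f c)"
    using graded[of u] by blast
  \<comment> \<open>The index \<open>None\<close> carries \<open>- u\<close>, so that the whole
    family sums to zero.\<close>
  define g where "g = case_option (- u) f"
  define \<psi> where "\<psi> = case_option m chr"
  have sep: "\<exists>h\<in>PV. m h \<noteq> chr c h" if "c \<in> C" for c using no Cf(2) that by blast
  have "g None = 0"
  proof (rule weight_indep[where C = "insert None (Some ` C)" and \<psi> = \<psi>])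
    show "K h (g x) = scal (\<psi> x h) (g x)" if "h \<in> PV" for x h
    proof (cases x)
      case None
      have "K h (0 - u) = 0 - scal (m h) u" unfolding K_lin(3,4)[OF that] assms(2)[OF that] ..
      then show ?thesis using None by (simp add: g_def \<psi>_def)
    next
      case (Some c)
      have "f c \<in> wsp c" using Cf(3) by blast
      then show ?thesis using that Some by (simp add: g_def \<psi>_def wsp_def)
    qed
    show "(\<Sum>x\<in>insert None (Some ` C). g x) = 0"
      using Cf(1,4) by (simp add: sum.reindex g_def)
    show "\<exists>h\<in>PV. \<psi> x h \<noteq> \<psi> y h"
      if xy: "x \<in> insert None (Some ` C)" "y \<in> insert None (Some ` C)" "x \<noteq> y" for x y
    proof (cases x)
      case None
      then obtain d where "y = Some d" "d \<in> C" using xy by auto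
      then show ?thesis using None sep[of d] unfolding \<psi>_def by (metis option.case)
    next
      case (Some c)
      then have "c \<in> C" using that by auto
      show ?thesis
      proof (cases y)
        case None
        then show ?thesis using Some sep[OF \<open>c \<in> C\<close>] unfolding \<psi>_def by (metis option.case)
      next
        case (Some d)
        then have "c \<noteq> d" using \<open>x = Some c\<close> that(3) by blast
        from chr_distinct[OF this] show ?thesis
          unfolding \<psi>_def \<open>x = Some c\<close> \<open>y = Some d\<close> option.case .
      qed
    qed
  qed (use Cf in auto)
  then show False using assms(1) by (simp add: g_def)
qed

lemma wsp_zero: assumes "u \<in> wsp (\<lambda>_. 0)" shows "\<exists>r. u = scal r v0"
proof -
  obtain C f where Cf: "finite C" "\<forall>c. f c \<in> wsp c" "\<exists>r. f (\<lambda>_. 0) = scal r v0"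
    "\<forall>c. c \<notin> C \<longrightarrow> f c = 0" "u = (\<Sum>c\<in>C. f c)"
    using graded[of u] by blast
  \<comment> \<open>Subtracting \<open>u\<close> from its own component of depth zero gives a family
    of weight vectors with sum zero.\<close>
  define g where "g c = f c - (if c = (\<lambda>_. 0) then u else 0)" for c
  have "g (\<lambda>_. 0) = 0"
  proof (rule weight_indep[where C = "insert (\<lambda>_. 0) C" and \<psi> = chr])
    have "g c \<in> wsp c" for c unfolding g_def using Cf(2) assms wsp_closed by auto
    then show "K h (g x) = scal (chr x h) (g x)" if "h \<in> PV" for x h
      using that by (simp add: wsp_def)
    have "(\<Sum>x\<in>insert (\<lambda>_. 0) C. f x) = u"
      unfolding Cf(5) using Cf(1,4) by (auto intro!: sum.mono_neutral_right)
    then show "(\<Sum>x\<in>insert (\<lambda>_. 0) C. g x) = 0"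
      unfolding g_def sum_subtractf using Cf(1) by simp
  qed (use Cf chr_distinct in auto)
  then show ?thesis using Cf(3) by (simp add: g_def)
qed

lemma wts_nonneg: assumes "c \<in> wts" shows "nonneg c"
proof -
  obtain u where u: "u \<in> wsp c" "u \<noteq> 0" using assms by (auto simp: wts_def)
  obtain d where "nonneg d" "\<forall>h\<in>PV. chr c h = chr d h"
    using weight_vector_char[OF u(2), of "chr c"] u(1) by (auto simp: wsp_def)
  then show ?thesis using chr_distinct by metis
qed

end

section \<open>Rank one strings and torsion\<close>

text \<open>With the denominators cleared, this says that the q-integers \<open>[m - 2j]\<close> for
  \<open>j \<le> k\<close> add up to the product of \<open>[k + 1]\<close> and
  \<open>[m - k]\<close>. The sum is the scalar by which \<open>e\<close> leads back one step in a
  string.\<close>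

lemma qint_sum:
  fixes Q :: "'a::field"
  assumes "Q \<noteq> 0"
  shows "(Q - inverse Q) * (\<Sum>j\<le>k. Q powi (m - 2 * int j) - Q powi (- (m - 2 * int j)))
    = (Q powi (int k + 1) - Q powi (- (int k + 1))) * (Q powi (m - int k) - Q powi (- (m - int k)))"
proof (induction k)
  case 0
  show ?case by (simp add: power_int_minus)
next
  case (Suc k)
  have mult: "Q powi a * Q powi b = Q powi (a + b)" for a b using assms by (simp add: power_int_add)
  have Q: "Q * Q powi a = Q powi (a + 1)" "inverse Q * Q powi a = Q powi (a - 1)" for a
    using mult[of 1 a] mult[of "- 1" a] by (simp_all add: power_int_minus add.commute)
  have e1: "(Q - inverse Q) * (Q powi (m - 2 * int (Suc k)) - Q powi (- (m - 2 * int (Suc k))))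
    = Q powi (m - 2 * int k - 1) - Q powi (- m + 2 * int k + 3) - Q powi (m - 2 * int k - 3) + Q powi (- m + 2 * int k + 1)"
    by (simp add: algebra_simps Q)
  have e2: "(Q powi (int k + 1) - Q powi (- (int k + 1))) * (Q powi (m - int k) - Q powi (- (m - int k)))
    = Q powi (m + 1) - Q powi (- m + 2 * int k + 1) - Q powi (m - 2 * int k - 1) + Q powi (- 1 - m)"
    by (simp add: algebra_simps mult)
  have e3: "(Q powi (int (Suc k) + 1) - Q powi (- (int (Suc k) + 1))) * (Q powi (m - int (Suc k)) - Q powi (- (m - int (Suc k))))
    = Q powi (m + 1) - Q powi (- m + 2 * int k + 3) - Q powi (m - 2 * int k - 3) + Q powi (- 1 - m)"
    by (simp add: algebra_simps mult)
  show ?case unfolding sum.atMost_Suc distrib_left Suc e1 e2 e3 by simp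
qed

context km_hw
begin

definition ell :: "'i \<Rightarrow> int" where "ell i = ipair (co i) lam"

text \<open>The value of the weight \<open>lam - phi c\<close> on the coroot \<open>i\<close>; see
  \<open>wt_co\<close>.\<close>

definition mval :: "'i \<Rightarrow> ('i \<Rightarrow> int) \<Rightarrow> int" where
  "mval i c = ell i - cpair i c"

definition qnum :: "'i \<Rightarrow> int \<Rightarrow> cq" where
  "qnum i m = (qi D i powi m - qi D i powi (- m)) / (qi D i - inverse (qi D i))"

lemma co_PV: "co i \<in> PV"
proof -
  interpret h: vector_space "scl D" by (rule vs_scl)
  show ?thesis using PV_closed(4)[of 1 i] by simp
qed

lemma lam_co: "lam (co i) = of_int (ell i)"
  unfolding ell_def using lam co_PV[of i] by (subst of_int_ipair) (auto simp: weight_lattice_def)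

lemma wt_co: "(lam - phi c) (co i) = of_int (mval i c)"
  by (simp add: lam_co phi_coroot mval_def)

lemma refl_wt: "refl i (lam - phi c) = lam - phi (c(i := c i + mval i c))"
proof -
  have "c(i := c i + mval i c) = (\<lambda>k. c k - (- mval i c) * unit_vec i k)"
    by (auto simp: unit_vec_def)
  then have "phi (c(i := c i + mval i c)) = phi c - dual_scale (of_int (- mval i c)) (al i)"
    by (simp only: phi_diff phi_scale phi_unit)
  then show ?thesis unfolding refl_def wt_co
    by (simp add: dual_scale_def fun_eq_iff)
qed

lemma mval_upd: "mval i (c(i := c i + m)) = mval i c - 2 * m"
proof -
  have "(\<Sum>k\<in>UNIV. cm i k * (c(i := c i + m)) k) = (\<Sum>k\<in>UNIV. cm i k * c k + (if k = i then cm i k * m else 0))"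
    by (intro sum.cong) (auto simp: algebra_simps)
  then show ?thesis by (simp add: mval_def cpair_def sum.distrib cartan_props)
qed

lemma qi_facts: "qi D i \<noteq> 0" "qi D i powi m = qi D i powi n \<longleftrightarrow> m = n" "qi D i - inverse (qi D i) \<noteq> 0"
proof -
  have d: "symd D i > 0" by (rule cartan_props)
  show 1: "qi D i \<noteq> 0" using qvar_nonzero by (simp add: qi_def)
  have e: "qi D i powi m = qvar powi (symd D i * m)" for m
    unfolding qi_def by (simp add: power_int_mult)
  show 2: "qi D i powi m = qi D i powi n \<longleftrightarrow> m = n" for m n
    unfolding e qvar_powi_inj using d by simp
  have "inverse (qi D i) = qi D i powi (- 1)" by (simp add: power_int_minus)
  then show "qi D i - inverse (qi D i) \<noteq> 0" using 2[of 1 "- 1"] by simp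
qed

lemma H_wt: assumes "u \<in> wsp c" shows "H i u = scal (qnum i (mval i c)) u"
proof -
  have wd: "lam - phi c \<in> dual_space D"
    using weight_lattice_shift[OF lam] by (simp add: weight_lattice_def)
  interpret h: vector_space "scl D" by (rule vs_scl)
  have sc: "(lam - phi c) (scl D x h) = x * (lam - phi c) h" for x h
    using wd unfolding dual_space_iff by blast
  have kv: "(lam - phi c) (kc i) = of_int (symd D i * mval i c)"
    unfolding sc wt_co by simp
  have "- kc i = scl D (- of_int (symd D i)) (co i)" by simp
  then have kv': "(lam - phi c) (- kc i) = of_int (symd D i * - mval i c)"
    using sc[of "- of_int (symd D i)" "co i"] unfolding wt_co by simp
  have "chr c (kc i) = qi D i powi mval i c" "chr c (- kc i) = qi D i powi (- mval i c)"
    unfolding chr_def ipairI[where \<mu> = "lam - phi c" and h = "kc i", OF kv] ipairI[where \<mu> = "lam - phi c" and h = "- kc i", OF kv'] qi_def power_int_mult by simp_all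
  moreover have "kc i \<in> PV" "- kc i \<in> PV" using PV_closed by auto
  ultimately have "K (kc i) u - K (- kc i) u = scal (qi D i powi mval i c - qi D i powi (- mval i c)) u"
    using assms by (simp add: wsp_def vec.scale_left_diff_distrib)
  then show ?thesis by (simp add: H_def qnum_def)
qed

lemma qnum_sum_nonzero:
  assumes "int k < m" shows "(\<Sum>j\<le>k. qnum i (m - 2 * int j)) \<noteq> 0"
proof
  assume "(\<Sum>j\<le>k. qnum i (m - 2 * int j)) = 0"
  then have "(\<Sum>j\<le>k. qi D i powi (m - 2 * int j) - qi D i powi (- (m - 2 * int j))) = 0"
    using qi_facts(3)[of i] unfolding qnum_def sum_divide_distrib[symmetric] by simp
  then have "qi D i powi (int k + 1) = qi D i powi (- (int k + 1)) \<or> qi D i powi (m - int k) = qi D i powi (- (m - int k))"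
    using qint_sum[OF qi_facts(1)[of i], where k = k and m = m] by simp
  then show False unfolding qi_facts(2) using assms by auto
qed

text \<open>Applying \<open>e\<close> to the vector number \<open>k + 1\<close> gives a nonzero
  multiple of vector number \<open>k\<close> as long as \<open>k < m\<close>. The operators are
  abstract because the statement is used with the roles of \<open>E\<close> and \<open>F\<close>
  exchanged as well.\<close>

lemma string_nonzero:
  assumes lin: "\<And>r x. f (scal r x) = scal r (f x)" "\<And>r x. e (scal r x) = scal r (e x)" "e 0 = 0" "f 0 = 0"
    and x: "x \<noteq> 0" "e x = 0"
    and comm: "\<And>k. e (f ((f ^^ k) x)) = f (e ((f ^^ k) x)) + scal (qnum i (m - 2 * int k)) ((f ^^ k) x)"
  shows "int k \<le> m \<Longrightarrow> (f ^^ k) x \<noteq> 0"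
proof (induction k)
  case 0
  then show ?case using x by simp
next
  case (Suc k)
  have "e ((f ^^ Suc k) x) = scal (\<Sum>j\<le>k. qnum i (m - 2 * int j)) ((f ^^ k) x)"
  proof (induction k)
    case 0
    show ?case using comm[of 0] x lin by simp
  next
    case (Suc k)
    have "e ((f ^^ Suc (Suc k)) x) = f (e ((f ^^ Suc k) x)) + scal (qnum i (m - 2 * int (Suc k))) ((f ^^ Suc k) x)"
      using comm[of "Suc k"] by simp
    also have "\<dots> = scal (\<Sum>j\<le>Suc k. qnum i (m - 2 * int j)) ((f ^^ Suc k) x)"
      unfolding Suc by (simp add: lin vec.scale_left_distrib)
    finally show ?case .
  qed
  moreover have "(\<Sum>j\<le>k. qnum i (m - 2 * int j)) \<noteq> 0" using qnum_sum_nonzero Suc.prems by simp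
  moreover have "(f ^^ k) x \<noteq> 0" using Suc by simp
  ultimately show ?case using lin(3) by force
qed

lemma F_pow_wsp: "u \<in> wsp c \<Longrightarrow> (F i ^^ k) u \<in> wsp (c(i := c i + int k))"
proof (induction k)
  case (Suc k)
  have e: "(c(i := c i + int k))(i := (c(i := c i + int k)) i + 1) = c(i := c i + int (Suc k))"
    by (auto simp: fun_eq_iff)
  from F_wsp[OF Suc.IH[OF Suc.prems], of i] show ?case unfolding e by (simp only: funpow.simps comp_apply)
qed simp

lemma E_pow_wsp: "u \<in> wsp c \<Longrightarrow> (E i ^^ k) u \<in> wsp (c(i := c i - int k))"
proof (induction k)
  case (Suc k)
  have e: "(c(i := c i - int k))(i := (c(i := c i - int k)) i - 1) = c(i := c i - int (Suc k))"
    by (auto simp: fun_eq_iff)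
  from E_wsp[OF Suc.IH[OF Suc.prems], of i] show ?case unfolding e by (simp only: funpow.simps comp_apply)
qed simp

lemma F_string:
  assumes "x \<in> wsp c" "x \<noteq> 0" "E i x = 0" "int k \<le> mval i c"
  shows "(F i ^^ k) x \<noteq> 0"
proof (rule string_nonzero[where e = "E i" and i = i and m = "mval i c", OF _ _ _ _ assms(2,3) _ assms(4)])
  show "E i (F i ((F i ^^ k) x)) = F i (E i ((F i ^^ k) x)) + scal (qnum i (mval i c - 2 * int k)) ((F i ^^ k) x)" for k
    using H_wt[OF F_pow_wsp[OF assms(1), of k i], of i] unfolding mval_upd by (simp add: E_F)
qed (simp_all add: E_lin F_lin)

lemma E_string:
  assumes "x \<in> wsp c" "x \<noteq> 0" "F i x = 0" "int k \<le> - mval i c"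
  shows "(E i ^^ k) x \<noteq> 0"
proof (rule string_nonzero[where e = "F i" and i = i and m = "- mval i c", OF _ _ _ _ assms(2,3) _ assms(4)])
  show "F i (E i ((E i ^^ k) x)) = E i (F i ((E i ^^ k) x)) + scal (qnum i (- mval i c - 2 * int k)) ((E i ^^ k) x)" for k
  proof -
    have m: "mval i (c(i := c i - int k)) = mval i c + 2 * int k"
      using mval_upd[of i c "- int k"] by simp
    have "qnum i (- mval i c - 2 * int k) = - qnum i (mval i c + 2 * int k)"
      unfolding qnum_def minus_divide_left by (simp add: add.commute)
    then show ?thesis
      using H_wt[OF E_pow_wsp[OF assms(1), of k i], of i] unfolding m by (simp add: E_F vec.scale_minus_left)
  qed
qed (simp_all add: E_lin F_lin)

lemma wtsI: "u \<in> wsp c \<Longrightarrow> u \<noteq> 0 \<Longrightarrow> c \<in> wts"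
  by (auto simp: wts_def)

lemma last_nonzero:
  assumes "u \<noteq> 0" "(f ^^ n) u = 0" obtains p where "(f ^^ p) u \<noteq> 0" "f ((f ^^ p) u) = 0"
proof -
  have "\<exists>p. (f ^^ p) u \<noteq> 0 \<and> (f ^^ Suc p) u = 0"
  proof (rule ccontr)
    assume no: "\<not> ?thesis"
    have "(f ^^ p) u \<noteq> 0" for p
      by (induction p) (use assms no in auto)
    then show False using assms by blast
  qed
  then show thesis using that by auto
qed

lemma E_nilpotent:
  assumes "u \<in> wsp c" shows "\<exists>n. (E i ^^ n) u = 0"
proof (rule ccontr)
  assume "\<not> ?thesis"
  \<comment> \<open>One step more than \<open>c i\<close> would make the depth at \<open>i\<close>
    negative.\<close>
  then have "(c(i := c i - int (nat (c i + 1)))) \<in> wts"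
    using E_pow_wsp[OF assms] wtsI by blast
  from wts_nonneg[OF this] have "0 \<le> (c(i := c i - int (nat (c i + 1)))) i"
    unfolding nonneg_def by blast
  then have "0 \<le> c i - int (nat (c i + 1))" by (simp only: fun_upd_same)
  then show False by linarith
qed

text \<open>Go up to the top of the string through a weight vector and down again.\<close>

lemma wts_down:
  assumes c: "c \<in> wts" and k: "int k \<le> mval i c"
  shows "c(i := c i + int k) \<in> wts"
proof -
  obtain u where u: "u \<in> wsp c" "u \<noteq> 0" using c by (auto simp: wts_def)
  obtain p where p: "(E i ^^ p) u \<noteq> 0" "E i ((E i ^^ p) u) = 0"
    using last_nonzero[OF u(2)] E_nilpotent[OF u(1)] by metis
  have x: "(E i ^^ p) u \<in> wsp (c(i := c i - int p))" by (rule E_pow_wsp[OF u(1)])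
  have "mval i (c(i := c i - int p)) = mval i c + 2 * int p"
    using mval_upd[of i c "- int p"] by simp
  then have "(F i ^^ (k + p)) ((E i ^^ p) u) \<noteq> 0"
    using F_string[OF x p, of "k + p"] k by simp
  moreover have "(F i ^^ (k + p)) ((E i ^^ p) u) \<in> wsp (c(i := c i + int k))"
    using F_pow_wsp[OF x, of "k + p" i] by simp
  ultimately show ?thesis using wtsI by blast
qed

text \<open>The mirror image of \<open>wts_down\<close>. Nilpotency of \<open>F i\<close> has to be
  assumed, since no bound on depths stops a string from going down forever.\<close>

lemma wts_up:
  assumes c: "c \<in> wts" and k: "int k \<le> - mval i c" and nil: "\<And>u. \<exists>n. (F i ^^ n) u = 0"
  shows "c(i := c i - int k) \<in> wts"
proof -
  obtain u where u: "u \<in> wsp c" "u \<noteq> 0" using c by (auto simp: wts_def)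
  obtain p where p: "(F i ^^ p) u \<noteq> 0" "F i ((F i ^^ p) u) = 0"
    using last_nonzero[OF u(2)] nil[of u] by metis
  have x: "(F i ^^ p) u \<in> wsp (c(i := c i + int p))" by (rule F_pow_wsp[OF u(1)])
  have "mval i (c(i := c i + int p)) = mval i c - 2 * int p" by (rule mval_upd)
  then have "(E i ^^ (k + p)) ((F i ^^ p) u) \<noteq> 0"
    using E_string[OF x p, of "k + p"] k by simp
  moreover have "(E i ^^ (k + p)) ((F i ^^ p) u) \<in> wsp (c(i := c i - int k))"
    using E_pow_wsp[OF x, of "k + p" i] by simp
  ultimately show ?thesis using wtsI by blast
qed

lemma wts_refl:
  assumes "c \<in> wts" "\<And>u. \<exists>n. (F i ^^ n) u = 0"
  shows "c(i := c i + mval i c) \<in> wts"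
proof (cases "mval i c \<ge> 0")
  case True
  then show ?thesis using wts_down[OF assms(1), of "nat (mval i c)" i] by simp
next
  case False
  then show ?thesis using wts_up[OF assms(1) _ assms(2), of "nat (- mval i c)"] by simp
qed

text \<open>The \<open>f\<^sub>i\<close>-torsion vectors. The lemmas below show that they form a
  submodule, which by simplicity is zero or everything.\<close>

definition tors :: "'i \<Rightarrow> 'v set" where
  "tors i = {u. \<exists>n. (F i ^^ n) u = 0}"

lemma F_pow_lin: "(F i ^^ n) (u + v) = (F i ^^ n) u + (F i ^^ n) v" "(F i ^^ n) (scal r u) = scal r ((F i ^^ n) u)"
  "(F i ^^ n) 0 = 0"
  by (induction n) (simp_all add: F_lin)

lemma F_pow_more: "(F i ^^ n) u = 0 \<Longrightarrow> n \<le> m \<Longrightarrow> (F i ^^ m) u = 0"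
  using F_pow_lin(3)[of "m - n" i] funpow_add[of "m - n" n "F i"] by (metis comp_apply le_add_diff_inverse2)

lemma tors_add: "u \<in> tors i \<Longrightarrow> v \<in> tors i \<Longrightarrow> u + v \<in> tors i"
proof -
  assume "u \<in> tors i" "v \<in> tors i"
  then obtain n m where "(F i ^^ n) u = 0" "(F i ^^ m) v = 0" by (auto simp: tors_def)
  then have "(F i ^^ max n m) u = 0" "(F i ^^ max n m) v = 0" using F_pow_more by (meson max.cobounded1 max.cobounded2)+
  then show ?thesis unfolding tors_def by (intro CollectI exI[of _ "max n m"]) (simp add: F_pow_lin)
qed

lemma tors_scal: "u \<in> tors i \<Longrightarrow> scal r u \<in> tors i"
  by (auto simp: tors_def F_pow_lin)

lemma tors_zero: "0 \<in> tors i"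
  using F_pow_lin(3) by (auto simp: tors_def)

lemma tors_sum: "(\<And>s. s \<in> S \<Longrightarrow> f s \<in> tors i) \<Longrightarrow> (\<Sum>s\<in>S. f s) \<in> tors i"
  by (induction S rule: infinite_finite_induct) (auto simp: tors_zero tors_add)

lemma tors_F_pow_iff: "(F i ^^ n) u \<in> tors i \<longleftrightarrow> u \<in> tors i"
proof
  assume "(F i ^^ n) u \<in> tors i"
  then obtain m where "(F i ^^ m) ((F i ^^ n) u) = 0" by (auto simp: tors_def)
  then have "(F i ^^ (m + n)) u = 0" by (simp add: funpow_add)
  then show "u \<in> tors i" by (auto simp: tors_def)
next
  assume "u \<in> tors i"
  then obtain m where "(F i ^^ m) u = 0" by (auto simp: tors_def)
  then have "(F i ^^ (m + n)) u = 0" by (rule F_pow_more) simp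
  then show "(F i ^^ n) u \<in> tors i" unfolding tors_def by (intro CollectI exI[of _ m]) (simp add: funpow_add)
qed

lemma F_pow_K: assumes "h \<in> PV" "(F i ^^ n) u = 0" shows "(F i ^^ n) (K h u) = 0"
proof -
  have "\<exists>r. r \<noteq> 0 \<and> K h ((F i ^^ n) u) = scal r ((F i ^^ n) (K h u))"
  proof (induction n)
    case 0
    show ?case by (intro exI[of _ 1]) simp
  next
    case (Suc n)
    then obtain r where "r \<noteq> 0" "K h ((F i ^^ n) u) = scal r ((F i ^^ n) (K h u))" by blast
    then show ?case using K_F[OF assms(1), of i "(F i ^^ n) u"] qvar_nonzero
      by (intro exI[of _ "qvar powi (- ipair h (al i)) * r"]) (simp add: F_lin)
  qed
  then show ?thesis using assms K_lin(3)[OF assms(1)] by auto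
qed

lemma tors_K: "h \<in> PV \<Longrightarrow> u \<in> tors i \<Longrightarrow> K h u \<in> tors i"
  unfolding tors_def using F_pow_K by blast

lemma F_pow_H: assumes "(F i ^^ n) u = 0" shows "(F i ^^ n) (H i u) = 0"
proof -
  have "kc i \<in> PV" "- kc i \<in> PV" using PV_closed by auto
  then have "(F i ^^ n) (K (kc i) u) = 0" "(F i ^^ n) (K (- kc i) u) = 0"
    using F_pow_K assms by auto
  moreover have "K (kc i) u - K (- kc i) u = K (kc i) u + scal (- 1) (K (- kc i) u)"
    by (simp add: vec.scale_minus_left)
  ultimately show ?thesis unfolding H_def by (simp only: F_pow_lin vec.scale_zero_right add_0_right)
qed

text \<open>Moving \<open>E i\<close> past the powers of \<open>F i\<close> costs one extra power,
  because \<open>F i (E i u)\<close> differs from \<open>E i (F i u)\<close> by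
  \<open>H i u\<close>, which is killed by the same power as \<open>u\<close>.\<close>

lemma F_pow_E: "(F i ^^ n) u = 0 \<Longrightarrow> (F i ^^ Suc n) (E i u) = 0"
proof (induction n arbitrary: u)
  case 0
  then show ?case by (simp add: E_lin F_lin)
next
  case (Suc n)
  have "(F i ^^ n) (F i u) = 0" using Suc.prems by (simp only: funpow_Suc_right comp_apply)
  from Suc.IH[OF this] have 1: "(F i ^^ Suc n) (E i (F i u)) = 0" .
  have "F i (E i u) = E i (F i u) + scal (- 1) (H i u)"
    using E_F[of i i u] by (simp add: vec.scale_minus_left)
  then have "(F i ^^ Suc n) (F i (E i u)) = 0"
    using 1 F_pow_H[OF Suc.prems] by (simp only: F_pow_lin vec.scale_zero_right add_0_right)
  then show ?case by (simp only: funpow_Suc_right[of "Suc n"] comp_apply)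
qed

lemma F_pow_E_other: "i \<noteq> j \<Longrightarrow> (F i ^^ n) (E j u) = E j ((F i ^^ n) u)"
  by (induction n) (simp_all add: E_F)

lemma tors_E: "u \<in> tors i \<Longrightarrow> E j u \<in> tors i"
proof (cases "i = j")
  case True
  assume "u \<in> tors i"
  then obtain n where "(F i ^^ n) u = 0" by (auto simp: tors_def)
  from F_pow_E[OF this] show ?thesis using True unfolding tors_def by blast
next
  case False
  assume "u \<in> tors i"
  then obtain n where "(F i ^^ n) u = 0" by (auto simp: tors_def)
  then have "(F i ^^ n) (E j u) = 0" using F_pow_E_other[OF False, of n u] E_lin(3) by simp
  then show ?thesis unfolding tors_def by blast
qed

lemma qfact_nonzero: "qfact (qi D i) n \<noteq> 0"
proof -
  have "qint (qi D i) k \<noteq> 0" if "k \<ge> 1" for k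
  proof -
    have "qi D i ^ k - inverse (qi D i) ^ k = qi D i powi int k - qi D i powi (- int k)"
      by (simp add: power_int_minus power_inverse)
    then show ?thesis using qi_facts(2)[of i "int k" "- int k"] qi_facts(3)[of i] that
      by (simp add: qint_def)
  qed
  then show ?thesis by (simp add: qfact_def)
qed

text \<open>Only the coefficient of \<open>s = 0\<close> in the Serre relation matters, namely that it is nonzero.\<close>

lemma tors_F: assumes u: "u \<in> tors i" shows "F j u \<in> tors i"
proof (cases "i = j")
  case True
  then show ?thesis using u tors_F_pow_iff[where i = i and n = 1 and u = u] by simp
next
  case False
  define N where "N = nat (1 - cm i j)"
  have "F j w \<in> tors i" if "(F i ^^ n) w = 0" for n w
    using that
  proof (induction n arbitrary: w)
    case 0
    then show ?case by (simp add: F_lin tors_zero)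
  next
    case (Suc n)
    \<comment> \<open>For \<open>s \<ge> 1\<close> the vector \<open>(F i ^^ s) w\<close> is already
      killed by the power \<open>n\<close>, so the induction hypothesis covers every Serre term with
      \<open>s \<ge> 1\<close>.\<close>
    have step: "F j ((F i ^^ s) w) \<in> tors i" if "s \<ge> 1" for s
    proof (rule Suc.IH)
      have "(F i ^^ (n + s)) w = 0" by (rule F_pow_more[OF Suc.prems]) (use that in simp)
      then show "(F i ^^ n) ((F i ^^ s) w) = 0" by (simp only: funpow_add comp_apply)
    qed
    define t where "t s = scal ((- 1) ^ s * qbinom (qi D i) N s) ((F i ^^ (N - s)) (F j ((F i ^^ s) w)))" for s
    have "(\<Sum>s\<le>N. t s) = 0" unfolding t_def N_def by (rule F_serre[OF False])
    moreover have "(\<Sum>s\<le>N. t s) = t 0 + (\<Sum>s\<in>{1..N}. t s)"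
      by (simp add: atMost_atLeast0 sum.atLeast_Suc_atMost)
    moreover have "t 0 = (F i ^^ N) (F j w)"
      using qfact_nonzero[of i N] qfact_nonzero[of i 0] by (simp add: t_def qbinom_def qfact_def)
    ultimately have "(F i ^^ N) (F j w) = scal (- 1) (\<Sum>s\<in>{1..N}. t s)"
      by (simp add: vec.scale_minus_left eq_neg_iff_add_eq_0)
    moreover have "t s \<in> tors i" if "s \<in> {1..N}" for s
      unfolding t_def using step[of s] that by (intro tors_scal) (simp add: tors_F_pow_iff)
    ultimately have "(F i ^^ N) (F j w) \<in> tors i" using tors_scal tors_sum by metis
    then show ?case unfolding tors_F_pow_iff .
  qed
  then show ?thesis using u by (auto simp: tors_def)
qed

lemma tors_cases: "tors i = {0} \<or> tors i = UNIV"
  by (rule simple[OF submodule_ofI])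
     (auto intro: tors_zero tors_add tors_scal tors_E tors_F tors_K)

end

section \<open>Weights of the simple module\<close>

context km_setting
begin

text \<open>Split off the last letter \<open>t\<close>: the reflection adds a nonnegative multiple
  of \<open>al t\<close>, which the remaining element keeps positive because \<open>t\<close> is an
  ascent for it.\<close>

lemma antidominant_increase:
  assumes g: "g \<in> wgrp R" and n: "\<And>i. i \<in> R \<Longrightarrow> cpair i n \<le> 0"
  shows "\<exists>d. nonneg d \<and> g (phi n) = phi n + phi d"
  using g
proof (induction "len R g" arbitrary: g rule: less_induct)
  case less
  show ?case
  proof (cases "g = id")
    case True
    then show ?thesis by (intro exI[of _ "\<lambda>_. 0"]) (simp add: nonneg_def phi_def fun_eq_iff)
  next
    case False
    then obtain t v where t: "t \<in> R" "v \<in> wgrp R" "g = v \<circ> refl t" "len R g = len R v + 1"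
      using last_letter[OF less.prems] by metis
    obtain d where d: "nonneg d" "v (phi n) = phi n + phi d" using less.hyps[of v] t by auto
    obtain e where e: "\<forall>i. 0 \<le> e i" "v (al t) = phi e"
      using len_ascent_pos[OF t(2,1)] t(3,4) by auto
    have "refl t (phi n) = phi n - dual_scale (of_int (cpair t n)) (al t)"
      unfolding refl_def phi_coroot ..
    then have "g (phi n) = phi n + phi d - dual_scale (of_int (cpair t n)) (phi e)"
      unfolding t(3) comp_apply using wgrp_linear[OF t(2)] d e by metis
    also have "\<dots> = phi n + phi (\<lambda>i. d i - cpair t n * e i)"
      unfolding phi_diff phi_scale by (simp only: add_diff_eq)
    finally have "g (phi n) = phi n + phi (\<lambda>i. d i - cpair t n * e i)" .
    moreover have "nonneg (\<lambda>i. d i - cpair t n * e i)"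
      unfolding nonneg_def
    proof
      fix i
      have "cpair t n * e i \<le> 0" using n[OF t(1)] e by (simp add: mult_nonpos_nonneg)
      moreover have "0 \<le> d i" using d(1) by (simp add: nonneg_def)
      ultimately show "0 \<le> d i - cpair t n * e i" by linarith
    qed
    ultimately show ?thesis by blast
  qed
qed

text \<open>A longest element makes all simple roots in \<open>R\<close> negative and so sends
  \<open>phi n\<close> into the negative cone, whereas antidominance makes the image at least
  \<open>phi n\<close>.\<close>

lemma finite_parabolic_antidominant:
  assumes fin: "finite (wgrp R)" and nn: "nonneg n" and out: "\<And>i. i \<notin> R \<Longrightarrow> n i = 0"
    and neg: "\<And>i. i \<in> R \<Longrightarrow> cpair i n \<le> 0"
  shows "n = (\<lambda>_. 0)"
proof -
  define M where "M = Max (len R ` wgrp R)"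
  have "M \<in> len R ` wgrp R" unfolding M_def using fin wgrp_id by (intro Max_in) auto
  then obtain g where g: "g \<in> wgrp R" "len R g = M" by auto
  have le: "len R g' \<le> M" if "g' \<in> wgrp R" for g' unfolding M_def using fin that by simp
  have "\<exists>e. nonneg e \<and> dual_scale (of_int (n i)) (g (al i)) = - phi e" for i
  proof (cases "i \<in> R")
    case True
    have "neg_at g i"
      using len_descent_neg[OF g(1) True] le[OF wgrp_comp[OF g(1) wgrp_refl[OF True]]] g(2) by simp
    then obtain c where c: "\<forall>k. 0 \<le> c k" "g (al i) = - phi c" by (auto simp: neg_at_def)
    have "dual_scale (of_int (n i)) (g (al i)) = - phi (\<lambda>k. n i * c k)"
      unfolding phi_scale c by (simp add: dual_scale_def fun_eq_iff)
    moreover have "nonneg (\<lambda>k. n i * c k)" using c nn by (simp add: nonneg_def)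
    ultimately show ?thesis by blast
  next
    case False
    then have "dual_scale (of_int (n i)) (g (al i)) = - phi (\<lambda>_. 0)"
      using out by (simp add: dual_scale_def phi_def fun_eq_iff)
    then show ?thesis by (intro exI[of _ "\<lambda>_. 0"]) (simp add: nonneg_def)
  qed
  then obtain e where e: "\<And>i. nonneg (e i)" "\<And>i. dual_scale (of_int (n i)) (g (al i)) = - phi (e i)"
    by metis
  have "g (phi n) = - phi (\<lambda>k. \<Sum>i\<in>UNIV. e i k)"
    unfolding wgrp_phi_sum[OF g(1)] e phi_sum by (rule sum_negf)
  moreover obtain d where d: "nonneg d" "g (phi n) = phi n + phi d"
    using antidominant_increase[OF g(1), of n] neg by blast
  ultimately have "phi (\<lambda>k. n k + d k) = phi (\<lambda>k. - (\<Sum>i\<in>UNIV. e i k))"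
    unfolding phi_add phi_minus by simp
  then have eq: "n k + d k = - (\<Sum>i\<in>UNIV. e i k)" for k
    unfolding phi_inj by (rule fun_cong)
  have "n k = 0" for k
  proof -
    have "0 \<le> (\<Sum>i\<in>UNIV. e i k)" using e(1) by (auto simp: nonneg_def intro: sum_nonneg)
    moreover have "0 \<le> n k" "0 \<le> d k" using nn d(1) by (auto simp: nonneg_def)
    ultimately show ?thesis using eq[of k] by linarith
  qed
  then show ?thesis by blast
qed

end

context km_hw
begin

section \<open>Integrability and stability of the weights under the parabolic Weyl group\<close>

abbreviation "JJ \<equiv> integrability D act (qwt D lam)"

lemma zero_wts: "(\<lambda>_. 0) \<in> wts"
  using wtsI[OF v0_wsp v0_nonzero] .

lemma lam_zero: "lam - phi (\<lambda>_. 0) = lam"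
  by (simp add: phi_def fun_eq_iff)

lemma weight_space_lam: "weight_space D act (qwt D lam) = wsp (\<lambda>_. 0)"
  unfolding wsp_eq lam_zero ..

lemma fi_orbit_eq:
  "fi_orbit D act (qwt D lam) i
    = {(\<Sum>k\<le>n. scal (c k) ((F i ^^ k) v)) | (n :: nat) c v. v \<in> wsp (\<lambda>_. 0)}"
proof -
  have "act (uq_class D (\<Sum>k\<le>n. const (c k) * gen (Fg i) ^ k)) v = (\<Sum>k\<le>n. scal (c k) ((F i ^^ k) v))"
    for n :: nat and c v
    unfolding op_def[symmetric] scal_op
    by (subst op_sum) (simp_all add: A_closed A_const A_power A_gen op_mult op_power)
  then show ?thesis unfolding fi_orbit_def weight_space_lam by simp
qed

text \<open>The vectors have pairwise distinct weights.\<close>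

lemma F_pow_v0_inj:
  assumes "\<And>k. (F i ^^ k) v0 \<noteq> 0"
  shows "inj (\<lambda>k. (F i ^^ k) v0)" "vec.independent (range (\<lambda>k. (F i ^^ k) v0))"
proof -
  define w where "w k = (\<lambda>j. if j = i then int k else 0)" for k
  have w: "(F i ^^ k) v0 \<in> wsp (w k)" for k
  proof -
    have "(\<lambda>_. 0)(i := (\<lambda>_. 0) i + int k) = w k" by (auto simp: w_def)
    then show ?thesis using F_pow_wsp[OF v0_wsp, of k i] by metis
  qed
  have wi: "w k \<noteq> w l" if "k \<noteq> l" for k l using that by (auto simp: w_def fun_eq_iff)
  have zero: "a k = 0"
    if "finite S" "(\<Sum>k\<in>S. scal (a k) ((F i ^^ k) v0)) = 0" "k \<in> S" for S a k
  proof -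
    have "scal (a k) ((F i ^^ k) v0) = 0"
    proof (rule weight_indep[where \<psi> = "\<lambda>k. chr (w k)", OF that(1) _ _ that(2,3)])
      show "K h (scal (a x) ((F i ^^ x) v0)) = scal (chr (w x) h) (scal (a x) ((F i ^^ x) v0))" if "h \<in> PV" for x h
        using wsp_closed(3)[OF w, of "a x" x] that by (simp add: wsp_def)
      show "\<exists>h\<in>PV. chr (w x) h \<noteq> chr (w y) h" if "x \<noteq> y" for x y
        using chr_distinct wi that by blast
    qed
    then show ?thesis using assms by simp
  qed
  show inj: "inj (\<lambda>k. (F i ^^ k) v0)"
  proof (rule injI, rule ccontr)
    fix k l assume e: "(F i ^^ k) v0 = (F i ^^ l) v0" and kl: "k \<noteq> l"
    have "(\<Sum>j\<in>{k, l}. scal (if j = k then 1 else - 1) ((F i ^^ j) v0)) = 0"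
      using kl e by (simp add: vec.scale_minus_left)
    from zero[OF _ this, of k] show False by simp
  qed
  show "vec.independent (range (\<lambda>k. (F i ^^ k) v0))"
  proof
    assume "vec.dependent (range (\<lambda>k. (F i ^^ k) v0))"
    then obtain T a where T: "finite T" "T \<subseteq> range (\<lambda>k. (F i ^^ k) v0)" "(\<Sum>v\<in>T. scal (a v) v) = 0" "\<exists>v\<in>T. a v \<noteq> 0"
      unfolding vec.dependent_explicit by blast
    obtain S where S: "finite S" "T = (\<lambda>k. (F i ^^ k) v0) ` S"
      using finite_subset_image[OF T(1,2)] by blast
    have "(\<Sum>k\<in>S. scal (a ((F i ^^ k) v0)) ((F i ^^ k) v0)) = 0"
      using T(3) sum.reindex[OF inj_on_subset[OF inj subset_UNIV], of "\<lambda>v. scal (a v) v" S]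
      unfolding S(2) by (simp add: o_def)
    from zero[OF S(1) this] show False using T(4) S(2) by blast
  qed
qed

text \<open>The highest weight space is the line through \<open>v0\<close>, so the orbit in question
  is spanned by the powers of \<open>F i\<close> on \<open>v0\<close>. These are independent until
  they vanish.\<close>

lemma integrability_iff: "i \<in> JJ \<longleftrightarrow> v0 \<in> tors i"
proof
  assume "i \<in> JJ"
  then obtain B where B: "finite B" "fi_orbit D act (qwt D lam) i \<subseteq> vec.span B"
    by (auto simp: integrability_def)
  show "v0 \<in> tors i"
  proof (rule ccontr)
    assume "v0 \<notin> tors i"
    then have nz: "(F i ^^ k) v0 \<noteq> 0" for k by (auto simp: tors_def)
    have "(F i ^^ k) v0 \<in> fi_orbit D act (qwt D lam) i" for k
    proof -
      have "(\<Sum>l\<le>k. scal (if l = k then 1 else 0) ((F i ^^ l) v0)) = (\<Sum>l\<le>k. if l = k then (F i ^^ l) v0 else 0)"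
        by (intro sum.cong) auto
      also have "\<dots> = (F i ^^ k) v0" by simp
      finally have "(F i ^^ k) v0 = (\<Sum>l\<le>k. scal (if l = k then 1 else 0) ((F i ^^ l) v0))" ..
      then show ?thesis unfolding fi_orbit_eq using v0_wsp
        by (intro CollectI exI[of _ k] exI[of _ "\<lambda>l. if l = k then 1 else 0"] exI[of _ v0] conjI)
    qed
    then have "range (\<lambda>k. (F i ^^ k) v0) \<subseteq> vec.span B" using B(2) by blast
    then have "finite (range (\<lambda>k. (F i ^^ k) v0))"
      using vec.independent_span_bound[OF B(1) F_pow_v0_inj(2)[OF nz]] by blast
    then show False using F_pow_v0_inj(1)[OF nz] finite_imageD infinite_UNIV_nat by blast
  qed
next
  assume "v0 \<in> tors i"
  then obtain N where N: "(F i ^^ N) v0 = 0" by (auto simp: tors_def)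
  define B where "B = (\<lambda>k. (F i ^^ k) v0) ` {..<N}"
  have F: "(F i ^^ k) v0 \<in> vec.span B" for k
  proof (cases "k < N")
    case True
    then show ?thesis unfolding B_def by (intro vec.span_base) blast
  next
    case False
    then have "(F i ^^ k) v0 = 0" using F_pow_more[OF N, of k] by simp
    then show ?thesis by (simp only: vec.span_zero)
  qed
  have "fi_orbit D act (qwt D lam) i \<subseteq> vec.span B"
  proof
    fix x assume "x \<in> fi_orbit D act (qwt D lam) i"
    then obtain n :: nat and c v where x: "x = (\<Sum>k\<le>n. scal (c k) ((F i ^^ k) v))" "v \<in> wsp (\<lambda>_. 0)"
      unfolding fi_orbit_eq by blast
    obtain r where "v = scal r v0" using wsp_zero[OF x(2)] by blast
    then have "(F i ^^ k) v \<in> vec.span B" for k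
      using vec.span_scale[OF F] by (simp add: F_pow_lin)
    then show "x \<in> vec.span B" unfolding x(1) by (intro vec.span_sum vec.span_scale)
  qed
  then show "i \<in> JJ" unfolding integrability_def B_def by blast
qed

lemma F_nilpotent: "i \<in> JJ \<Longrightarrow> \<exists>n. (F i ^^ n) u = 0"
  using tors_cases[of i] v0_nonzero unfolding integrability_iff tors_def by blast

lemma F_injective: assumes "i \<notin> JJ" "F i u = 0" shows "u = 0"
proof -
  have "tors i = {0}" using assms tors_cases[of i] unfolding integrability_iff by blast
  moreover have "(F i ^^ 1) u = 0" using assms by simp
  then have "u \<in> tors i" unfolding tors_def by blast
  ultimately show ?thesis by blast
qed

lemma wts_wgrp:
  assumes "g \<in> wgrp JJ" "c \<in> wts"
  shows "\<exists>d\<in>wts. g (lam - phi c) = lam - phi d"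
proof -
  obtain ws where ws: "set ws \<subseteq> JJ" "g = rw ws" using assms(1) by (rule wgrpE)
  have "\<exists>d\<in>wts. rw ws (lam - phi c) = lam - phi d"
    using ws(1)
  proof (induction ws)
    case Nil
    then show ?case using assms(2) by auto
  next
    case (Cons s ws)
    then have "set ws \<subseteq> JJ" by simp
    from Cons.IH[OF this] obtain d where d: "d \<in> wts" "rw ws (lam - phi c) = lam - phi d" by blast
    have "d(s := d s + mval s d) \<in> wts" using d(1) Cons.prems by (intro wts_refl F_nilpotent) auto
    then show ?case unfolding rw_Cons comp_apply d(2) refl_wt by blast
  qed
  then show ?thesis using ws(2) by simp
qed

lemma wgrp_lam_below: "g \<in> wgrp JJ \<Longrightarrow> \<exists>c. nonneg c \<and> g lam = lam - phi c"
  using wts_wgrp[OF _ zero_wts] wts_nonneg unfolding lam_zero by blast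

lemma mval_zero: "mval i (\<lambda>_. 0) = ell i"
  by (simp add: mval_def cpair_def)

text \<open>The reflection of the weight \<open>lam\<close> at an integrable \<open>i\<close> is
  again a weight, and its depth at \<open>i\<close> is \<open>ell i\<close>.\<close>

lemma ell_nonneg: assumes "i \<in> JJ" shows "0 \<le> ell i"
proof -
  have "(\<lambda>_. 0)(i := (\<lambda>_. 0) i + mval i (\<lambda>_. 0)) \<in> wts"
    by (rule wts_refl[OF zero_wts F_nilpotent[OF assms]])
  from wts_nonneg[OF this] have "0 \<le> ((\<lambda>_. 0)(i := (\<lambda>_. 0) i + mval i (\<lambda>_. 0))) i"
    unfolding nonneg_def by blast
  then show ?thesis by (simp add: mval_zero)
qed

text \<open>Symmetry of the bilinear form on the root lattice with Gram matrix DA.\<close>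

lemma symmetrized_cpair:
  "(\<Sum>i\<in>UNIV. symd D i * a i * cpair i b) = (\<Sum>i\<in>UNIV. symd D i * b i * cpair i a)"
proof -
  have "(\<Sum>i\<in>UNIV. symd D i * a i * cpair i b) = (\<Sum>i\<in>UNIV. \<Sum>k\<in>UNIV. a i * b k * (symd D i * cm i k))"
    by (simp add: cpair_def sum_distrib_left algebra_simps)
  also have "\<dots> = (\<Sum>k\<in>UNIV. \<Sum>i\<in>UNIV. a i * b k * (symd D i * cm i k))"
    by (rule sum.swap)
  also have "\<dots> = (\<Sum>k\<in>UNIV. \<Sum>i\<in>UNIV. a i * b k * (symd D k * cm k i))"
    by (simp only: cartan_props(5))
  also have "\<dots> = (\<Sum>k\<in>UNIV. symd D k * b k * cpair k a)"
    by (simp add: cpair_def sum_distrib_left algebra_simps)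
  finally show ?thesis .
qed

text \<open>
  Take a weight \<open>lam - phi b\<close> above \<open>lam - phi c\<close> which is as low as possible. If \<open>b \<noteq> c\<close>, then
  by the symmetrized Cartan matrix \<open>lam\<close> is orthogonal to the simple coroots in the support of
  \<open>c - b\<close>, which hence generate a finite group, although \<open>c - b\<close> is antidominant.
\<close>

lemma dominant_wts:
  assumes stab: "finite {g \<in> wgrp JJ. g lam = lam}"
    and c: "nonneg c" and dom: "\<And>i. i \<in> JJ \<Longrightarrow> 0 \<le> mval i c"
  shows "c \<in> wts"
proof -
  define S where "S = {b. nonneg b \<and> (\<forall>i. b i \<le> c i) \<and> b \<in> wts}"
  have "finite S" unfolding S_def by (rule finite_subset[OF _ finite_bounded_nonneg[of c]]) blast
  moreover have "(\<lambda>_. 0) \<in> S" using c zero_wts by (simp add: S_def nonneg_def)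
  ultimately have "Max ((\<lambda>b. \<Sum>i\<in>UNIV. b i) ` S) \<in> (\<lambda>b. \<Sum>i\<in>UNIV. b i) ` S"
    by (intro Max_in) auto
  then obtain b where b: "b \<in> S" "Max ((\<lambda>b. \<Sum>i\<in>UNIV. b i) ` S) = (\<Sum>i\<in>UNIV. b i)" by blast
  have bmax: "(\<Sum>i\<in>UNIV. b' i) \<le> (\<Sum>i\<in>UNIV. b i)" if "b' \<in> S" for b'
    unfolding b(2)[symmetric] using \<open>finite S\<close> that by (intro Max_ge) auto
  have bp: "nonneg b" "b i \<le> c i" "b \<in> wts" for i using b(1) by (auto simp: S_def)
  define R where "R = {i. b i < c i}"
  define n where "n = (\<lambda>i. c i - b i)"
  have maximal: "b(i := b i + 1) \<notin> wts" if "i \<in> R" for i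
  proof
    assume "b(i := b i + 1) \<in> wts"
    moreover have "nonneg (b(i := b i + 1))" using bp(1) by (auto simp: nonneg_def)
    moreover have "\<forall>k. (b(i := b i + 1)) k \<le> c k" using bp(2) that by (auto simp: R_def)
    ultimately have "b(i := b i + 1) \<in> S" unfolding S_def by blast
    then have "(\<Sum>k\<in>UNIV. (b(i := b i + 1)) k) \<le> (\<Sum>k\<in>UNIV. b k)" by (rule bmax)
    moreover have "(\<Sum>k\<in>UNIV. (b(i := b i + 1)) k) = (\<Sum>k\<in>UNIV. b k + (if k = i then 1 else 0))"
      by (intro sum.cong) auto
    ultimately show False by (simp add: sum.distrib)
  qed
  \<comment> \<open>For \<open>i\<close> outside \<open>JJ\<close> the operator \<open>F i\<close>
    is injective and would lower \<open>b\<close> further.\<close>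
  have RJ: "i \<in> JJ" if "i \<in> R" for i
  proof (rule ccontr)
    assume i: "i \<notin> JJ"
    obtain u where u: "u \<in> wsp b" "u \<noteq> 0" using bp(3) by (auto simp: wts_def)
    then have "F i u \<noteq> 0" using F_injective[OF i] by blast
    then have "b(i := b i + 1) \<in> wts" using wtsI[OF F_wsp[OF u(1)]] by blast
    then show False using maximal that by blast
  qed
  have mb: "mval i b \<le> 0" if "i \<in> R" for i
  proof (rule ccontr)
    assume "\<not> ?thesis"
    then have "b(i := b i + int 1) \<in> wts" by (intro wts_down[OF bp(3)]) simp
    then show False using maximal[OF that] by simp
  qed
  have cn: "cpair i n \<le> 0" if "i \<in> R" for i
    using mb[OF that] dom[OF RJ[OF that]] unfolding n_def cpair_diff mval_def by simp
  \<comment> \<open>Cutting \<open>b\<close> down to \<open>R\<close> only drops nonpositive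
    off-diagonal terms from \<open>cpair i b\<close> for \<open>i\<close> in \<open>R\<close>, hence
    \<open>ell i \<le> cpair i b \<le> cpair i bR\<close>.\<close>
  define bR where "bR = (\<lambda>k. if k \<in> R then b k else 0)"
  have cb: "ell i \<le> cpair i bR" if i: "i \<in> R" for i
  proof -
    have "cpair i b \<le> cpair i bR" unfolding cpair_def
    proof (rule sum_mono)
      fix k
      show "cm i k * b k \<le> cm i k * bR k"
      proof (cases "k \<in> R")
        case False
        then have "cm i k \<le> 0" using i cartan_props(2)[of i k] by blast
        moreover have "0 \<le> b k" using bp(1) by (simp add: nonneg_def)
        ultimately show ?thesis using False by (simp add: bR_def mult_nonpos_nonneg)
      qed (simp add: bR_def)
    qed
    moreover have "ell i \<le> cpair i b" using mb[OF i] by (simp add: mval_def)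
    ultimately show ?thesis by linarith
  qed
  have n0: "n i = 0" if "i \<notin> R" for i using that bp(2)[of i] by (simp add: n_def R_def)
  have npos: "n i > 0" if "i \<in> R" for i using that by (simp add: n_def R_def)
  have d: "symd D i > 0" for i by (rule cartan_props)
  \<comment> \<open>The form pairing \<open>n\<close> with \<open>bR\<close> is a sum of nonnegative
    terms when expanded along \<open>n\<close> and of nonpositive terms when expanded along
    \<open>bR\<close>. So all terms vanish, and \<open>0 \<le> ell i \<le> cpair i bR = 0\<close> on
    \<open>R\<close>.\<close>
  have trm: "0 \<le> symd D i * n i * cpair i bR" for i
  proof (cases "i \<in> R")
    case True
    then have "0 \<le> cpair i bR" using cb[OF True] ell_nonneg[OF RJ[OF True]] by linarith
    then show ?thesis using npos[OF True] d[of i] by simp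
  qed (simp add: n0)
  have "(\<Sum>i\<in>UNIV. symd D i * bR i * cpair i n) \<le> 0"
  proof (rule sum_nonpos)
    fix i
    have "0 \<le> bR i" using bp(1) by (simp add: bR_def nonneg_def)
    then show "symd D i * bR i * cpair i n \<le> 0"
      using cn[of i] d[of i] by (cases "i \<in> R") (auto simp: bR_def intro!: mult_nonneg_nonpos)
  qed
  then have "(\<Sum>i\<in>UNIV. symd D i * n i * cpair i bR) = 0"
    using symmetrized_cpair[of n bR] trm by (intro order_antisym sum_nonneg) auto
  then have "symd D i * n i * cpair i bR = 0" for i
    using trm sum_nonneg_eq_0_iff[of UNIV "\<lambda>i. symd D i * n i * cpair i bR"] by simp
  then have "cpair i bR = 0" if "i \<in> R" for i
    using npos[OF that] d[of i] by (metis mult_eq_0_iff less_irrefl)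
  then have ell0: "ell i = 0" if "i \<in> R" for i
    using cb[OF that] ell_nonneg[OF RJ[OF that]] that by force
  have fix_lam: "g lam = lam" if gR: "g \<in> wgrp R" for g
  proof -
    obtain ws where ws: "set ws \<subseteq> R" "g = rw ws" using gR by (rule wgrpE)
    have "refl i lam = lam" if "i \<in> R" for i
      using lam_co[of i] ell0[OF that] by (simp add: refl_def dual_scale_def fun_eq_iff)
    then show ?thesis unfolding ws(2) using ws(1) by (induction ws) auto
  qed
  have "wgrp R \<subseteq> {g \<in> wgrp JJ. g lam = lam}" using fix_lam wgrp_mono[of R JJ] RJ by blast
  then have "finite (wgrp R)" using stab by (rule finite_subset)
  then have "n = (\<lambda>_. 0)"
    by (rule finite_parabolic_antidominant) (use bp(2) n0 cn in \<open>auto simp: nonneg_def n_def\<close>)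
  then have "c i = b i" for i by (metis n_def eq_iff_diff_eq_0)
  then have "c = b" by blast
  then show ?thesis using bp(3) by blast
qed

text \<open>The orbit element of least total depth is dominant: a reflection changes the total depth
  by \<open>mval i d\<close>, and every depth in the orbit is nonnegative. Stability of the weights
  then leads back to \<open>c\<close>.\<close>

lemma bounded_orbit_wts:
  assumes stab: "finite {g \<in> wgrp JJ. g lam = lam}"
    and bd: "\<And>g. g \<in> wgrp JJ \<Longrightarrow> \<exists>d. nonneg d \<and> g (lam - phi c) = lam - phi d"
  shows "c \<in> wts"
proof -
  define P where "P d \<longleftrightarrow> nonneg d \<and> (\<exists>g\<in>wgrp JJ. g (lam - phi c) = lam - phi d)" for d
  have "\<exists>d. P d" using bd[OF wgrp_id] wgrp_id unfolding P_def by blast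
  then obtain d where d: "P d" "\<And>d'. P d' \<Longrightarrow> nat (\<Sum>i\<in>UNIV. d i) \<le> nat (\<Sum>i\<in>UNIV. d' i)"
    using ex_has_least_nat[of P _ "\<lambda>d. nat (\<Sum>i\<in>UNIV. d i)"] by blast
  obtain g where g: "nonneg d" "g \<in> wgrp JJ" "g (lam - phi c) = lam - phi d"
    using d(1) by (auto simp: P_def)
  have dom: "0 \<le> mval i d" if i: "i \<in> JJ" for i
  proof -
    define d' where "d' = d(i := d i + mval i d)"
    have gi: "refl i \<circ> g \<in> wgrp JJ" using g i by (intro wgrp_comp wgrp_refl)
    have e: "(refl i \<circ> g) (lam - phi c) = lam - phi d'"
      unfolding comp_apply g(3) refl_wt d'_def ..
    then obtain d'' where "nonneg d''" "lam - phi d' = lam - phi d''" using bd[OF gi] by metis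
    then have nn: "nonneg d'" by (simp add: phi_inj)
    then have "P d'" unfolding P_def using gi e by blast
    from d(2)[OF this] have "nat (\<Sum>i\<in>UNIV. d i) \<le> nat (\<Sum>i\<in>UNIV. d' i)" .
    moreover have "0 \<le> (\<Sum>i\<in>UNIV. d' i)" using nn by (simp add: nonneg_def sum_nonneg)
    moreover have "(\<Sum>k\<in>UNIV. d' k) = (\<Sum>k\<in>UNIV. d k + (if k = i then mval i d else 0))"
      unfolding d'_def by (intro sum.cong) auto
    then have "(\<Sum>k\<in>UNIV. d' k) = (\<Sum>k\<in>UNIV. d k) + mval i d" by (simp add: sum.distrib)
    ultimately show ?thesis by linarith
  qed
  have "d \<in> wts" by (rule dominant_wts[OF stab g(1) dom])
  obtain h where h: "h \<in> wgrp JJ" "h \<circ> g = id" using g(2) by (rule wgrp_inverse)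
  obtain e where e: "e \<in> wts" "h (lam - phi d) = lam - phi e" using wts_wgrp[OF h(1) \<open>d \<in> wts\<close>] by blast
  have "lam - phi c = lam - phi e" using h(2) g(3) e(2) by (metis comp_apply id_apply)
  then show ?thesis using e(1) by (simp add: phi_inj)
qed

section \<open>Comparison of the two sides\<close>

lemma weight_space_nonzero_iff:
  assumes \<mu>: "\<mu> \<in> weight_lattice D" and stab: "finite {g \<in> wgrp JJ. g lam = lam}"
  shows "weight_space D act (qwt D \<mu>) \<noteq> {0} \<longleftrightarrow> (\<forall>g\<in>wgrp JJ. \<exists>c. nonneg c \<and> g \<mu> = lam - phi c)"
proof
  assume "weight_space D act (qwt D \<mu>) \<noteq> {0}"
  moreover have "0 \<in> weight_space D act (qwt D \<mu>)" unfolding weight_space_qwt by (simp add: K_lin)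
  ultimately obtain u where u: "u \<noteq> 0" "\<And>h. h \<in> PV \<Longrightarrow> K h u = scal (qvar powi ipair h \<mu>) u"
    unfolding weight_space_qwt by blast
  obtain c where c: "\<forall>h\<in>PV. qvar powi ipair h \<mu> = chr c h"
    using weight_vector_char[OF u] by blast
  have "\<mu> = lam - phi c"
  proof (rule dual_eqI)
    fix h assume h: "h \<in> PV"
    then have "ipair h \<mu> = ipair h (lam - phi c)" using c by (simp add: chr_def qvar_powi_inj)
    moreover have "of_int (ipair h \<mu>) = \<mu> h" using \<mu> h by (intro of_int_ipair) (simp add: weight_lattice_def)
    ultimately show "\<mu> h = (lam - phi c) h" using ipair_wt[OF h, of c] by simp
  qed (use \<mu> weight_lattice_shift[OF lam, of c] in \<open>simp_all add: weight_lattice_def\<close>)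
  moreover have "u \<in> wsp c" using u(2) c by (simp add: wsp_def)
  then have "c \<in> wts" using u(1) by (rule wtsI)
  ultimately show "\<forall>g\<in>wgrp JJ. \<exists>c. nonneg c \<and> g \<mu> = lam - phi c"
    using wts_wgrp wts_nonneg by blast
next
  assume bd: "\<forall>g\<in>wgrp JJ. \<exists>c. nonneg c \<and> g \<mu> = lam - phi c"
  then obtain c where "id \<mu> = lam - phi c" using wgrp_id by blast
  then have c: "\<mu> = lam - phi c" by simp
  have "c \<in> wts" using bounded_orbit_wts[OF stab] bd unfolding c by blast
  then show "weight_space D act (qwt D \<mu>) \<noteq> {0}" unfolding wts_def wsp_eq c by auto
qed

text \<open>\<open>weight_vector_char\<close> identifies the values of \<open>m\<close> on the
  elements \<open>q^h\<close>, and by linearity these determine a homomorphism on the torus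
  algebra.\<close>

lemma weights_integral:
  assumes m: "m \<in> weights D" and nz: "weight_space D act m \<noteq> {0}"
  shows "m \<in> integral_weights D"
proof -
  have "0 \<in> weight_space D act m"
    unfolding weight_space_def op_def[symmetric] by (simp add: K_lin)
  then obtain u where u: "u \<noteq> 0" "u \<in> weight_space D act m" using nz by blast
  obtain c where c: "\<forall>h\<in>PV. m (Poly_Mapping.single h 1) = chr c h"
    using weight_vector_char[OF u(1), of "\<lambda>h. m (Poly_Mapping.single h 1)"] u(2)
    unfolding weight_space_def op_def by blast
  have madd: "m (p + p') = m p + m p'" and mconst: "m (const r * p) = r * m p"
    if "p \<in> torus_algebra D" "p' \<in> torus_algebra D" for p p' r
    using m that by (auto simp: weights_def)
  have t0: "0 \<in> torus_algebra D" by (simp add: torus_algebra_def)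
  have m0: "m 0 = 0" using mconst[OF t0 t0, of 0] by simp
  have single: "m (Poly_Mapping.single h r) = r * chr c h" "Poly_Mapping.single h r \<in> torus_algebra D"
    if "h \<in> PV" for h r
  proof -
    have "Poly_Mapping.single h r = const r * Poly_Mapping.single h 1"
      by (simp add: const_def mult_single)
    moreover have "Poly_Mapping.single h 1 \<in> torus_algebra D" using that by (simp add: torus_algebra_def)
    ultimately show "m (Poly_Mapping.single h r) = r * chr c h"
      using mconst[of "Poly_Mapping.single h 1" 0 r] t0 c that by simp
    show "Poly_Mapping.single h r \<in> torus_algebra D" using that by (simp add: torus_algebra_def)
  qed
  have "m = qwt D (lam - phi c)"
  proof (rule extensionalityI[of _ "torus_algebra D"])
    show "m \<in> extensional (torus_algebra D)" using m by (simp add: weights_def)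
    show "qwt D (lam - phi c) \<in> extensional (torus_algebra D)" by (simp add: qwt_def)
    fix p assume p: "p \<in> torus_algebra D"
    define f where "f h = Poly_Mapping.single h (Poly_Mapping.lookup p h)" for h
    have "m (\<Sum>h\<in>S. f h) = (\<Sum>h\<in>S. Poly_Mapping.lookup p h * chr c h) \<and> (\<Sum>h\<in>S. f h) \<in> torus_algebra D"
      if "S \<subseteq> PV" for S
      using that
    proof (induction S rule: infinite_finite_induct)
      case (insert x S)
      have fx: "m (f x) = Poly_Mapping.lookup p x * chr c x" "f x \<in> torus_algebra D"
        using single[of x] insert.prems by (simp_all add: f_def)
      have "f x + (\<Sum>h\<in>S. f h) \<in> torus_algebra D"
        using fx(2) insert Poly_Mapping.keys_add[of "f x" "\<Sum>h\<in>S. f h"] unfolding torus_algebra_def by blast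
      then show ?case using insert fx madd[OF fx(2), of "\<Sum>h\<in>S. f h"] by simp
    qed (simp_all add: m0 t0)
    from this[of "Poly_Mapping.keys p"] p
    have "m (\<Sum>h\<in>Poly_Mapping.keys p. f h) = (\<Sum>h\<in>Poly_Mapping.keys p. Poly_Mapping.lookup p h * chr c h)"
      by (simp add: torus_algebra_def)
    moreover have "(\<Sum>h\<in>Poly_Mapping.keys p. f h) = p"
      unfolding f_def by (rule poly_mapping_sum_single[symmetric])
    ultimately show "m p = qwt D (lam - phi c) p" using p by (simp add: qwt_def chr_def)
  qed
  then show ?thesis using weight_lattice_shift[OF lam] by (simp add: integral_weights_def)
qed

lemma formal_sum:
  assumes "finite {w \<in> parabolic_weyl D JJ. w lam = lam}"
  shows "is_formal_sum D (weyl_summand D lam) (parabolic_weyl D JJ) (wt_char D act)"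
  unfolding is_formal_sum_def
proof
  fix \<mu> assume \<mu>: "\<mu> \<in> weight_lattice D"
  have ld: "lam \<in> dual_space D" using lam by (simp add: weight_lattice_def)
  have "rst ` {g \<in> wgrp JJ. g lam = lam} \<subseteq> {w \<in> parabolic_weyl D JJ. w lam = lam}"
    using ld by (auto simp: parabolic_weyl_eq rst_def)
  then have "finite (rst ` {g \<in> wgrp JJ. g lam = lam})" using assms by (rule finite_subset)
  \<comment> \<open>Injectivity of \<open>rst\<close> carries finiteness from the bijection group
    back to maps on all functions.\<close>
  then have stab: "finite {g \<in> wgrp JJ. g lam = lam}"
    by (rule finite_imageD) (rule inj_on_subset[OF rst_inj], blast)
  define G where "G = {g \<in> wgrp JJ. eps lam g \<mu> \<noteq> 0}"
  have fin: "finite G" unfolding G_def by (rule finite_eps) (use wgrp_lam_below stab in blast)+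
  have set: "{w \<in> parabolic_weyl D JJ. weyl_summand D lam w \<mu> \<noteq> 0} = rst ` G"
    unfolding G_def parabolic_weyl_eq using weyl_summand_eq[OF _ ld] by auto
  have inj: "inj_on rst G" by (rule inj_on_subset[OF rst_inj]) (auto simp: G_def)
  have "(\<Sum>w\<in>rst ` G. weyl_summand D lam w \<mu>) = (\<Sum>g\<in>G. weyl_summand D lam (rst g) \<mu>)"
    using sum.reindex[OF inj] by (simp add: o_def)
  also have "\<dots> = weyl_sum JJ lam \<mu>"
    unfolding weyl_sum_def G_def using weyl_summand_eq[OF _ ld] by (intro sum.cong) auto
  also have "\<dots> = wt_char D act \<mu>"
  proof -
    have "weyl_sum JJ lam \<mu> = (if \<forall>g\<in>wgrp JJ. \<exists>c. nonneg c \<and> g \<mu> = lam - phi c then 1 else 0)"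
    proof (rule weyl_sum_eq[OF _ _ stab])
      show "lam (co i) \<in> \<int>" for i using lam_co[of i] by simp
    qed (rule wgrp_lam_below)
    then show ?thesis unfolding wt_char_def using weight_space_nonzero_iff[OF \<mu> stab] by simp
  qed
  finally show "finite {x \<in> parabolic_weyl D JJ. weyl_summand D lam x \<mu> \<noteq> 0} \<and>
    wt_char D act \<mu> = (\<Sum>x\<in>{x \<in> parabolic_weyl D JJ. weyl_summand D lam x \<mu> \<noteq> 0}. weyl_summand D lam x \<mu>)"
    unfolding set using fin by simp
qed

end

theorem theorem9p16:
  fixes D :: "('i::finite, 'h::ab_group_add) km_datum"
    and act :: "('i, 'h) uq_gen falg set \<Rightarrow> 'v \<Rightarrow> 'v::ab_group_add"
    and lam :: "'h \<Rightarrow> complex"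
  assumes "symmetrizable_km_datum D"
    and "lam \<in> weight_lattice D"
    and "simple_highest_weight_module D act (qwt D lam)"
    and "finite {w \<in> parabolic_weyl D (integrability D act (qwt D lam)). qwt D (w lam) = qwt D lam}"
  shows "(\<forall>m\<in>weights D. weight_space D act m \<noteq> {0} \<longrightarrow> m \<in> integral_weights D) \<and>
         is_formal_sum D (weyl_summand D lam) (parabolic_weyl D (integrability D act (qwt D lam)))
           (wt_char D act)"
proof -
  obtain v0 where v0: "v0 \<in> weight_space D act (qwt D lam)" "v0 \<noteq> 0"
    "\<And>i. act (uq_class D (gen (Eg i))) v0 = 0"
    using assms(3) by (auto simp: simple_highest_weight_module_def highest_weight_module_def)
  interpret km_setting D by unfold_locales (rule assms(1))
  interpret km_module D act
    by unfold_locales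
       (use assms(3) in \<open>simp add: simple_highest_weight_module_def highest_weight_module_def\<close>)
  interpret km_hw D act lam v0
    by unfold_locales
       (use assms(2,3) v0 in \<open>auto simp: simple_highest_weight_module_def simple_left_module_def op_def\<close>)
  \<comment> \<open>An element fixing \<open>lam\<close> also fixes its exponential
    \<open>qwt D lam\<close>, so this stabilizer lies in the finite one.\<close>
  have "finite {w \<in> parabolic_weyl D JJ. w lam = lam}"
    by (rule finite_subset[OF _ assms(4)]) auto
  then show ?thesis using formal_sum weights_integral by blast
qed

end
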